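(* Let $\Omega\subset\mathbb{R}^N$ ($N\ge2$) be bounded, open and smooth, $T>0$, $Q=\Omega\times(0,T)$, $\Gamma=\partial\Omega\times(0,T)$, $2-\frac{1}{N+1}<p<N$, and $a:\Omega\times(0,T)\times\mathbb{R}^N\to\mathbb{R}^N$ Carathéodory with, for a.e. $(x,t)\in Q$ and all $\xi\neq\eta$, $a(x,t,\xi)\cdot\xi\ge\alpha|\xi|^p$, $|a(x,t,\xi)|\le\beta|\xi|^{p-1}$, $(a(x,t,\xi)-a(x,t,\eta))\cdot(\xi-\eta)>0$ ($\alpha,\beta>0$). Let $h:[0,\infty)\to[0,\infty]$ be continuous, finite on $(0,\infty)$, $h(0)\ne0$, with $h(s)\le Cs^{-\gamma}$ for $0<s\le s_0$ (some $\gamma\ge0$, $C,s_0>0$), $h$ bounded on $[s_0,\infty)$, and assume moreover that $h$ is nonincreasing. Let $f\in L^1(Q)$ and $u_0\in L^1(\Omega)$ be nonnegative. Then there is at most one finite energy solution of $$u_t-\operatorname{div}(a(x,t,\nabla u))=h(u)f \text{ in }Q,\quad u=0\text{ on }\Gamma,\quad u(x,0)=u_0(x)\text{ in }\Omega.$$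
   Context: A distributional solution is $u\in L^1(0,T;W^{1,1}_{\rm loc}(\Omega))$ with $|a(x,t,\nabla u)|,\ h(u)f\in L^1(0,T;L^1_{\rm loc}(\Omega))$, such that $\lim_{\epsilon\to0}\frac1\epsilon\int_{\Omega_\epsilon}T_k(u(x,t))\,dx=0$ for a.e. $t\in(0,T)$ and all $k>0$ (with $\Omega_\epsilon=\{x\in\Omega:\operatorname{dist}(x,\partial\Omega)<\epsilon\}$, $T_k(s)=\max(-k,\min(s,k))$), and $-\int_Q u\varphi_t-\int_\Omega u_0\varphi(x,0)+\int_Q a(x,t,\nabla u)\cdot\nabla\varphi=\int_Q h(u)f\varphi$ for all $\varphi\in C^1_c(\Omega\times[0,T))$. A finite energy solution is a distributional solution $u$ with $u\in L^p(0,T;W^{1,p}_0(\Omega))$ and $u_t\in L^{p'}(0,T;W^{-1,p'}(\Omega))+L^1(Q)$, $p'=p/(p-1)$. *)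

theory Defs
  imports "HOL-Analysis.Analysis"
begin

text \<open>Gradient of a real-valued function (meaningful where the function is differentiable).\<close>
definition grad :: "('a::real_inner \<Rightarrow> real) \<Rightarrow> 'a \<Rightarrow> 'a" where
  "grad f x = (SOME D. GDERIV f x :> D)"

definition csupp :: "('a::topological_space \<Rightarrow> real) \<Rightarrow> 'a set" where
  "csupp f = closure {x. f x \<noteq> 0}"

text \<open>C^infinity on an open set U: f has continuous partial derivatives of all orders,
  i.e. f lies in a family of functions that are continuous on U and closed under taking
  partial derivatives along the standard basis directions.\<close>
definition smooth_on :: "'a::euclidean_space set \<Rightarrow> ('a \<Rightarrow> real) \<Rightarrow> bool" where
  "smooth_on U f \<longleftrightarrow> (\<exists>F. f \<in> F \<and> (\<forall>g\<in>F. continuous_on U g \<and>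
      (\<forall>b\<in>Basis. \<exists>g'\<in>F. \<forall>x\<in>U. ((\<lambda>s. g (x + s *\<^sub>R b)) has_real_derivative g' x) (at 0))))"

definition C1 :: "('a::euclidean_space \<Rightarrow> real) \<Rightarrow> bool" where
  "C1 f \<longleftrightarrow> (\<exists>D. continuous_on UNIV D \<and> (\<forall>x. GDERIV f x :> D x))"

definition test_fun :: "'a::euclidean_space set \<Rightarrow> ('a \<Rightarrow> real) \<Rightarrow> bool" where
  "test_fun U \<phi> \<longleftrightarrow> smooth_on UNIV \<phi> \<and> compact (csupp \<phi>) \<and> csupp \<phi> \<subseteq> U"

definition smooth_domain :: "'a::euclidean_space set \<Rightarrow> bool" where
  "smooth_domain \<Omega> \<longleftrightarrow> bounded \<Omega> \<and> open \<Omega> \<and>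
     (\<forall>x0\<in>frontier \<Omega>. \<exists>U \<rho>. open U \<and> x0 \<in> U \<and> smooth_on U \<rho> \<and>
        (\<forall>x\<in>U. (\<rho> has_derivative (\<lambda>v. grad \<rho> x \<bullet> v)) (at x) \<and> grad \<rho> x \<noteq> 0) \<and>
        \<Omega> \<inter> U = {x\<in>U. \<rho> x < 0})"

definition trunc :: "real \<Rightarrow> real \<Rightarrow> real" where
  "trunc k s = max (- k) (min s k)"

definition caratheodory :: "('a::euclidean_space \<times> real) set \<Rightarrow> ('a \<times> real \<Rightarrow> 'a \<Rightarrow> 'a) \<Rightarrow> bool" where
  "caratheodory Q a \<longleftrightarrow>
     (\<forall>\<xi>. (\<lambda>z. a z \<xi>) \<in> borel_measurable (restrict_space lebesgue Q)) \<and>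
     (AE z in lebesgue. z \<in> Q \<longrightarrow> continuous_on UNIV (a z))"

text \<open>Distributional solution; G is the (spatial, weak) gradient of u, h(u)f is the
  product in [0,\<infinity>] with convention \<infinity>\<cdot>0 = 0.\<close>
definition dist_solution ::
  "'a::euclidean_space set \<Rightarrow> real \<Rightarrow> ('a \<times> real \<Rightarrow> 'a \<Rightarrow> 'a) \<Rightarrow> (real \<Rightarrow> ennreal) \<Rightarrow>
   ('a \<times> real \<Rightarrow> real) \<Rightarrow> ('a \<Rightarrow> real) \<Rightarrow> ('a \<times> real \<Rightarrow> real) \<Rightarrow> ('a \<times> real \<Rightarrow> 'a) \<Rightarrow> bool" where
  "dist_solution \<Omega> T a h f u0 u G \<longleftrightarrow>
     u \<in> borel_measurable (restrict_space lebesgue (\<Omega> \<times> {0<..<T})) \<and>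
     G \<in> borel_measurable (restrict_space lebesgue (\<Omega> \<times> {0<..<T})) \<and>
     (AE z in lebesgue. z \<in> \<Omega> \<times> {0<..<T} \<longrightarrow> u z \<ge> 0) \<and>
     (\<forall>K. compact K \<and> K \<subseteq> \<Omega> \<longrightarrow>
        set_integrable lebesgue (K \<times> {0<..<T}) u \<and>
        set_integrable lebesgue (K \<times> {0<..<T}) (\<lambda>z. norm (G z)) \<and>
        set_integrable lebesgue (K \<times> {0<..<T}) (\<lambda>z. norm (a z (G z))) \<and>
        (\<lambda>z. h (u z) * ennreal (f z)) \<in> borel_measurable (restrict_space lebesgue (\<Omega> \<times> {0<..<T})) \<and>
        (\<integral>\<^sup>+ z. h (u z) * ennreal (f z) * indicator (K \<times> {0<..<T}) z \<partial>lebesgue) < \<infinity>) \<and>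
     (AE t in lborel. t \<in> {0<..<T} \<longrightarrow>
        (\<forall>\<phi>. test_fun \<Omega> \<phi> \<longrightarrow>
           (LINT x:\<Omega>|lebesgue. u (x, t) *\<^sub>R grad \<phi> x) = - (LINT x:\<Omega>|lebesgue. \<phi> x *\<^sub>R G (x, t)))) \<and>
     (AE t in lborel. t \<in> {0<..<T} \<longrightarrow>
        (\<forall>k>0. ((\<lambda>\<epsilon>. (1 / \<epsilon>) * (LINT x:{x\<in>\<Omega>. infdist x (frontier \<Omega>) < \<epsilon>}|lebesgue. trunc k (u (x, t))))
                 \<longlongrightarrow> 0) (at_right 0))) \<and>
     (\<forall>\<phi>. C1 \<phi> \<and> compact (csupp \<phi>) \<and> csupp \<phi> \<subseteq> \<Omega> \<times> {..<T} \<longrightarrow>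
        - (LINT z:\<Omega> \<times> {0<..<T}|lebesgue. u z * snd (grad \<phi> z))
        - (LINT x:\<Omega>|lebesgue. u0 x * \<phi> (x, 0))
        + (LINT z:\<Omega> \<times> {0<..<T}|lebesgue. a z (G z) \<bullet> fst (grad \<phi> z))
        = (LINT z:\<Omega> \<times> {0<..<T}|lebesgue. enn2real (h (u z) * ennreal (f z)) * \<phi> z))"

text \<open>Finite energy solution: u(t) \<in> W_0^{1,p}(\<Omega>) (closure of C_c^\<infinity> in W^{1,p}) for a.e. t,
  u, \<nabla>u \<in> L^p(Q), and u_t = g0 - div F + g in D'(Q) with g0, F \<in> L^{p'}(Q), g \<in> L^1(Q)
  (i.e. u_t \<in> L^{p'}(0,T;W^{-1,p'}(\<Omega>)) + L^1(Q)).\<close>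
definition finite_energy_solution ::
  "'a::euclidean_space set \<Rightarrow> real \<Rightarrow> real \<Rightarrow> ('a \<times> real \<Rightarrow> 'a \<Rightarrow> 'a) \<Rightarrow> (real \<Rightarrow> ennreal) \<Rightarrow>
   ('a \<times> real \<Rightarrow> real) \<Rightarrow> ('a \<Rightarrow> real) \<Rightarrow> ('a \<times> real \<Rightarrow> real) \<Rightarrow> bool" where
  "finite_energy_solution \<Omega> T p a h f u0 u \<longleftrightarrow> (\<exists>G.
     dist_solution \<Omega> T a h f u0 u G \<and>
     set_integrable lebesgue (\<Omega> \<times> {0<..<T}) (\<lambda>z. \<bar>u z\<bar> powr p) \<and>
     set_integrable lebesgue (\<Omega> \<times> {0<..<T}) (\<lambda>z. norm (G z) powr p) \<and>
     (AE t in lborel. t \<in> {0<..<T} \<longrightarrow>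
        (\<exists>\<phi>s :: nat \<Rightarrow> 'a \<Rightarrow> real. (\<forall>n. test_fun \<Omega> (\<phi>s n)) \<and>
           (\<lambda>n. LINT x:\<Omega>|lebesgue. \<bar>\<phi>s n x - u (x, t)\<bar> powr p) \<longlonglongrightarrow> 0 \<and>
           (\<lambda>n. LINT x:\<Omega>|lebesgue. norm (grad (\<phi>s n) x - G (x, t)) powr p) \<longlonglongrightarrow> 0)) \<and>
     (\<exists>g0 F g. g0 \<in> borel_measurable (restrict_space lebesgue (\<Omega> \<times> {0<..<T})) \<and>
        F \<in> borel_measurable (restrict_space lebesgue (\<Omega> \<times> {0<..<T})) \<and>
        set_integrable lebesgue (\<Omega> \<times> {0<..<T}) (\<lambda>z. \<bar>g0 z\<bar> powr (p / (p - 1))) \<and>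
        set_integrable lebesgue (\<Omega> \<times> {0<..<T}) (\<lambda>z. norm (F z :: 'a) powr (p / (p - 1))) \<and>
        set_integrable lebesgue (\<Omega> \<times> {0<..<T}) g \<and>
        (\<forall>\<psi>. test_fun (\<Omega> \<times> {0<..<T}) \<psi> \<longrightarrow>
           - (LINT z:\<Omega> \<times> {0<..<T}|lebesgue. u z * snd (grad \<psi> z))
           = (LINT z:\<Omega> \<times> {0<..<T}|lebesgue. g0 z * \<psi> z + F z \<bullet> fst (grad \<psi> z) + g z * \<psi> z))))"

end

theory Submission
  imports Defs
begin

text \<open>
  The difference \<open>w = u - v\<close> of two solutions, extended by zero, satisfies
  \<open>w\<^sub>t - div A = H\<close> on \<open>\<Omega> \<times> (-\<infinity>, T)\<close>, where \<open>A = a(\<nabla>u) - a(\<nabla>v)\<close> and \<open>H = (h(u) - h(v)) f\<close>: the common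
  initial datum cancels. Mollifying in space and time, multiplying by
  \<open>\<zeta>(t) \<eta>(x) S(w)\<close> with \<open>S\<close> bounded, odd and increasing, \<open>\<zeta>\<close> decreasing and \<open>\<eta>\<close> a spatial cutoff,
  and removing the mollification gives an energy identity in which the terms with \<open>A \<bullet> \<nabla>w \<ge> 0\<close> and
  \<open>S(w) H \<le> 0\<close> have a sign. What remains is the term with \<open>S(w) A \<bullet> \<nabla>\<eta>\<close>, concentrated in a boundary layer of
  width of order \<open>\<epsilon>\<close>. Points of the layer leave \<open>\<Omega>\<close> under a shift of size of order \<open>\<epsilon>\<close> in a fixed
  direction (locally), so there \<open>w\<close> is the integral of \<open>\<nabla>w\<close> over a segment of that length. With Young's inequality
  the layer term is at most a constant times the integral of \<open>|A|\<^bsup>p'\<^esup> + |\<nabla>w|\<^bsup>p\<^esup>\<close> over a slightly larger layer, which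
  tends to zero.
\<close>

section \<open>Translations and mollification\<close>

text \<open>The obstacle is that h(u) f is integrable only over compact subsets of \<Omega>, so the
  equation cannot be tested up to the lateral boundary. A cutoff is forced, its gradient has size
  1/\<epsilon>, and w has to supply a compensating factor \<epsilon>. That factor rests on
  membership in W_0^{1,p}: the zero extension of w has a weak spatial gradient on the whole space,
  across the boundary of \<Omega>. After mollification the equation is a pointwise identity between
  continuous functions, and the chain rule for S is classical. The price is the product of A and
  \<nabla>w: its mollified factors are handled through L^1 convergence only, so the passage to the
  limit uses majorants that change with the mollification radius and converge in L^1. At the final
  time the weight \<zeta>(t) = (T' - t)_+^2 with T' < T leaves room for the kernel. It is C^1, and
  -\<zeta>' = 2 (T' - t)_+ makes the time term the integral of a nonnegative function that vanishes
  before T' only where w does.\<close>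

lemma lborel_integral_translate:
  fixes f :: "'a::euclidean_space \<Rightarrow> 'b::{banach, second_countable_topology}"
  assumes [measurable]: "f \<in> borel_measurable borel"
  shows "(\<integral>x. f (x + c) \<partial>lborel) = (\<integral>x. f x \<partial>lborel)"
proof -
  have "(\<integral>x. f x \<partial>lborel) = (\<integral>x. f x \<partial>distr lborel borel ((+) c))"
    by (simp add: lborel_distr_plus)
  also have "\<dots> = (\<integral>x. f (c + x) \<partial>lborel)"
    by (rule integral_distr) auto
  finally show ?thesis by (simp add: add.commute)
qed

lemma lborel_integrable_translate:
  fixes f :: "'a::euclidean_space \<Rightarrow> 'b::{banach, second_countable_topology}"
  assumes "integrable lborel f"
  shows "integrable lborel (\<lambda>x. f (x + c))"
proof -
  have "integrable (distr lborel borel ((+) c)) f"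
    using assms by (simp add: lborel_distr_plus)
  then have "integrable lborel (\<lambda>x. f (c + x))"
    by (subst (asm) integrable_distr_eq) (use assms in \<open>auto dest: borel_measurable_integrable\<close>)
  then show ?thesis by (simp add: add.commute)
qed

lemma integrable_bounded_continuous_cball:
  fixes f :: "'a::euclidean_space \<Rightarrow> 'b::euclidean_space"
  assumes "continuous_on UNIV f" "\<And>z. norm z > R \<Longrightarrow> f z = 0"
  shows "integrable lborel f"
proof -
  have "integrable lborel (\<lambda>x. indicator (cball 0 R) x *\<^sub>R f x)"
    using borel_integrable_compact[of "cball 0 R" f] assms(1)
    by (simp add: set_integrable_def continuous_on_subset)
  moreover have "(\<lambda>x. indicator (cball 0 R) x *\<^sub>R f x) = f"
    using assms(2) by (auto simp: indicator_def fun_eq_iff not_le)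
  ultimately show ?thesis by simp
qed

lemma bounded_continuous_cball:
  fixes f :: "'a::euclidean_space \<Rightarrow> 'b::real_normed_vector"
  assumes "continuous_on UNIV f" "\<And>z. norm z > R \<Longrightarrow> f z = 0"
  obtains M where "M > 0" "\<And>z. norm (f z) \<le> M"
proof -
  have "compact (f ` cball 0 R)"
    by (intro compact_continuous_image continuous_on_subset[OF assms(1)]) auto
  then have "bounded (f ` cball 0 R)" by (rule compact_imp_bounded)
  then obtain M where M: "\<forall>x \<in> f ` cball 0 R. norm x \<le> M"
    unfolding bounded_iff ..
  have "norm (f z) \<le> max M 1" for z
    using M assms(2)[of z] by (cases "norm z \<le> R") (auto simp: le_max_iff_disj)
  then show ?thesis by (intro that[of "max M 1"]) auto
qed

lemma lborel_inner_compact: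
  fixes A :: "'a::euclidean_space set"
  assumes A: "A \<in> sets borel" "emeasure lborel A < \<infinity>" and e: "e > 0"
  obtains K where "compact K" "K \<subseteq> A" "measure lborel A < measure lborel K + e"
proof (cases "measure lborel A < e")
  case True
  then show ?thesis by (intro that[of "{}"]) auto
next
  case False
  \<comment> \<open>\<open>inner_regular\<close> needs a finite measure, so Lebesgue measure is
    first concentrated on \<open>A\<close>.\<close>
  let ?M = "density lborel (indicator A)"
  have M: "emeasure ?M B = emeasure lborel (A \<inter> B)" if "B \<in> sets borel" for B
    using that A by (simp add: emeasure_density nn_integral_indicator Int_commute
        indicator_inter_arith[symmetric])
  have "emeasure ?M A = (SUP K \<in> {K. K \<subseteq> A \<and> compact K}. emeasure ?M K)"
    using A M[of UNIV] by (intro inner_regular) auto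
  moreover have "ennreal (measure lborel A - e) < emeasure ?M A"
    using A e False M[of A] by (simp add: emeasure_eq_ennreal_measure ennreal_less_iff)
  ultimately obtain K where K: "K \<subseteq> A" "compact K" "ennreal (measure lborel A - e) < emeasure ?M K"
    by (auto simp: less_SUP_iff)
  then have "K \<in> sets borel" "A \<inter> K = K" by (auto intro: borel_compact)
  with K M[of K] have "ennreal (measure lborel A - e) < emeasure lborel K" by simp
  also have "\<dots> = ennreal (measure lborel K)"
    using emeasure_lborel_cbox_finite emeasure_compact_finite[OF K(2)]
    by (simp add: emeasure_eq_ennreal_measure)
  finally show ?thesis
    using K False by (intro that[of K]) (auto simp: ennreal_less_iff)
qed

lemma L1_translation_indicator:
  fixes A :: "'a::euclidean_space set"
  assumes A: "A \<in> sets borel" "emeasure lborel A < \<infinity>" and e: "e > 0"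
  obtains d where "d > 0"
    "\<And>y. norm y < d \<Longrightarrow> (\<integral>z. \<bar>indicator A (z + y) - indicator A z\<bar> \<partial>lborel) \<le> (e::real)"
proof -
  obtain K where K: "compact K" "K \<subseteq> A" "measure lborel A < measure lborel K + e / 4"
    using lborel_inner_compact[OF A, of "e / 4"] e by auto
  have [measurable]: "K \<in> sets borel" "A \<in> sets borel" using K A by (auto intro: borel_compact)
  have Kfin: "emeasure lborel K < \<infinity>" using emeasure_compact_finite[OF K(1)] by simp
  obtain U where U: "open U" "K \<subseteq> U" "emeasure lborel (U - K) < ennreal (e / 4)"
    using sets_lebesgue_outer_open[of K "e / 4"] e by auto
  have [measurable]: "U \<in> sets borel" using U by auto
  have U_eq: "emeasure lborel U = emeasure lborel K + emeasure lborel (U - K)"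
    using U by (subst plus_emeasure) (auto simp: Un_absorb1)
  have Ufin: "emeasure lborel U < \<infinity>"
    using Kfin U(3) unfolding U_eq by (auto simp: less_top[symmetric])
  have mU: "measure lborel U < measure lborel K + e / 4"
  proof -
    have "measure lborel (U - K) = measure lborel U - measure lborel K"
      using U Ufin Kfin by (intro measure_Diff) (auto simp: less_top[symmetric])
    moreover have "measure lborel (U - K) < e / 4"
    proof -
      have "emeasure lborel (U - K) \<noteq> \<infinity>" using U(3) by (auto simp: top_unique)
      then show ?thesis using U(3) by (simp add: emeasure_eq_ennreal_measure ennreal_less_iff)
    qed
    ultimately show ?thesis by simp
  qed
  obtain d where d: "d > 0" "(\<Union>x\<in>K. ball x d) \<subseteq> U"
    using compact_subset_open_imp_ball_epsilon_subset[of K U] U K by blast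
  note int_ind = integrable_real_indicator[OF _ Kfin] integrable_real_indicator[OF _ Ufin]
      integrable_real_indicator[OF _ A(2)]
  show ?thesis
  proof (rule that[OF d(1)])
    fix y :: 'a assume y: "norm y < d"
    \<comment> \<open>The path A(z+y), K(z+y), U(z), K(z), A(z) of indicators gives four
      differences. Each is nonnegative, the second because K shifted by -y stays in U, and each has
      integral below e/4.\<close>
    let ?B = "\<lambda>z. ((indicator A (z + y) - indicator K (z + y)) + (indicator U z - indicator K (z + y)))
        + ((indicator U z - indicator K z) + (indicator A z - indicator K z)) :: real"
    have KU: "z \<in> U" if "z + y \<in> K" for z
      using d(2) y that by (force simp: dist_norm)
    have I: "integrable lborel (indicat_real K)" "integrable lborel (indicat_real U)"
      "integrable lborel (indicat_real A)"
      "integrable lborel (\<lambda>z. indicat_real A (z + y))" "integrable lborel (\<lambda>z. indicat_real K (z + y))"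
      using int_ind by (auto intro!: lborel_integrable_translate)
    have "(\<integral>z. \<bar>indicator A (z + y) - indicator A z\<bar> \<partial>lborel) \<le> (\<integral>z. ?B z \<partial>lborel)"
    proof (rule integral_mono)
      show "integrable lborel (\<lambda>z. \<bar>indicat_real A (z + y) - indicator A z\<bar>)"
        using I by auto
      show "integrable lborel ?B"
        by (intro Bochner_Integration.integrable_add Bochner_Integration.integrable_diff I)
      show "\<bar>indicator A (z + y) - indicator A z\<bar> \<le> ?B z" for z
        using KU[of z] K(2) U(2) by (auto simp: indicator_def)
    qed
    also have "\<dots> = (measure lborel A - measure lborel K) + (measure lborel U - measure lborel K)
        + ((measure lborel U - measure lborel K) + (measure lborel A - measure lborel K))"
      using I by (simp add: lborel_integral_translate)
    also have "\<dots> \<le> e" using mU K by simp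
    finally show "(\<integral>z. \<bar>indicator A (z + y) - indicator A z\<bar> \<partial>lborel) \<le> e" .
  qed
qed

text \<open>By \<open>integrable_induct\<close> the claim reduces to indicators, sums and dominated
  limits. Banach space values are allowed because several functions are later mollified together as
  one tuple.\<close>

lemma L1_translation_continuous:
  fixes f :: "'a::euclidean_space \<Rightarrow> 'b::{banach, second_countable_topology}"
  assumes "integrable lborel f" and "e > 0"
  shows "\<exists>d>0. \<forall>y. norm y < d \<longrightarrow> (\<integral>z. norm (f (z + y) - f z) \<partial>lborel) \<le> e"
  using assms
proof (induction arbitrary: e rule: integrable_induct)
  case (base A c)
  then have A: "A \<in> sets borel" by simp
  from base have e: "e / (norm c + 1) > 0" by (simp add: add_nonneg_pos)
  obtain d where d: "d > 0" and
    le: "\<And>y. norm y < d \<Longrightarrow> (\<integral>z. \<bar>indicator A (z + y) - indicator A z\<bar> \<partial>lborel) \<le> e / (norm c + 1)"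
    using L1_translation_indicator[OF A base(2) e] by auto
  have "(\<integral>z. norm (indicator A (z + y) *\<^sub>R c - indicator A z *\<^sub>R c) \<partial>lborel) \<le> e"
    if y: "norm y < d" for y
  proof -
    have "(\<integral>z. norm (indicator A (z + y) *\<^sub>R c - indicator A z *\<^sub>R c) \<partial>lborel)
        = (\<integral>z. \<bar>indicator A (z + y) - indicator A z\<bar> \<partial>lborel) * norm c"
      by (simp add: scaleR_left_diff_distrib[symmetric])
    also have "\<dots> \<le> e / (norm c + 1) * norm c"
      by (intro mult_right_mono le y) auto
    also have "\<dots> \<le> e / (norm c + 1) * (norm c + 1)"
      using e by (intro mult_left_mono) auto
    also have "\<dots> = e" using norm_ge_zero[of c] by (simp add: add_nonneg_eq_0_iff)
    finally show ?thesis .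
  qed
  then show ?case using d by blast
next
  case (add f g)
  from add.IH(1)[of "e/2"] add.IH(2)[of "e/2"] \<open>e > 0\<close> obtain d1 d2 where
    d: "d1 > 0" "d2 > 0"
    "\<And>y. norm y < d1 \<Longrightarrow> (\<integral>z. norm (f (z + y) - f z) \<partial>lborel) \<le> e / 2"
    "\<And>y. norm y < d2 \<Longrightarrow> (\<integral>z. norm (g (z + y) - g z) \<partial>lborel) \<le> e / 2"
    by auto
  have "(\<integral>z. norm (f (z + y) + g (z + y) - (f z + g z)) \<partial>lborel) \<le> e" if y: "norm y < min d1 d2" for y
  proof -
    note I = add.hyps lborel_integrable_translate[OF add.hyps(1), of y]
      lborel_integrable_translate[OF add.hyps(2), of y]
    have "(\<integral>z. norm (f (z + y) + g (z + y) - (f z + g z)) \<partial>lborel)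
        \<le> (\<integral>z. norm (f (z + y) - f z) + norm (g (z + y) - g z) \<partial>lborel)"
      using I by (intro integral_mono) (auto intro!: norm_diff_triangle_ineq)
    also have "\<dots> = (\<integral>z. norm (f (z + y) - f z) \<partial>lborel) + (\<integral>z. norm (g (z + y) - g z) \<partial>lborel)"
      using I by (intro Bochner_Integration.integral_add) auto
    also have "\<dots> \<le> e" using d(3)[of y] d(4)[of y] y by simp
    finally show ?thesis .
  qed
  then show ?case using d by (intro exI[of _ "min d1 d2"]) auto
next
  case (lim f s)
  \<comment> \<open>\<open>integrable_induct\<close> supplies norm (s i z) \<le> 2 * norm (f z),
    hence the majorant 3 * norm (f z).\<close>
  have "(\<lambda>i. \<integral>z. norm (s i z - f z) \<partial>lborel) \<longlonglongrightarrow> (\<integral>z. 0 \<partial>(lborel::'a measure))"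
  proof (rule integral_dominated_convergence[where w = "\<lambda>z. 3 * norm (f z)"])
    show "AE z in lborel. (\<lambda>i. norm (s i z - f z)) \<longlonglongrightarrow> 0"
      using lim.hyps(2) by (auto intro!: tendsto_norm_zero LIM_zero)
    show "AE z in lborel. norm (norm (s i z - f z)) \<le> 3 * norm (f z)" for i
      using lim.hyps(3)[of _ i] by (auto intro!: order_trans[OF norm_triangle_ineq4])
  qed (use lim.hyps in auto)
  then have "eventually (\<lambda>i. (\<integral>z. norm (s i z - f z) \<partial>lborel) < e / 3) sequentially"
    using \<open>e > 0\<close> by (intro order_tendstoD) auto
  then obtain i where i: "(\<integral>z. norm (s i z - f z) \<partial>lborel) < e / 3"
    by (auto simp: eventually_sequentially)
  obtain d where d: "d > 0"
    "\<And>y. norm y < d \<Longrightarrow> (\<integral>z. norm (s i (z + y) - s i z) \<partial>lborel) \<le> e / 3"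
    using lim.IH[of "e/3" i] \<open>e > 0\<close> by auto
  have "(\<integral>z. norm (f (z + y) - f z) \<partial>lborel) \<le> e" if y: "norm y < d" for y
  proof -
    note I = lim.hyps(1)[of i] lim.hyps(4) lborel_integrable_translate[OF lim.hyps(1), of i y]
      lborel_integrable_translate[OF lim.hyps(4), of y]
    have "(\<integral>z. norm (f (z + y) - f z) \<partial>lborel)
        \<le> (\<integral>z. norm (s i (z + y) - f (z + y)) + norm (s i (z + y) - s i z) + norm (s i z - f z) \<partial>lborel)"
    proof (rule integral_mono)
      fix z
      have eq: "f (z + y) - f z = - (s i (z + y) - f (z + y)) + (s i (z + y) - s i z) + (s i z - f z)"
        by simp
      show "norm (f (z + y) - f z) \<le> norm (s i (z + y) - f (z + y)) + norm (s i (z + y) - s i z) + norm (s i z - f z)"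
        unfolding eq using norm_triangle_ineq[of "- (s i (z + y) - f (z + y)) + (s i (z + y) - s i z)" "s i z - f z"]
          norm_triangle_ineq[of "- (s i (z + y) - f (z + y))" "s i (z + y) - s i z"]
          norm_minus_cancel[of "s i (z + y) - f (z + y)"] by linarith
    qed (intro Bochner_Integration.integrable_add Bochner_Integration.integrable_diff
        integrable_norm I)+
    also have "\<dots> = (\<integral>z. norm (s i (z + y) - f (z + y)) \<partial>lborel) + (\<integral>z. norm (s i (z + y) - s i z) \<partial>lborel)
        + (\<integral>z. norm (s i z - f z) \<partial>lborel)"
    proof -
      have "integrable lborel (\<lambda>z. norm (s i (z + y) - f (z + y)))"
        "integrable lborel (\<lambda>z. norm (s i (z + y) - s i z))" "integrable lborel (\<lambda>z. norm (s i z - f z))"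
        by (intro Bochner_Integration.integrable_diff integrable_norm I)+
      then show ?thesis by (simp only: Bochner_Integration.integral_add Bochner_Integration.integrable_add)
    qed
    also have "(\<integral>z. norm (s i (z + y) - f (z + y)) \<partial>lborel) = (\<integral>z. norm (s i z - f z) \<partial>lborel)"
      using borel_measurable_integrable[OF I(1)] borel_measurable_integrable[OF I(2)]
      by (intro lborel_integral_translate[of "\<lambda>z. norm (s i z - f z)"]) simp
    finally show ?thesis using i d(2)[OF y] by simp
  qed
  then show ?case using d by blast
qed

section \<open>The mollification kernel and its gradient\<close>

definition bump :: "real \<Rightarrow> 'a::euclidean_space \<Rightarrow> real" where
  "bump \<delta> z = (max 0 (\<delta>\<^sup>2 - z \<bullet> z))\<^sup>2"

definition moll :: "real \<Rightarrow> 'a::euclidean_space \<Rightarrow> real" where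
  "moll \<delta> z = bump \<delta> z / (\<integral>y. bump \<delta> y \<partial>(lborel::'a measure))"

definition moll_grad :: "real \<Rightarrow> 'a::euclidean_space \<Rightarrow> 'a" where
  "moll_grad \<delta> z = (- 4 * max 0 (\<delta>\<^sup>2 - z \<bullet> z) / (\<integral>y. bump \<delta> y \<partial>(lborel::'a measure))) *\<^sub>R z"

definition mollify :: "real \<Rightarrow> ('a::euclidean_space \<Rightarrow> 'b::{banach, second_countable_topology}) \<Rightarrow> 'a \<Rightarrow> 'b" where
  "mollify \<delta> f z = (\<integral>y. moll \<delta> (z - y) *\<^sub>R f y \<partial>lborel)"

lemma continuous_on_bump: "continuous_on UNIV (bump \<delta>)"
  unfolding bump_def by (intro continuous_intros)

lemma bump_eq_0: "\<delta> > 0 \<Longrightarrow> norm z \<ge> \<delta> \<Longrightarrow> bump \<delta> z = 0"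
  by (auto simp: bump_def max_def power2_norm_eq_inner[symmetric] dest: power_mono[of \<delta> "norm z" 2])

lemma integrable_bump: "\<delta> > 0 \<Longrightarrow> integrable lborel (bump \<delta>)"
  by (rule integrable_bounded_continuous_cball[OF continuous_on_bump, of \<delta>]) (auto intro: bump_eq_0)

lemma integral_bump_pos:
  assumes "\<delta> > 0" shows "(\<integral>z. bump \<delta> z \<partial>(lborel::'a::euclidean_space measure)) > 0"
proof -
  have "(\<integral>z. bump \<delta> z \<partial>(lborel::'a::euclidean_space measure)) \<noteq> 0"
  proof
    assume "(\<integral>z. bump \<delta> z \<partial>(lborel::'a::euclidean_space measure)) = 0"
    then have "AE z in (lborel::'a measure). bump \<delta> z = 0"
      using integrable_bump[OF assms] by (subst (asm) integral_nonneg_eq_0_iff_AE) (auto simp: bump_def)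
    moreover have "z \<notin> ball 0 \<delta>" if "bump \<delta> z = 0" for z :: 'a
    proof
      assume "z \<in> ball 0 \<delta>"
      then have "(norm z)\<^sup>2 < \<delta>\<^sup>2" by (intro power_strict_mono) auto
      then show False using that by (auto simp: bump_def power2_norm_eq_inner)
    qed
    ultimately have "AE z in (lborel::'a measure). z \<notin> ball 0 \<delta>" by auto
    then have "emeasure lborel (ball (0::'a) \<delta>) = 0"
      by (subst (asm) AE_iff_measurable[OF _ refl]) (auto simp: not_le ball_def dist_norm)
    then show False
      using content_ball_pos[OF assms, of "0::'a"] by (simp add: measure_def)
  qed
  then show ?thesis
    by (simp add: bump_def less_le)
qed

lemma moll_nonneg: "moll \<delta> z \<ge> 0"
  by (auto simp: moll_def bump_def)

lemma moll_minus: "moll \<delta> (- z) = moll \<delta> z"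
  by (simp add: moll_def bump_def)

lemma moll_eq_0: "\<delta> > 0 \<Longrightarrow> norm z \<ge> \<delta> \<Longrightarrow> moll \<delta> z = 0"
  by (simp add: moll_def bump_eq_0)

lemma moll_grad_eq_0:
  assumes "\<delta> > 0" "norm z \<ge> \<delta>" shows "moll_grad \<delta> z = 0"
  using bump_eq_0[OF assms] by (auto simp: moll_grad_def bump_def)

lemma continuous_on_moll: "continuous_on UNIV (moll \<delta>)"
  unfolding moll_def divide_inverse by (intro continuous_intros continuous_on_bump)

lemma continuous_on_moll_grad: "continuous_on UNIV (moll_grad \<delta>)"
  unfolding moll_grad_def divide_inverse by (intro continuous_intros)

lemma moll_measurable [measurable]: "moll \<delta> \<in> borel_measurable borel"
  by (rule borel_measurable_continuous_onI[OF continuous_on_moll])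

lemma moll_grad_measurable [measurable]: "moll_grad \<delta> \<in> borel_measurable borel"
  by (rule borel_measurable_continuous_onI[OF continuous_on_moll_grad])

lemma integrable_moll: "\<delta> > 0 \<Longrightarrow> integrable lborel (moll \<delta>)"
  unfolding moll_def using integrable_bump by auto

lemma integral_moll: "\<delta> > 0 \<Longrightarrow> (\<integral>z. moll \<delta> z \<partial>(lborel::'a::euclidean_space measure)) = 1"
  using integral_bump_pos[where 'a='a, of \<delta>] by (simp add: moll_def)

lemma DERIV_max_0_square: "((\<lambda>s. (max 0 s)\<^sup>2) has_real_derivative 2 * max 0 s) (at s)"
proof (cases "s = 0")
  case False
  show ?thesis
  proof (cases "s > 0")
    case True
    have "((\<lambda>s. s\<^sup>2) has_real_derivative 2 * max 0 s) (at s)"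
      using True by (auto intro!: derivative_eq_intros)
    then show ?thesis
      by (rule has_field_derivative_transform_within_open[where S = "{0<..}"]) (use True in auto)
  next
    case False
    have "((\<lambda>s. 0) has_real_derivative 2 * max 0 s) (at s)"
      using False by (auto simp: max_def)
    then show ?thesis
      by (rule has_field_derivative_transform_within_open[where S = "{..<0}"])
        (use False \<open>s \<noteq> 0\<close> in auto)
  qed
next
  case True
  have "((\<lambda>h. ((max 0 h)\<^sup>2 - (max 0 0)\<^sup>2) / h) \<longlongrightarrow> 0) (at (0::real))"
  proof (rule Lim_null_comparison)
    show "eventually (\<lambda>h. norm (((max 0 h)\<^sup>2 - (max 0 0)\<^sup>2) / h) \<le> \<bar>h\<bar>) (at (0::real))"
      by (auto simp: max_def power2_eq_square)
    show "((\<lambda>h. \<bar>h\<bar>) \<longlongrightarrow> 0) (at (0::real))"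
      by (auto intro!: tendsto_eq_intros)
  qed
  then show ?thesis using True by (simp add: DERIV_def)
qed

text \<open>The square in \<open>bump\<close> makes the kernel differentiable across the sphere of
  radius \<delta>. C^1 regularity with a closed formula for the gradient is all that a test function
  of the equation has to offer.\<close>

lemma GDERIV_moll:
  fixes z :: "'a::euclidean_space"
  shows "GDERIV (moll \<delta>) z :> moll_grad \<delta> z"
proof -
  have "GDERIV (\<lambda>z. \<delta>\<^sup>2 - z \<bullet> z) z :> - 2 *\<^sub>R z"
    unfolding gderiv_def by (auto intro!: derivative_eq_intros simp: inner_commute)
  then have "GDERIV (\<lambda>z. (max 0 (\<delta>\<^sup>2 - z \<bullet> z))\<^sup>2) z :> (2 * max 0 (\<delta>\<^sup>2 - z \<bullet> z)) *\<^sub>R (- 2 *\<^sub>R z)"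
    by (rule GDERIV_DERIV_compose) (rule DERIV_max_0_square)
  then have "GDERIV (\<lambda>z. (\<lambda>s. s / (\<integral>y. bump \<delta> y \<partial>(lborel::'a measure))) ((max 0 (\<delta>\<^sup>2 - z \<bullet> z))\<^sup>2)) z :>
      (1 / (\<integral>y. bump \<delta> y \<partial>(lborel::'a measure))) *\<^sub>R (2 * max 0 (\<delta>\<^sup>2 - z \<bullet> z)) *\<^sub>R (- 2 *\<^sub>R z)"
    by (rule GDERIV_DERIV_compose) (rule DERIV_cdivide, rule DERIV_ident)
  moreover have "(1 / (\<integral>y. bump \<delta> y \<partial>(lborel::'a measure))) *\<^sub>R (2 * max 0 (\<delta>\<^sup>2 - z \<bullet> z)) *\<^sub>R (- 2 *\<^sub>R z)
      = moll_grad \<delta> z"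
    by (simp add: moll_grad_def)
  moreover have "(\<lambda>z::'a. (\<lambda>s. s / (\<integral>y. bump \<delta> y \<partial>(lborel::'a measure))) ((max 0 (\<delta>\<^sup>2 - z \<bullet> z))\<^sup>2)) = moll \<delta>"
    by (simp add: moll_def bump_def fun_eq_iff)
  ultimately show ?thesis by simp
qed

section \<open>Differentiation under the integral sign and integration by parts\<close>

lemma dir_deriv_shift:
  fixes f :: "'a::real_normed_vector \<Rightarrow> real"
  assumes "\<And>z. ((\<lambda>s. f (z + s *\<^sub>R b)) has_real_derivative g z) (at 0)"
  shows "((\<lambda>s. f (z + s *\<^sub>R b)) has_real_derivative g (z + s *\<^sub>R b)) (at s)"
proof -
  have "((\<lambda>r. f (z + (s + r) *\<^sub>R b)) has_real_derivative g (z + s *\<^sub>R b)) (at 0)"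
    using assms[of "z + s *\<^sub>R b"] by (simp add: scaleR_add_left add.assoc)
  then show ?thesis
    using DERIV_shift[of "\<lambda>s. f (z + s *\<^sub>R b)" "g (z + s *\<^sub>R b)" 0 s] by (simp add: add.commute)
qed

lemma DERIV_abs_diff_le:
  fixes k :: "real \<Rightarrow> real"
  assumes "\<And>s. (k has_real_derivative k' s) (at s)" "\<And>s. \<bar>k' s\<bar> \<le> M"
  shows "\<bar>k s - k t\<bar> \<le> M * \<bar>s - t\<bar>"
  using field_differentiable_bound[of UNIV k k' M s t] assms
  by (auto intro: has_field_derivative_at_within)

text \<open>The mean value bound M on the difference quotients gives the integrable majorant M *
  \<bar>\<phi> y\<bar>. The form with a weight \<phi> serves integration by parts, the derivative of
  a mollification, and the shift argument at the boundary.\<close>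

lemma DERIV_integral_bounded:
  fixes k :: "real \<Rightarrow> 'a::euclidean_space \<Rightarrow> real"
  assumes \<phi>: "integrable lborel \<phi>"
    and D: "\<And>s y. ((\<lambda>s. k s y) has_real_derivative k' s y) (at s)"
    and bd: "\<And>s y. \<bar>k' s y\<bar> \<le> M"
    and int: "\<And>s. integrable lborel (\<lambda>y. k s y * \<phi> y)"
    and [measurable]: "k' t \<in> borel_measurable borel"
  shows "((\<lambda>s. \<integral>y. k s y * \<phi> y \<partial>lborel) has_real_derivative (\<integral>y. k' t y * \<phi> y \<partial>lborel)) (at t)"
  unfolding DERIV_def tendsto_at_iff_sequentially
proof (intro allI impI)
  fix X :: "nat \<Rightarrow> real" assume X: "\<forall>i. X i \<in> UNIV - {0}" "X \<longlonglongrightarrow> 0"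
  have [measurable]: "\<phi> \<in> borel_measurable borel" using borel_measurable_integrable[OF \<phi>] by simp
  have "(\<lambda>i. \<integral>y. (k (t + X i) y * \<phi> y - k t y * \<phi> y) / X i \<partial>lborel) \<longlonglongrightarrow> (\<integral>y. k' t y * \<phi> y \<partial>lborel)"
  proof (rule integral_dominated_convergence[where w = "\<lambda>y. M * \<bar>\<phi> y\<bar>"])
    show "AE y in lborel. (\<lambda>i. (k (t + X i) y * \<phi> y - k t y * \<phi> y) / X i) \<longlonglongrightarrow> k' t y * \<phi> y"
    proof (rule AE_I2)
      fix y
      have "((\<lambda>h. (k (t + h) y - k t y) / h) \<longlongrightarrow> k' t y) (at 0)"
        using D[of y t] by (simp add: DERIV_def)
      then have "(\<lambda>i. (k (t + X i) y - k t y) / X i) \<longlonglongrightarrow> k' t y"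
        using X unfolding tendsto_at_iff_sequentially by (auto simp: o_def)
      then have "(\<lambda>i. (k (t + X i) y - k t y) / X i * \<phi> y) \<longlonglongrightarrow> k' t y * \<phi> y"
        by (intro tendsto_intros)
      then show "(\<lambda>i. (k (t + X i) y * \<phi> y - k t y * \<phi> y) / X i) \<longlonglongrightarrow> k' t y * \<phi> y"
        by (simp add: left_diff_distrib)
    qed
    show "AE y in lborel. norm ((k (t + X i) y * \<phi> y - k t y * \<phi> y) / X i) \<le> M * \<bar>\<phi> y\<bar>" for i
    proof (rule AE_I2)
      fix y
      have "\<bar>k (t + X i) y - k t y\<bar> \<le> M * \<bar>X i\<bar>"
        using DERIV_abs_diff_le[OF D bd, of "t + X i" y t] by simp
      then have "\<bar>k (t + X i) y - k t y\<bar> / \<bar>X i\<bar> * \<bar>\<phi> y\<bar> \<le> M * \<bar>\<phi> y\<bar>"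
        using X(1) by (intro mult_right_mono) (auto simp: divide_le_eq)
      then show "norm ((k (t + X i) y * \<phi> y - k t y * \<phi> y) / X i) \<le> M * \<bar>\<phi> y\<bar>"
        by (simp add: left_diff_distrib[symmetric] abs_mult)
    qed
    show "(\<lambda>y. (k (t + X i) y * \<phi> y - k t y * \<phi> y) / X i) \<in> borel_measurable lborel" for i
      using borel_measurable_integrable[OF int[of "t + X i"]] borel_measurable_integrable[OF int[of t]] by simp
  qed (use \<phi> in auto)
  then show "((\<lambda>h. ((\<integral>y. k (t + h) y * \<phi> y \<partial>lborel) - (\<integral>y. k t y * \<phi> y \<partial>lborel)) / h) \<circ> X)
      \<longlonglongrightarrow> (\<integral>y. k' t y * \<phi> y \<partial>lborel)"
    using int by (simp add: o_def)
qed

text \<open>By translation invariance the integral of f(y + s b) does not depend on s, and its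
  derivative at s = 0 is the integral of g. This is integration by parts without slicing the space
  along b.\<close>

lemma integral_dir_deriv_eq_0:
  fixes f :: "'a::euclidean_space \<Rightarrow> real"
  assumes D: "\<And>z. ((\<lambda>s. f (z + s *\<^sub>R b)) has_real_derivative g z) (at 0)"
    and cont: "continuous_on UNIV f" "continuous_on UNIV g"
    and supp: "\<And>z. norm z > R \<Longrightarrow> f z = 0" "\<And>z. norm z > R \<Longrightarrow> g z = 0"
  shows "(\<integral>z. g z \<partial>lborel) = 0"
proof -
  have [measurable]: "f \<in> borel_measurable borel" "g \<in> borel_measurable borel"
    using cont by (auto intro: borel_measurable_continuous_onI)
  \<comment> \<open>An integrable weight is needed for differentiation under the integral. With
    radius R + norm b it equals 1 on the support of every shift with \<bar>s\<bar> < 1, so it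
    changes no integral.\<close>
  let ?\<phi> = "indicat_real (cball 0 (R + norm b)) :: 'a \<Rightarrow> real"
  have \<phi>: "integrable lborel ?\<phi>"
    using emeasure_compact_finite[OF compact_cball] by (intro integrable_real_indicator) auto
  obtain M where M: "\<And>z. norm (g z) \<le> M" using bounded_continuous_cball[OF cont(2) supp(2)] by metis
  obtain M' where M': "\<And>z. norm (f z) \<le> M'" using bounded_continuous_cball[OF cont(1) supp(1)] by metis
  have "((\<lambda>s. \<integral>y. f (y + s *\<^sub>R b) * ?\<phi> y \<partial>lborel) has_real_derivative (\<integral>y. g (y + 0 *\<^sub>R b) * ?\<phi> y \<partial>lborel)) (at 0)"
  proof (rule DERIV_integral_bounded[OF \<phi>, where M = M])
    show "integrable lborel (\<lambda>y. f (y + s *\<^sub>R b) * ?\<phi> y)" for s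
      by (rule Bochner_Integration.integrable_bound[where f = "\<lambda>y. M' * ?\<phi> y"])
        (use \<phi> M' in \<open>auto simp: abs_mult intro!: AE_I2 mult_right_mono intro: order_trans[OF _ abs_ge_self]\<close>)
  qed (use M dir_deriv_shift[OF D] in auto)
  also have "(\<integral>y. g (y + 0 *\<^sub>R b) * ?\<phi> y \<partial>lborel) = (\<integral>y. g y \<partial>lborel)"
  proof (rule Bochner_Integration.integral_cong[OF refl])
    fix y show "g (y + 0 *\<^sub>R b) * ?\<phi> y = g y"
    proof (cases "norm y \<le> R")
      case True
      then have "norm y \<le> R + norm b" using norm_ge_zero[of b] by linarith
      then show ?thesis by simp
    qed (use supp(2)[of y] in simp)
  qed
  finally have 1: "((\<lambda>s. \<integral>y. f (y + s *\<^sub>R b) * ?\<phi> y \<partial>lborel) has_real_derivative (\<integral>y. g y \<partial>lborel)) (at 0)" .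
  have "(\<integral>y. f (y + s *\<^sub>R b) * ?\<phi> y \<partial>lborel) = (\<integral>y. f y \<partial>lborel)" if s: "s \<in> {-1<..<1}" for s
  proof -
    have "f (y + s *\<^sub>R b) * ?\<phi> y = f (y + s *\<^sub>R b)" for y
    proof (cases "norm y \<le> R + norm b")
      case False
      have "norm y \<le> norm (y + s *\<^sub>R b) + norm (s *\<^sub>R b)"
        by (metis add_diff_cancel_right' norm_triangle_ineq4)
      moreover have "norm (s *\<^sub>R b) \<le> norm b"
        using s by (auto intro!: mult_left_le_one_le)
      ultimately show ?thesis using False supp(1)[of "y + s *\<^sub>R b"] by simp
    qed auto
    then show ?thesis by (simp only:) (simp add: lborel_integral_translate)
  qed
  then have 2: "((\<lambda>s. \<integral>y. f (y + s *\<^sub>R b) * ?\<phi> y \<partial>lborel) has_real_derivative 0) (at 0)"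
    by (intro has_field_derivative_transform_within_open[OF DERIV_const, where S = "{-1<..<1}"]) auto
  show ?thesis using DERIV_unique[OF 1 2] .
qed

section \<open>Convolution with the kernel\<close>

lemma continuous_on_convolution:
  fixes f :: "'a::euclidean_space \<Rightarrow> 'b::{banach, second_countable_topology}"
  assumes f: "integrable lborel f" and k: "continuous_on UNIV k" "\<And>z. \<bar>k z\<bar> \<le> M"
  shows "continuous_on UNIV (\<lambda>z. \<integral>y. k (z - y) *\<^sub>R f y \<partial>lborel)"
proof -
  have [measurable]: "f \<in> borel_measurable borel" using borel_measurable_integrable[OF f] by simp
  have [measurable]: "k \<in> borel_measurable borel" using k by (auto intro: borel_measurable_continuous_onI)
  have "(\<lambda>i. \<integral>y. k (X i - y) *\<^sub>R f y \<partial>lborel) \<longlonglongrightarrow> (\<integral>y. k (z - y) *\<^sub>R f y \<partial>lborel)"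
    if X: "X \<longlonglongrightarrow> z" for X z
  proof (rule integral_dominated_convergence[where w = "\<lambda>y. M * norm (f y)"])
    show "AE y in lborel. (\<lambda>i. k (X i - y) *\<^sub>R f y) \<longlonglongrightarrow> k (z - y) *\<^sub>R f y"
      using X by (intro AE_I2 tendsto_intros continuous_on_tendsto_compose[OF k(1)]) auto
    show "AE y in lborel. norm (k (X i - y) *\<^sub>R f y) \<le> M * norm (f y)" for i
      using k(2) by (auto intro!: mult_right_mono)
  qed (use f in auto)
  then show ?thesis
    by (auto simp: continuous_on_sequentially o_def)
qed

lemma moll_bounds:
  assumes "\<delta> > 0"
  obtains M where "M > 0" "\<And>z::'a::euclidean_space. \<bar>moll \<delta> z\<bar> \<le> M" "\<And>z::'a. norm (moll_grad \<delta> z) \<le> M"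
proof -
  obtain M1 where M1: "M1 > 0" "\<And>z::'a. norm (moll \<delta> z) \<le> M1"
    using bounded_continuous_cball[OF continuous_on_moll, of \<delta> \<delta>, where 'a='a] moll_eq_0[OF assms]
    by (metis less_imp_le)
  obtain M2 where M2: "M2 > 0" "\<And>z::'a. norm (moll_grad \<delta> z) \<le> M2"
    using bounded_continuous_cball[OF continuous_on_moll_grad, of \<delta> \<delta>, where 'a='a] moll_grad_eq_0[OF assms]
    by (metis less_imp_le)
  show ?thesis
  proof (rule that[of "max M1 M2"])
    show "\<bar>moll \<delta> z\<bar> \<le> max M1 M2" for z :: 'a using M1(2)[of z] by simp
    show "norm (moll_grad \<delta> z) \<le> max M1 M2" for z :: 'a using M2(2)[of z] by simp
  qed (use M1 in auto)
qed

lemma integrable_moll_scaleR: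
  fixes f :: "'a::euclidean_space \<Rightarrow> 'b::{banach, second_countable_topology}"
  assumes f: "integrable lborel f" and \<delta>: "\<delta> > 0"
  shows "integrable lborel (\<lambda>y. moll \<delta> (z - y) *\<^sub>R f y)"
proof -
  have [measurable]: "f \<in> borel_measurable borel" using borel_measurable_integrable[OF f] by simp
  obtain M where M: "\<And>z::'a. \<bar>moll \<delta> z\<bar> \<le> M" using moll_bounds[OF \<delta>] by metis
  show ?thesis
    by (rule Bochner_Integration.integrable_bound[where f = "\<lambda>y. M *\<^sub>R f y"])
      (use f M in \<open>auto intro!: AE_I2 mult_right_mono intro: order_trans[OF _ abs_ge_self]\<close>)
qed

lemma integrable_moll_grad_mult:
  fixes f :: "'a::euclidean_space \<Rightarrow> real"
  assumes f: "integrable lborel f" and \<delta>: "\<delta> > 0"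
  shows "integrable lborel (\<lambda>y. (moll_grad \<delta> (z - y) \<bullet> b) * f y)"
proof -
  have [measurable]: "f \<in> borel_measurable borel" using borel_measurable_integrable[OF f] by simp
  obtain M where M: "\<And>z::'a. norm (moll_grad \<delta> z) \<le> M" using moll_bounds[OF \<delta>] by metis
  have le: "\<bar>moll_grad \<delta> z \<bullet> b\<bar> \<le> \<bar>M * norm b\<bar>" for z
    using M[of z] by (intro order_trans[OF Cauchy_Schwarz_ineq2] order_trans[OF _ abs_ge_self] mult_right_mono) auto
  show ?thesis
  proof (rule Bochner_Integration.integrable_bound)
    show "integrable lborel (\<lambda>y. (M * norm b) * f y)" using f by simp
    show "AE y in lborel. norm ((moll_grad \<delta> (z - y) \<bullet> b) * f y) \<le> norm ((M * norm b) * f y)"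
      unfolding real_norm_def abs_mult[of _ "f _"] by (intro AE_I2 mult_right_mono le) simp
  qed measurable
qed

text \<open>Its uses are the components of a mollified tuple and the inner product with a fixed
  vector.\<close>

lemma mollify_bounded_linear:
  fixes f :: "'a::euclidean_space \<Rightarrow> 'b::{banach, second_countable_topology}"
    and L :: "'b \<Rightarrow> 'c::{banach, second_countable_topology}"
  assumes L: "bounded_linear L" and f: "integrable lborel f" and \<delta>: "\<delta> > 0"
  shows "mollify \<delta> (\<lambda>y. L (f y)) z = L (mollify \<delta> f z)"
proof -
  interpret bounded_linear L by fact
  show ?thesis
    unfolding mollify_def
    by (subst integral_bounded_linear[OF L integrable_moll_scaleR[OF f \<delta>], symmetric]) (simp add: scaleR)
qed

lemma mollify_eq:
  fixes f :: "'a::euclidean_space \<Rightarrow> 'b::{banach, second_countable_topology}"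
  assumes [measurable]: "f \<in> borel_measurable borel"
  shows "mollify \<delta> f z = (\<integral>y. moll \<delta> y *\<^sub>R f (z + y) \<partial>lborel)"
proof -
  have "mollify \<delta> f z = (\<integral>y. moll \<delta> (z - (y + z)) *\<^sub>R f (y + z) \<partial>lborel)"
    unfolding mollify_def
    by (rule lborel_integral_translate[where f = "\<lambda>y. moll \<delta> (z - y) *\<^sub>R f y", symmetric]) measurable
  then show ?thesis by (simp add: moll_minus add.commute)
qed

lemma norm_mollify_le:
  fixes f :: "'a::euclidean_space \<Rightarrow> 'b::{banach, second_countable_topology}"
  shows "norm (mollify \<delta> f z) \<le> mollify \<delta> (\<lambda>y. norm (f y)) z"
  unfolding mollify_def
  by (rule order_trans[OF integral_norm_bound]) (simp add: moll_nonneg)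

lemma mollify_const:
  assumes "\<delta> > 0" shows "mollify \<delta> (\<lambda>_. c) (z::'a::euclidean_space) = (c::'b::{banach, second_countable_topology})"
  using integral_moll[OF assms, where 'a='a] integrable_moll[OF assms, where 'a='a]
  by (simp add: mollify_eq integral_scaleR_left)

lemma mollify_add:
  fixes f g :: "'a::euclidean_space \<Rightarrow> 'b::{banach, second_countable_topology}"
  assumes "integrable lborel f" "integrable lborel g" "\<delta> > 0"
  shows "mollify \<delta> (\<lambda>y. f y + g y) z = mollify \<delta> f z + mollify \<delta> g z"
  unfolding mollify_def using assms
  by (simp add: scaleR_add_right integrable_moll_scaleR)

lemma mollify_local_cong:
  fixes f g :: "'a::euclidean_space \<Rightarrow> 'b::{banach, second_countable_topology}"
  assumes "\<delta> > 0" "\<And>y. y \<in> ball z \<delta> \<Longrightarrow> f y = g y"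
  shows "mollify \<delta> f z = mollify \<delta> g z"
  unfolding mollify_def
proof (rule Bochner_Integration.integral_cong[OF refl])
  fix y show "moll \<delta> (z - y) *\<^sub>R f y = moll \<delta> (z - y) *\<^sub>R g y"
    using assms(2)[of y] moll_eq_0[OF assms(1), of "z - y"]
    by (cases "dist z y < \<delta>") (auto simp: dist_norm)
qed

lemma continuous_on_mollify:
  fixes f :: "'a::euclidean_space \<Rightarrow> 'b::{banach, second_countable_topology}"
  assumes "integrable lborel f" "\<delta> > 0"
  shows "continuous_on UNIV (mollify \<delta> f)"
proof -
  obtain M where M: "\<And>z::'a. \<bar>moll \<delta> z\<bar> \<le> M" using moll_bounds[OF assms(2)] by metis
  show ?thesis
    unfolding mollify_def[abs_def] by (rule continuous_on_convolution[OF assms(1) continuous_on_moll M])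
qed

text \<open>The derivative falls on the kernel, so an integrable f has a derivative of its
  mollification in every direction. A weak derivative of f, where there is one, enters only
  afterwards.\<close>

definition mollify_deriv :: "real \<Rightarrow> ('a::euclidean_space \<Rightarrow> real) \<Rightarrow> 'a \<Rightarrow> 'a \<Rightarrow> real" where
  "mollify_deriv \<delta> f b z = (\<integral>y. (moll_grad \<delta> (z - y) \<bullet> b) * f y \<partial>lborel)"

lemma continuous_on_mollify_deriv:
  fixes f :: "'a::euclidean_space \<Rightarrow> real"
  assumes "integrable lborel f" "\<delta> > 0"
  shows "continuous_on UNIV (mollify_deriv \<delta> f b)"
proof -
  obtain M where M: "\<And>z::'a. norm (moll_grad \<delta> z) \<le> M" using moll_bounds[OF assms(2)] by metis
  have "\<bar>moll_grad \<delta> z \<bullet> b\<bar> \<le> M * norm b" for z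
    using M[of z] by (intro order_trans[OF Cauchy_Schwarz_ineq2] mult_right_mono) auto
  moreover have "continuous_on UNIV (\<lambda>z. moll_grad \<delta> z \<bullet> b)"
    by (intro continuous_intros continuous_on_moll_grad)
  ultimately show ?thesis
    unfolding mollify_deriv_def[abs_def]
    using continuous_on_convolution[OF assms(1), of "\<lambda>z. moll_grad \<delta> z \<bullet> b" "M * norm b"] by simp
qed

lemma mollify_deriv_bounded:
  fixes f :: "'a::euclidean_space \<Rightarrow> real"
  assumes f: "integrable lborel f" and \<delta>: "\<delta> > 0"
  obtains M where "M > 0" "\<And>z. \<bar>mollify_deriv \<delta> f b z\<bar> \<le> M"
proof -
  obtain M where M: "M > 0" "\<And>z::'a. norm (moll_grad \<delta> z) \<le> M" using moll_bounds[OF \<delta>] by metis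
  have "\<bar>mollify_deriv \<delta> f b z\<bar> \<le> M * norm b * (\<integral>y. \<bar>f y\<bar> \<partial>lborel) + 1" for z
  proof -
    have "\<bar>moll_grad \<delta> z \<bullet> b\<bar> \<le> M * norm b" for z
      using M(2)[of z] by (intro order_trans[OF Cauchy_Schwarz_ineq2] mult_right_mono) auto
    then have "\<bar>mollify_deriv \<delta> f b z\<bar> \<le> (\<integral>y. M * norm b * \<bar>f y\<bar> \<partial>lborel)"
      unfolding mollify_deriv_def
      using f integrable_abs[OF integrable_moll_grad_mult[OF f \<delta>]]
      by (intro order_trans[OF integral_abs_bound] integral_mono) (auto simp: abs_mult intro!: mult_right_mono)
    then show ?thesis by simp
  qed
  then show ?thesis
    using M(1) by (intro that[of "M * norm b * (\<integral>y. \<bar>f y\<bar> \<partial>lborel) + 1"]) (auto intro!: add_nonneg_pos)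
qed

lemma DERIV_mollify:
  fixes f :: "'a::euclidean_space \<Rightarrow> real"
  assumes f: "integrable lborel f" and \<delta>: "\<delta> > 0"
  shows "((\<lambda>s. mollify \<delta> f (z + s *\<^sub>R b)) has_real_derivative mollify_deriv \<delta> f b z) (at 0)"
proof -
  have [measurable]: "f \<in> borel_measurable borel" using borel_measurable_integrable[OF f] by simp
  obtain M where M: "\<And>z::'a. norm (moll_grad \<delta> z) \<le> M" using moll_bounds[OF \<delta>] by metis
  have D: "((\<lambda>s. moll \<delta> (z + s *\<^sub>R b)) has_real_derivative (moll_grad \<delta> z \<bullet> b)) (at 0)" for z
  proof -
    have "(moll \<delta> has_derivative (\<lambda>h. h \<bullet> moll_grad \<delta> z)) (at (z + 0 *\<^sub>R b))"
      using GDERIV_moll[of \<delta> z] by (simp add: gderiv_def)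
    then have "((\<lambda>s. moll \<delta> (z + s *\<^sub>R b)) has_derivative (\<lambda>s. (s *\<^sub>R b) \<bullet> moll_grad \<delta> z)) (at 0)"
      by (rule has_derivative_compose[rotated]) (auto intro!: derivative_eq_intros)
    then show ?thesis
      by (simp add: has_field_derivative_def inner_commute mult_commute_abs)
  qed
  have "((\<lambda>s. \<integral>y. moll \<delta> ((z - y) + s *\<^sub>R b) * f y \<partial>lborel) has_real_derivative
      (\<integral>y. (moll_grad \<delta> ((z - y) + 0 *\<^sub>R b) \<bullet> b) * f y \<partial>lborel)) (at 0)"
  proof (rule DERIV_integral_bounded[OF f, where M = "M * norm b"])
    show "((\<lambda>s. moll \<delta> ((z - y) + s *\<^sub>R b)) has_real_derivative (moll_grad \<delta> ((z - y) + s *\<^sub>R b) \<bullet> b)) (at s)" for s y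
      by (rule dir_deriv_shift[OF D])
    show "\<bar>moll_grad \<delta> ((z - y) + s *\<^sub>R b) \<bullet> b\<bar> \<le> M * norm b" for s y
      using M by (intro order_trans[OF Cauchy_Schwarz_ineq2] mult_right_mono) auto
    show "integrable lborel (\<lambda>y. moll \<delta> ((z - y) + s *\<^sub>R b) * f y)" for s
      using integrable_moll_scaleR[OF f \<delta>, of "z + s *\<^sub>R b"] by (simp add: algebra_simps)
  qed measurable
  then show ?thesis
    by (simp add: mollify_def mollify_deriv_def algebra_simps)
qed

section \<open>Convergence of mollifications in L^1\<close>

lemma
  fixes f :: "'a::euclidean_space \<Rightarrow> 'b::{banach, second_countable_topology}"
  assumes f: "integrable lborel f" and \<delta>: "\<delta> > 0" and e: "e \<ge> 0"
    and le: "\<And>y. norm y < \<delta> \<Longrightarrow> (\<integral>z. norm (f (z + y) - f z) \<partial>lborel) \<le> e"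
  shows integrable_mollify_aux: "integrable lborel (\<lambda>z. mollify \<delta> f z - f z)"
    and mollify_L1_le_aux: "(\<integral>z. norm (mollify \<delta> f z - f z) \<partial>lborel) \<le> e"
proof -
  have [measurable]: "f \<in> borel_measurable borel" using borel_measurable_integrable[OF f] by simp
  have [measurable]: "mollify \<delta> f \<in> borel_measurable borel"
    by (rule borel_measurable_continuous_onI[OF continuous_on_mollify[OF f \<delta>]])
  \<comment> \<open>The kernel has mass one, so f z can be written as an average and the error
    becomes an average of translation errors.\<close>
  have pointwise: "ennreal (norm (mollify \<delta> f z - f z)) \<le> (\<integral>\<^sup>+y. ennreal (moll \<delta> y * norm (f (z + y) - f z)) \<partial>lborel)" for z
  proof -
    have I1: "integrable lborel (\<lambda>y. moll \<delta> y *\<^sub>R f (z + y))"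
      using lborel_integrable_translate[OF integrable_moll_scaleR[OF f \<delta>, of z], of z]
      by (simp add: moll_minus add.commute)
    have I2: "integrable lborel (\<lambda>y::'a. moll \<delta> y *\<^sub>R f z)"
      using integrable_moll[OF \<delta>] by (intro integrable_scaleR_left)
    have "mollify \<delta> f z - f z = (\<integral>y. moll \<delta> y *\<^sub>R f (z + y) \<partial>lborel) - (\<integral>y. moll \<delta> y *\<^sub>R f z \<partial>(lborel::'a measure))"
      using mollify_const[OF \<delta>, of "f z" z] by (simp add: mollify_eq)
    also have "\<dots> = (\<integral>y. moll \<delta> y *\<^sub>R (f (z + y) - f z) \<partial>lborel)"
      using I1 I2 by (simp add: scaleR_diff_right)
    finally have "norm (mollify \<delta> f z - f z) \<le> (\<integral>y. norm (moll \<delta> y *\<^sub>R (f (z + y) - f z)) \<partial>lborel)"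
      by (simp only: integral_norm_bound)
    also have "(\<lambda>y. norm (moll \<delta> y *\<^sub>R (f (z + y) - f z))) = (\<lambda>y. moll \<delta> y * norm (f (z + y) - f z))"
      by (simp add: moll_nonneg fun_eq_iff)
    finally have "norm (mollify \<delta> f z - f z) \<le> (\<integral>y. moll \<delta> y * norm (f (z + y) - f z) \<partial>lborel)" .
    moreover have "integrable lborel (\<lambda>y. moll \<delta> y * norm (f (z + y) - f z))"
      using integrable_norm[OF Bochner_Integration.integrable_diff[OF I1 I2]]
      by (simp add: scaleR_diff_right[symmetric] moll_nonneg)
    ultimately show ?thesis
      by (subst nn_integral_eq_integral) (auto simp: moll_nonneg intro!: ennreal_leI)
  qed
  have "(\<integral>\<^sup>+z. norm (mollify \<delta> f z - f z) \<partial>lborel)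
      \<le> (\<integral>\<^sup>+z. \<integral>\<^sup>+y. ennreal (moll \<delta> y * norm (f (z + y) - f z)) \<partial>lborel \<partial>lborel)"
    by (intro nn_integral_mono pointwise)
  \<comment> \<open>Exchanging the integrals leaves translation errors for a fixed y. Since the
    kernel vanishes for norm y \<ge> \<delta>, only short translations count.\<close>
  also have "\<dots> = (\<integral>\<^sup>+y. \<integral>\<^sup>+z. ennreal (moll \<delta> y * norm (f (z + y) - f z)) \<partial>lborel \<partial>lborel)"
    by (rule lborel_pair.Fubini') measurable
  also have "\<dots> \<le> (\<integral>\<^sup>+y. ennreal (moll \<delta> y) * ennreal e \<partial>(lborel::'a measure))"
  proof (rule nn_integral_mono)
    fix y :: 'a
    have I: "integrable lborel (\<lambda>z. norm (f (z + y) - f z))"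
      by (intro integrable_norm Bochner_Integration.integrable_diff f lborel_integrable_translate)
    have "(\<integral>\<^sup>+z. ennreal (moll \<delta> y * norm (f (z + y) - f z)) \<partial>lborel)
        = ennreal (moll \<delta> y) * (\<integral>\<^sup>+z. ennreal (norm (f (z + y) - f z)) \<partial>lborel)"
      by (simp add: ennreal_mult' moll_nonneg nn_integral_cmult)
    also have "\<dots> = ennreal (moll \<delta> y) * ennreal (\<integral>z. norm (f (z + y) - f z) \<partial>lborel)"
      by (subst nn_integral_eq_integral[OF I]) auto
    also have "\<dots> \<le> ennreal (moll \<delta> y) * ennreal e"
      using le[of y] moll_eq_0[OF \<delta>, of y]
      by (cases "norm y < \<delta>") (auto intro!: mult_left_mono ennreal_leI)
    finally show "(\<integral>\<^sup>+z. ennreal (moll \<delta> y * norm (f (z + y) - f z)) \<partial>lborel) \<le> ennreal (moll \<delta> y) * ennreal e" .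
  qed
  also have "\<dots> = ennreal e"
    using integral_moll[OF \<delta>, where 'a='a] integrable_moll[OF \<delta>, where 'a='a]
    by (simp add: nn_integral_multc nn_integral_eq_integral moll_nonneg)
  finally have *: "(\<integral>\<^sup>+z. norm (mollify \<delta> f z - f z) \<partial>lborel) \<le> ennreal e" .
  show int: "integrable lborel (\<lambda>z. mollify \<delta> f z - f z)"
    using order_le_less_trans[OF *] by (intro integrableI_bounded) auto
  show "(\<integral>z. norm (mollify \<delta> f z - f z) \<partial>lborel) \<le> e"
    using * int e by (subst (asm) nn_integral_eq_integral) auto
qed

text \<open>The preceding estimate is used with the crude bound 2 * (\<integral>z. norm (f z)
  \<partial>lborel), valid for every translation; with small bounds the same estimate yields the
  convergence below.\<close>

lemma integrable_mollify:
  fixes f :: "'a::euclidean_space \<Rightarrow> 'b::{banach, second_countable_topology}"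
  assumes f: "integrable lborel f" and \<delta>: "\<delta> > 0"
  shows "integrable lborel (mollify \<delta> f)"
proof -
  have "(\<integral>z. norm (f (z + y) - f z) \<partial>lborel) \<le> 2 * (\<integral>z. norm (f z) \<partial>lborel)" for y
  proof -
    have [measurable]: "f \<in> borel_measurable borel" using borel_measurable_integrable[OF f] by simp
    note I = integrable_norm[OF f] integrable_norm[OF lborel_integrable_translate[OF f, of y]]
    have "(\<integral>z. norm (f (z + y) - f z) \<partial>lborel) \<le> (\<integral>z. norm (f (z + y)) + norm (f z) \<partial>lborel)"
      by (intro integral_mono integrable_norm Bochner_Integration.integrable_diff
          lborel_integrable_translate f Bochner_Integration.integrable_add norm_triangle_ineq4)
    also have "\<dots> = (\<integral>z. norm (f (z + y)) \<partial>lborel) + (\<integral>z. norm (f z) \<partial>lborel)"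
      using I by (rule Bochner_Integration.integral_add[rotated])
    also have "(\<integral>z. norm (f (z + y)) \<partial>lborel) = (\<integral>z. norm (f z) \<partial>lborel)"
      by (rule lborel_integral_translate) measurable
    finally show ?thesis by simp
  qed
  then have "integrable lborel (\<lambda>z. mollify \<delta> f z - f z)"
    by (intro integrable_mollify_aux[OF f \<delta>, where e = "2 * (\<integral>z. norm (f z) \<partial>lborel)"]) auto
  then show ?thesis
    using f Bochner_Integration.integrable_add by force
qed

lemma mollify_tendsto_L1:
  fixes f :: "'a::euclidean_space \<Rightarrow> 'b::{banach, second_countable_topology}"
  assumes f: "integrable lborel f"
  shows "((\<lambda>\<delta>. \<integral>z. norm (mollify \<delta> f z - f z) \<partial>lborel) \<longlongrightarrow> 0) (at_right 0)"
proof (rule tendstoI)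
  fix e :: real assume e: "e > 0"
  then obtain d where d: "d > 0" "\<forall>y. norm y < d \<longrightarrow> (\<integral>z. norm (f (z + y) - f z) \<partial>lborel) \<le> e / 2"
    using L1_translation_continuous[OF f, of "e / 2"] by auto
  have "eventually (\<lambda>\<delta>. \<delta> \<in> {0<..<d}) (at_right 0)"
    using d(1) by (rule eventually_at_right_real)
  then show "eventually (\<lambda>\<delta>. dist (\<integral>z. norm (mollify \<delta> f z - f z) \<partial>lborel) 0 < e) (at_right 0)"
  proof (rule eventually_mono)
    fix \<delta> assume \<delta>: "\<delta> \<in> {0<..<d}"
    then have "(\<integral>z. norm (mollify \<delta> f z - f z) \<partial>lborel) \<le> e / 2"
      using d e by (intro mollify_L1_le_aux[OF f]) auto
    then show "dist (\<integral>z. norm (mollify \<delta> f z - f z) \<partial>lborel) 0 < e"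
      using e by (simp add: integral_nonneg)
  qed
qed

lemma mollify_AE_subseq:
  fixes f :: "'a::euclidean_space \<Rightarrow> 'b::{banach, second_countable_topology}"
  assumes f: "integrable lborel f" and d: "d > 0"
  obtains \<delta> :: "nat \<Rightarrow> real" where "\<And>n. \<delta> n > 0" "\<And>n. \<delta> n < d" "\<delta> \<longlonglongrightarrow> 0"
    "AE z in lborel. (\<lambda>n. mollify (\<delta> n) f z) \<longlonglongrightarrow> f z"
proof -
  define r where "r n = d * inverse (real (Suc (Suc n)))" for n
  have r: "r n > 0" "r n < d" for n
    using d mult_strict_left_mono[of "inverse (real (Suc (Suc n)))" 1 d]
    by (auto simp: r_def inverse_less_1_iff simp del: of_nat_Suc)
  have r0: "r \<longlonglongrightarrow> 0"
    unfolding r_def by (rule tendsto_mult_right_zero[OF LIMSEQ_Suc[OF LIMSEQ_inverse_real_of_nat]])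
  have "filterlim r (at_right 0) sequentially"
    using r0 r by (auto simp: filterlim_at intro!: always_eventually) (metis less_irrefl)
  then have L: "(\<lambda>n. \<integral>z. norm (mollify (r n) f z - f z) \<partial>lborel) \<longlonglongrightarrow> 0"
    by (rule filterlim_compose[OF mollify_tendsto_L1[OF f]])
  obtain q :: "nat \<Rightarrow> nat" where q: "strict_mono q" "AE z in lborel. (\<lambda>n. mollify (r (q n)) f z - f z) \<longlonglongrightarrow> 0"
    using tendsto_L1_AE_subseq[OF _ L] integrable_mollify[OF f r(1)] f by auto
  show ?thesis
  proof (rule that[of "\<lambda>n. r (q n)"])
    show "(\<lambda>n. r (q n)) \<longlonglongrightarrow> 0"
      using LIMSEQ_subseq_LIMSEQ[OF r0 q(1)] by (simp add: o_def)
    show "AE z in lborel. (\<lambda>n. mollify (r (q n)) f z) \<longlonglongrightarrow> f z"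
      using q(2) by eventually_elim (simp add: LIM_zero_iff)
  qed (use r in auto)
qed

section \<open>Integration lemmas\<close>

text \<open>Dominated convergence with a majorant \<open>m n\<close> that depends on n and converges
  in L^1. The mollified integrands come with such majorants, namely mollifications of one integrable
  function.\<close>

lemma dominated_convergence_L1_bound:
  fixes s :: "nat \<Rightarrow> 'a \<Rightarrow> real"
  assumes [measurable]: "\<And>n. s n \<in> borel_measurable M" "f \<in> borel_measurable M"
    and m: "\<And>n. integrable M (m n)" "integrable M g"
    and L1: "(\<lambda>n. \<integral>x. \<bar>m n x - g x\<bar> \<partial>M) \<longlonglongrightarrow> 0"
    and lim: "AE x in M. (\<lambda>n. s n x) \<longlonglongrightarrow> f x" "AE x in M. (\<lambda>n. m n x) \<longlonglongrightarrow> g x"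
    and le: "\<And>n x. \<bar>s n x\<bar> \<le> m n x"
  shows "(\<lambda>n. \<integral>x. s n x \<partial>M) \<longlonglongrightarrow> (\<integral>x. f x \<partial>M)" and "integrable M f"
proof -
  note [measurable] = borel_measurable_integrable[OF m(1)] borel_measurable_integrable[OF m(2)]
  have m0: "0 \<le> m n x" for n x using le[of n x] by linarith
  have fg: "AE x in M. \<bar>f x\<bar> \<le> g x"
    using lim by eventually_elim (rule LIMSEQ_le[OF tendsto_rabs], auto intro: le)
  show f: "integrable M f"
    by (rule Bochner_Integration.integrable_bound[OF m(2)]) (use fg in auto)
  have s: "integrable M (s n)" for n
    by (rule Bochner_Integration.integrable_bound[OF m(1)[of n]])
      (use le in \<open>auto intro!: AE_I2 order_trans[OF le abs_ge_self]\<close>)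
  \<comment> \<open>Clipping at \<bar>g\<bar> brings ordinary dominated convergence into play. Since
    \<bar>s n x\<bar> \<le> m n x, the part cut off is at most \<bar>m n x - g x\<bar>, which tends
    to zero in L^1.\<close>
  define c where "c n x = max (- \<bar>g x\<bar>) (min \<bar>g x\<bar> (s n x))" for n x
  have [measurable]: "c n \<in> borel_measurable M" for n unfolding c_def by measurable
  have c_lim: "(\<lambda>n. \<integral>x. c n x \<partial>M) \<longlonglongrightarrow> (\<integral>x. f x \<partial>M)"
  proof (rule integral_dominated_convergence[where w = "\<lambda>x. \<bar>g x\<bar>"])
    show "AE x in M. (\<lambda>n. c n x) \<longlonglongrightarrow> f x"
      using lim(1) fg
    proof eventually_elim
      case (elim x)
      then have "(\<lambda>n. c n x) \<longlonglongrightarrow> max (- \<bar>g x\<bar>) (min \<bar>g x\<bar> (f x))"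
        unfolding c_def by (intro tendsto_intros)
      then show ?case using elim by (simp add: min_def max_def abs_le_iff split: if_splits)
    qed
    show "AE x in M. norm (c n x) \<le> \<bar>g x\<bar>" for n
      by (auto simp: c_def)
  qed (use m in auto)
  have c: "integrable M (c n)" for n
    by (rule Bochner_Integration.integrable_bound[OF m(2)]) (auto simp: c_def)
  have "(\<lambda>n. (\<integral>x. s n x \<partial>M) - (\<integral>x. c n x \<partial>M)) \<longlonglongrightarrow> 0"
  proof (rule Lim_null_comparison[OF _ L1], rule always_eventually, rule allI)
    fix n
    have "norm ((\<integral>x. s n x \<partial>M) - (\<integral>x. c n x \<partial>M)) = \<bar>\<integral>x. s n x - c n x \<partial>M\<bar>"
      using s c by simp
    also have "\<dots> \<le> (\<integral>x. \<bar>s n x - c n x\<bar> \<partial>M)" by (rule integral_abs_bound)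
    also have "\<dots> \<le> (\<integral>x. \<bar>m n x - g x\<bar> \<partial>M)"
    proof (rule integral_mono)
      show "\<bar>s n x - c n x\<bar> \<le> \<bar>m n x - g x\<bar>" for x
        using le[of n x] by (auto simp: c_def max_def min_def abs_le_iff split: if_splits)
    qed (use s c m in auto)
    finally show "norm ((\<integral>x. s n x \<partial>M) - (\<integral>x. c n x \<partial>M)) \<le> (\<integral>x. \<bar>m n x - g x\<bar> \<partial>M)" .
  qed
  from tendsto_add[OF this c_lim] show "(\<lambda>n. \<integral>x. s n x \<partial>M) \<longlonglongrightarrow> (\<integral>x. f x \<partial>M)" by simp
qed

lemma Young_powr:
  fixes x y p :: real
  assumes "x \<ge> 0" "y \<ge> 0" "p > 1"
  shows "x * y \<le> x powr (p / (p - 1)) + y powr p"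
proof (cases "x = 0 \<or> y = 0")
  case False
  with assms have pos: "x > 0" "y > 0" by auto
  show ?thesis
  proof (cases "x \<le> y powr (p - 1)")
    case True
    then have "x * y \<le> y powr (p - 1) * y" using pos by (intro mult_right_mono) auto
    also have "\<dots> = y powr p" using pos powr_add[of y "p - 1" 1] by simp
    finally show ?thesis using powr_ge_zero[of x "p / (p - 1)"] by linarith
  next
    case False
    then have "y powr (p - 1) \<le> x" by simp
    then have "(y powr (p - 1)) powr (1 / (p - 1)) \<le> x powr (1 / (p - 1))"
      using assms by (intro powr_mono2) auto
    then have "y \<le> x powr (1 / (p - 1))" using assms pos by (simp add: powr_powr)
    then have "x * y \<le> x * x powr (1 / (p - 1))" using pos by (intro mult_left_mono) auto
    also have "\<dots> = x powr (1 + 1 / (p - 1))" using pos by (simp add: powr_add)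
    also have "1 + 1 / (p - 1) = p / (p - 1)" using assms by (simp add: field_simps)
    finally show ?thesis using powr_ge_zero[of y p] by linarith
  qed
qed auto

text \<open>Integrating Young's inequality against the product of two copies of the mollifier
  replaces Jensen's inequality.\<close>
lemma mollify_mult_le:
  fixes A G :: "'a::euclidean_space \<Rightarrow> real"
  assumes A: "integrable lborel A" and G: "integrable lborel G"
    and F: "integrable lborel F" "integrable lborel H" and \<delta>: "\<delta> > 0"
    and le: "\<And>y y'. A y * G y' \<le> F y + H y'"
  shows "mollify \<delta> A z * mollify \<delta> G z \<le> mollify \<delta> F z + mollify \<delta> H z"
proof -
  have 1: "mollify \<delta> A z * G y' \<le> mollify \<delta> F z + H y'" for y'
  proof -
    have "mollify \<delta> A z * G y' = (\<integral>y. moll \<delta> (z - y) * (A y * G y') \<partial>lborel)"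
      using integrable_moll_scaleR[OF A \<delta>, of z] by (simp add: mollify_def mult.assoc[symmetric])
    also have "\<dots> \<le> (\<integral>y. moll \<delta> (z - y) * F y + moll \<delta> (z - y) * H y' \<partial>lborel)"
    proof (rule integral_mono)
      show "integrable lborel (\<lambda>y. moll \<delta> (z - y) * (A y * G y'))"
        using integrable_moll_scaleR[OF A \<delta>, of z] by (simp add: mult.assoc[symmetric])
      show "integrable lborel (\<lambda>y. moll \<delta> (z - y) * F y + moll \<delta> (z - y) * H y')"
        using integrable_moll_scaleR[OF F(1) \<delta>, of z] lborel_integrable_translate[OF integrable_moll[OF \<delta>], of "- z"]
        by (auto simp: moll_minus[of \<delta> "z - _", simplified, symmetric])
      show "moll \<delta> (z - y) * (A y * G y') \<le> moll \<delta> (z - y) * F y + moll \<delta> (z - y) * H y'" for y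
        using mult_left_mono[OF le moll_nonneg] by (simp add: distrib_left)
    qed
    also have "\<dots> = mollify \<delta> F z + mollify \<delta> (\<lambda>_. H y') z"
      unfolding mollify_def
      using integrable_moll_scaleR[OF F(1) \<delta>, of z] lborel_integrable_translate[OF integrable_moll[OF \<delta>], of "- z"]
      by (subst Bochner_Integration.integral_add) (auto simp: moll_minus[of \<delta> "z - _", simplified, symmetric])
    finally show ?thesis by (simp add: mollify_const[OF \<delta>])
  qed
  have "mollify \<delta> A z * mollify \<delta> G z = (\<integral>y. moll \<delta> (z - y) * (mollify \<delta> A z * G y) \<partial>lborel)"
    using integrable_moll_scaleR[OF G \<delta>, of z] unfolding mollify_def[of \<delta> G]
    by (simp add: mult.left_commute)
  also have "\<dots> \<le> (\<integral>y. moll \<delta> (z - y) * H y + moll \<delta> (z - y) * mollify \<delta> F z \<partial>lborel)"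
  proof (rule integral_mono)
    show "integrable lborel (\<lambda>y. moll \<delta> (z - y) * (mollify \<delta> A z * G y))"
      using integrable_moll_scaleR[OF G \<delta>, of z] by (simp add: mult.left_commute)
    show "integrable lborel (\<lambda>y. moll \<delta> (z - y) * H y + moll \<delta> (z - y) * mollify \<delta> F z)"
      using integrable_moll_scaleR[OF F(2) \<delta>, of z] lborel_integrable_translate[OF integrable_moll[OF \<delta>], of "- z"]
      by (auto simp: moll_minus[of \<delta> "z - _", simplified, symmetric])
    show "moll \<delta> (z - y) * (mollify \<delta> A z * G y) \<le> moll \<delta> (z - y) * H y + moll \<delta> (z - y) * mollify \<delta> F z" for y
      using mult_left_mono[OF 1 moll_nonneg] by (simp add: distrib_left add.commute)
  qed
  also have "\<dots> = mollify \<delta> H z + mollify \<delta> (\<lambda>_. mollify \<delta> F z) z"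
    unfolding mollify_def[of \<delta> H] mollify_def[of \<delta> "\<lambda>_. mollify \<delta> F z"]
    using integrable_moll_scaleR[OF F(2) \<delta>, of z] lborel_integrable_translate[OF integrable_moll[OF \<delta>], of "- z"]
    by (subst Bochner_Integration.integral_add) (auto simp: moll_minus[of \<delta> "z - _", simplified, symmetric])
  finally show ?thesis by (simp add: mollify_const[OF \<delta>])
qed

section \<open>A bounded smooth sign function\<close>

text \<open>\<open>sgnS\<close> meets four demands at once: it is bounded by 1, so its product with
  an integrable right-hand side is integrable; it is bounded by \<bar>s\<bar>, so w itself controls
  the boundary layer; its derivative \<open>sgnS'\<close> lies in [0, 1]; and its primitive
  \<open>absS\<close> vanishes only at 0, which gives w = 0 in the end.\<close>

definition sgnS :: "real \<Rightarrow> real" where "sgnS s = s / sqrt (1 + s\<^sup>2)"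
definition sgnS' :: "real \<Rightarrow> real" where "sgnS' s = 1 / (sqrt (1 + s\<^sup>2) * (1 + s\<^sup>2))"
definition absS :: "real \<Rightarrow> real" where "absS s = sqrt (1 + s\<^sup>2) - 1"

lemma one_plus_square_pos: "1 + (s::real)\<^sup>2 > 0"
  by (simp add: add_pos_nonneg)

lemma DERIV_absS: "(absS has_real_derivative sgnS s) (at s)"
  unfolding absS_def[abs_def] sgnS_def using one_plus_square_pos[of s]
  by (auto intro!: derivative_eq_intros simp: field_simps)

lemma DERIV_sgnS: "(sgnS has_real_derivative sgnS' s) (at s)"
proof -
  have pos: "1 + s\<^sup>2 > 0" "sqrt (1 + s\<^sup>2) > 0" using one_plus_square_pos[of s] by auto
  have sq: "sqrt (1 + s\<^sup>2) * sqrt (1 + s\<^sup>2) = 1 + s\<^sup>2" using pos by simp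
  have "(sgnS has_real_derivative ((sqrt (1 + s\<^sup>2) - s * (s / sqrt (1 + s\<^sup>2))) / (1 + s\<^sup>2))) (at s)"
  proof -
    have "((\<lambda>s. sqrt (1 + s\<^sup>2)) has_real_derivative s / sqrt (1 + s\<^sup>2)) (at s)"
      using pos by (auto intro!: derivative_eq_intros simp: field_simps)
    from DERIV_divide[OF DERIV_ident this] pos show ?thesis
      unfolding sgnS_def[abs_def] by (simp add: sq)
  qed
  moreover have "(sqrt (1 + s\<^sup>2) - s * (s / sqrt (1 + s\<^sup>2))) / (1 + s\<^sup>2) = sgnS' s"
  proof -
    have "sqrt (1 + s\<^sup>2) - s * (s / sqrt (1 + s\<^sup>2)) = (sqrt (1 + s\<^sup>2) * sqrt (1 + s\<^sup>2) - s * s) / sqrt (1 + s\<^sup>2)"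
      using pos by (simp add: field_simps)
    also have "\<dots> = 1 / sqrt (1 + s\<^sup>2)" unfolding sq by (simp add: power2_eq_square)
    finally show ?thesis by (simp add: sgnS'_def)
  qed
  ultimately show ?thesis by simp
qed

lemma sgnS_0 [simp]: "sgnS 0 = 0" and absS_0 [simp]: "absS 0 = 0"
  by (auto simp: sgnS_def absS_def)

lemma continuous_on_sgnS: "continuous_on UNIV sgnS"
  using DERIV_sgnS by (meson DERIV_isCont continuous_at_imp_continuous_on)

lemma continuous_on_absS: "continuous_on UNIV absS"
  using DERIV_absS by (meson DERIV_isCont continuous_at_imp_continuous_on)

lemma continuous_on_sgnS': "continuous_on UNIV sgnS'"
  unfolding sgnS'_def[abs_def]
  by (intro continuous_intros) (use one_plus_square_pos in \<open>auto simp: less_le add_nonneg_eq_0_iff\<close>)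

lemma sgnS_measurable [measurable]: "sgnS \<in> borel_measurable borel" "absS \<in> borel_measurable borel"
  "sgnS' \<in> borel_measurable borel"
  using continuous_on_sgnS continuous_on_absS continuous_on_sgnS' by (auto intro: borel_measurable_continuous_onI)

lemma abs_sgnS_le: "\<bar>sgnS s\<bar> \<le> 1" "\<bar>sgnS s\<bar> \<le> \<bar>s\<bar>"
proof -
  have "\<bar>s\<bar> \<le> sqrt (1 + s\<^sup>2)" by (rule real_le_rsqrt) simp
  moreover have "1 \<le> sqrt (1 + s\<^sup>2)" by simp
  ultimately show "\<bar>sgnS s\<bar> \<le> 1" "\<bar>sgnS s\<bar> \<le> \<bar>s\<bar>"
    using one_plus_square_pos[of s] mult_left_mono[of 1 "sqrt (1 + s\<^sup>2)" "\<bar>s\<bar>"]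
    by (auto simp: sgnS_def divide_le_eq)
qed

lemma sgnS'_bounds: "0 \<le> sgnS' s" "sgnS' s \<le> 1"
proof -
  have "1 * 1 \<le> sqrt (1 + s\<^sup>2) * (1 + s\<^sup>2)" by (rule mult_mono) auto
  then show "0 \<le> sgnS' s" "sgnS' s \<le> 1" by (auto simp: sgnS'_def)
qed

lemma absS_bounds: "0 \<le> absS s" "absS s \<le> \<bar>s\<bar>"
proof -
  have "1 + s\<^sup>2 \<le> (1 + \<bar>s\<bar>)\<^sup>2" by (simp add: power2_sum)
  then have "sqrt (1 + s\<^sup>2) \<le> 1 + \<bar>s\<bar>" by (intro real_le_lsqrt) auto
  then show "0 \<le> absS s" "absS s \<le> \<bar>s\<bar>" by (auto simp: absS_def)
qed

lemma absS_eq_0_iff: "absS s = 0 \<longleftrightarrow> s = 0"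
  by (simp add: absS_def)

lemma sgnS_mult_nonpos: "s * x \<le> 0 \<Longrightarrow> sgnS s * x \<le> 0"
  using one_plus_square_pos[of s] by (simp add: sgnS_def divide_le_0_iff)

section \<open>Cutoff functions\<close>

lemma DERIV_abs_le_Lipschitz:
  fixes f :: "real \<Rightarrow> real"
  assumes "(f has_real_derivative D) (at 0)" "\<And>s. \<bar>f s - f 0\<bar> \<le> L * \<bar>s\<bar>"
  shows "\<bar>D\<bar> \<le> L"
proof -
  have "((\<lambda>h. (f h - f 0) / h) \<longlongrightarrow> D) (at 0)" using assms(1) by (simp add: DERIV_def)
  then have "((\<lambda>h. \<bar>(f h - f 0) / h\<bar>) \<longlongrightarrow> \<bar>D\<bar>) (at 0)" by (rule tendsto_rabs)
  moreover have "eventually (\<lambda>h. \<bar>(f h - f 0) / h\<bar> \<le> L) (at 0)"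
    using assms(2) by (auto simp: eventually_at_filter divide_le_eq)
  ultimately show ?thesis by (intro tendsto_upperbound) auto
qed

text \<open>A ramp in the distance to the complement is mollified at radius \<epsilon>. Averaging
  keeps its Lipschitz constant 1/\<epsilon>, which bounds the derivatives without any smoothness of
  the distance function.\<close>

lemma cutoff_exists:
  fixes \<Omega> :: "'a::euclidean_space set"
  assumes \<Omega>: "open \<Omega>" "bounded \<Omega>" and \<epsilon>: "\<epsilon> > 0"
  obtains \<eta> :: "'a \<Rightarrow> real" and \<eta>' :: "'a \<Rightarrow> 'a \<Rightarrow> real" where
    "\<And>b x. ((\<lambda>s. \<eta> (x + s *\<^sub>R b)) has_real_derivative \<eta>' b x) (at 0)"
    "continuous_on UNIV \<eta>" "\<And>b. continuous_on UNIV (\<eta>' b)"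
    "\<And>x. 0 \<le> \<eta> x" "\<And>x. \<eta> x \<le> 1"
    "\<And>b x. \<bar>\<eta>' b x\<bar> \<le> norm b / \<epsilon>"
    "\<And>x. \<eta> x \<noteq> 0 \<Longrightarrow> infdist x (- \<Omega>) > \<epsilon>"
    "\<And>x. infdist x (- \<Omega>) \<ge> 4 * \<epsilon> \<Longrightarrow> \<eta> x = 1"
    "\<And>b x. \<eta>' b x \<noteq> 0 \<Longrightarrow> infdist x (- \<Omega>) \<ge> \<epsilon> \<and> infdist x (- \<Omega>) \<le> 4 * \<epsilon>"
proof -
  define d where "d x = infdist x (- \<Omega>)" for x
  have d_lip: "\<bar>d x - d y\<bar> \<le> norm (x - y)" for x y
    unfolding d_def using infdist_triangle_abs[of x "- \<Omega>" y] by (simp add: dist_norm)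
  have d_cont: "continuous_on UNIV d" unfolding d_def[abs_def] by (intro continuous_intros)
  \<comment> \<open>The ramp rises for distances between 2\<epsilon> and 3\<epsilon>. Mollification
    widens this zone by \<epsilon> on either side, which explains the bounds \<epsilon> and
    4\<epsilon> of the conclusion.\<close>
  define \<kappa> where "\<kappa> x = max 0 (min 1 ((d x - 2 * \<epsilon>) / \<epsilon>))" for x
  have \<kappa>_cont: "continuous_on UNIV \<kappa>" unfolding \<kappa>_def[abs_def] divide_inverse by (intro continuous_intros d_cont)
  have \<kappa>_bd: "0 \<le> \<kappa> x" "\<kappa> x \<le> 1" for x by (auto simp: \<kappa>_def)
  have \<kappa>_0: "\<kappa> x = 0" if "d x \<le> 2 * \<epsilon>" for x using that \<epsilon> by (simp add: \<kappa>_def divide_nonpos_pos)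
  have \<kappa>_1: "\<kappa> x = 1" if "d x \<ge> 3 * \<epsilon>" for x
  proof -
    have "1 \<le> (d x - 2 * \<epsilon>) / \<epsilon>" using that \<epsilon> by (simp add: le_divide_eq)
    then show ?thesis by (simp add: \<kappa>_def)
  qed
  have \<kappa>_lip: "\<bar>\<kappa> x - \<kappa> y\<bar> \<le> norm (x - y) / \<epsilon>" for x y
  proof -
    have "\<bar>\<kappa> x - \<kappa> y\<bar> \<le> \<bar>(d x - 2 * \<epsilon>) / \<epsilon> - (d y - 2 * \<epsilon>) / \<epsilon>\<bar>"
      unfolding \<kappa>_def by linarith
    also have "\<dots> = \<bar>d x - d y\<bar> / \<epsilon>" using \<epsilon> by (simp add: diff_divide_distrib[symmetric])
    also have "\<dots> \<le> norm (x - y) / \<epsilon>" using \<epsilon> d_lip by (intro divide_right_mono) auto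
    finally show ?thesis .
  qed
  obtain R where R: "\<And>x. x \<in> \<Omega> \<Longrightarrow> norm x \<le> R" using \<Omega> by (auto simp: bounded_iff)
  have "\<kappa> x = 0" if "norm x > R" for x
    using R[of x] that \<epsilon> infdist_zero[of x "- \<Omega>"] by (intro \<kappa>_0) (force simp: d_def)
  then have \<kappa>_int: "integrable lborel \<kappa>" by (rule integrable_bounded_continuous_cball[OF \<kappa>_cont])
  have [measurable]: "\<kappa> \<in> borel_measurable borel" using \<kappa>_cont by (rule borel_measurable_continuous_onI)
  define \<eta> where "\<eta> = mollify \<epsilon> \<kappa>"
  define \<eta>' where "\<eta>' b = mollify_deriv \<epsilon> \<kappa> b" for b
  have D: "((\<lambda>s. \<eta> (x + s *\<^sub>R b)) has_real_derivative \<eta>' b x) (at 0)" for b x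
    unfolding \<eta>_def \<eta>'_def by (rule DERIV_mollify[OF \<kappa>_int \<epsilon>])
  have ball: "d y \<le> d x + \<epsilon>" "d x \<le> d y + \<epsilon>" "d y < d x + \<epsilon>" "d x < d y + \<epsilon>" if "y \<in> ball x \<epsilon>" for x y
    using d_lip[of x y] that by (auto simp: dist_norm)
  have \<eta>_0: "\<eta> x = 0" if "d x \<le> \<epsilon>" for x
  proof -
    have "\<eta> x = mollify \<epsilon> (\<lambda>_. 0) x" unfolding \<eta>_def
      using ball[of _ x] that by (intro mollify_local_cong[OF \<epsilon>] \<kappa>_0) (smt (verit))
    then show ?thesis by (simp add: mollify_const[OF \<epsilon>])
  qed
  have \<eta>_1: "\<eta> x = 1" if "d x \<ge> 4 * \<epsilon>" for x
  proof -
    have "\<eta> x = mollify \<epsilon> (\<lambda>_. 1) x" unfolding \<eta>_def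
      using ball[of _ x] that by (intro mollify_local_cong[OF \<epsilon>] \<kappa>_1) (smt (verit))
    then show ?thesis by (simp add: mollify_const[OF \<epsilon>])
  qed
  have I: "integrable lborel (\<lambda>y. moll \<epsilon> y * \<kappa> (x + y))" for x
    using lborel_integrable_translate[OF integrable_moll_scaleR[OF \<kappa>_int \<epsilon>, of x], of x]
    by (simp add: moll_minus add.commute)
  have le: "mollify \<epsilon> \<kappa> x \<le> c" if "\<And>y. \<kappa> y \<le> c" for x c
  proof -
    have "mollify \<epsilon> \<kappa> x \<le> (\<integral>y. moll \<epsilon> y *\<^sub>R c \<partial>(lborel::'a measure))"
      unfolding mollify_eq[OF \<open>\<kappa> \<in> borel_measurable borel\<close>]
      using I[of x] integrable_moll[OF \<epsilon>] that
      by (intro integral_mono) (auto intro!: mult_left_mono moll_nonneg)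
    also have "\<dots> = c" using mollify_const[OF \<epsilon>, of c "0::'a"] by (simp add: mollify_eq)
    finally show ?thesis .
  qed
  have \<eta>_lip: "\<bar>\<eta> x - \<eta> y\<bar> \<le> norm (x - y) / \<epsilon>" for x y
  proof -
    have "\<eta> x - \<eta> y = (\<integral>v. moll \<epsilon> v * (\<kappa> (x + v) - \<kappa> (y + v)) \<partial>lborel)"
      unfolding \<eta>_def using I by (simp add: mollify_eq right_diff_distrib)
    also have "\<bar>\<dots>\<bar> \<le> (\<integral>v. \<bar>moll \<epsilon> v * (\<kappa> (x + v) - \<kappa> (y + v))\<bar> \<partial>lborel)" by (rule integral_abs_bound)
    also have "\<dots> \<le> (\<integral>v. moll \<epsilon> v *\<^sub>R (norm (x - y) / \<epsilon>) \<partial>(lborel::'a measure))"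
    proof (rule integral_mono)
      show "integrable lborel (\<lambda>v. \<bar>moll \<epsilon> v * (\<kappa> (x + v) - \<kappa> (y + v))\<bar>)"
        using I by (simp add: right_diff_distrib)
      show "integrable lborel (\<lambda>v::'a. moll \<epsilon> v *\<^sub>R (norm (x - y) / \<epsilon>))"
        using integrable_moll[OF \<epsilon>] by (intro integrable_scaleR_left)
      show "\<bar>moll \<epsilon> v * (\<kappa> (x + v) - \<kappa> (y + v))\<bar> \<le> moll \<epsilon> v *\<^sub>R (norm (x - y) / \<epsilon>)" for v
        using mult_left_mono[OF \<kappa>_lip[of "x + v" "y + v"] moll_nonneg, of \<epsilon> v]
        by (simp add: abs_mult moll_nonneg)
    qed
    also have "\<dots> = norm (x - y) / \<epsilon>"
      using mollify_const[OF \<epsilon>, of "norm (x - y) / \<epsilon>" "0::'a"] by (simp add: mollify_eq)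
    finally show ?thesis .
  qed
  \<comment> \<open>A vanishing derivative requires constancy on an open set, so it is obtained for
    distances strictly below \<epsilon> or strictly above 4\<epsilon>.\<close>
  have \<eta>'_0: "\<eta>' b x = 0" if "open U" "x \<in> U" "\<And>y. y \<in> U \<Longrightarrow> \<eta> y = c" for b x U c
  proof -
    have "open ((\<lambda>s. x + s *\<^sub>R b) -` U)"
      by (intro open_vimage that) (auto intro!: continuous_intros)
    then have "((\<lambda>s. \<eta> (x + s *\<^sub>R b)) has_real_derivative 0) (at 0)"
      by (intro has_field_derivative_transform_within_open[OF DERIV_const[of c], where S = "(\<lambda>s. x + s *\<^sub>R b) -` U"])
        (use that in auto)
    with D[of x b] show ?thesis by (rule DERIV_unique)
  qed
  show ?thesis
  proof (rule that[of \<eta> \<eta>'])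
    show "((\<lambda>s. \<eta> (x + s *\<^sub>R b)) has_real_derivative \<eta>' b x) (at 0)" for b x by (rule D)
    show "continuous_on UNIV \<eta>" unfolding \<eta>_def by (rule continuous_on_mollify[OF \<kappa>_int \<epsilon>])
    show "continuous_on UNIV (\<eta>' b)" for b unfolding \<eta>'_def by (rule continuous_on_mollify_deriv[OF \<kappa>_int \<epsilon>])
    show "0 \<le> \<eta> x" for x unfolding \<eta>_def mollify_def using \<kappa>_bd by (intro Bochner_Integration.integral_nonneg) (simp add: moll_nonneg)
    show "\<eta> x \<le> 1" for x unfolding \<eta>_def by (intro le \<kappa>_bd)
    show "\<bar>\<eta>' b x\<bar> \<le> norm b / \<epsilon>" for b x
      by (rule DERIV_abs_le_Lipschitz[OF D]) (use \<eta>_lip[of "x + _ *\<^sub>R b" x] in \<open>simp add: mult.commute\<close>)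
    show "infdist x (- \<Omega>) > \<epsilon>" if "\<eta> x \<noteq> 0" for x
      using \<eta>_0[of x] that by (force simp: d_def not_le[symmetric])
    show "\<eta> x = 1" if "infdist x (- \<Omega>) \<ge> 4 * \<epsilon>" for x
      using \<eta>_1[of x] that by (simp add: d_def)
    show "infdist x (- \<Omega>) \<ge> \<epsilon> \<and> infdist x (- \<Omega>) \<le> 4 * \<epsilon>" if "\<eta>' b x \<noteq> 0" for b x
    proof (rule ccontr)
      assume "\<not> ?thesis"
      then consider "d x < \<epsilon>" | "d x > 4 * \<epsilon>" by (auto simp: d_def not_le)
      then show False
      proof cases
        case 1
        have "open {x. d x < \<epsilon>}" using d_cont by (intro open_Collect_less) auto
        from \<eta>'_0[OF this, of x 0 b] 1 that \<eta>_0 show False by auto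
      next
        case 2
        have "open {x. d x > 4 * \<epsilon>}" using d_cont by (intro open_Collect_less) auto
        from \<eta>'_0[OF this, of x 1 b] 2 that \<eta>_1 show False by auto
      qed
    qed
  qed
qed

section \<open>The equation for a difference of two solutions\<close>

lemma le_one_plus_powr:
  fixes x q :: real assumes "x \<ge> 0" "q \<ge> 1" shows "x \<le> 1 + x powr q"
proof (cases "x \<le> 1")
  case False
  then have "x powr 1 \<le> x powr q" using assms by (intro powr_mono) auto
  then show ?thesis using False by simp
qed (use powr_ge_zero[of x q] in linarith)

lemma integrable_of_powr:
  fixes f :: "'a::euclidean_space \<Rightarrow> 'b::euclidean_space"
  assumes [measurable]: "f \<in> borel_measurable borel" and Q: "bounded Q" "Q \<in> sets borel"
    and f0: "\<And>z. z \<notin> Q \<Longrightarrow> f z = 0" and q: "q \<ge> 1"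
    and int: "integrable lborel (\<lambda>z. norm (f z) powr q)"
  shows "integrable lborel f"
proof (rule Bochner_Integration.integrable_bound)
  have "emeasure lborel Q < \<infinity>" using emeasure_bounded_finite[OF Q(1)] by simp
  then show "integrable lborel (\<lambda>z. indicator Q z + norm (f z) powr q)"
    using Q int by (intro Bochner_Integration.integrable_add integrable_real_indicator) auto
  have "norm (f z) \<le> norm (indicator Q z + norm (f z) powr q)" for z
    using f0[of z] le_one_plus_powr[of "norm (f z)" q] q by (cases "z \<in> Q") auto
  then show "AE z in lborel. norm (f z) \<le> norm (indicator Q z + norm (f z) powr q)" by simp
qed simp

lemma GDERIV_moll_reflect:
  "GDERIV (\<lambda>y. moll \<delta> (z - y)) y :> - moll_grad \<delta> (z - y)" for z :: "'c::euclidean_space"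
proof -
  have "((\<lambda>y. moll \<delta> (z - y)) has_derivative (\<lambda>h. (- h) \<bullet> moll_grad \<delta> (z - y))) (at y)"
    by (rule has_derivative_compose[where g = "moll \<delta>" and f = "\<lambda>y. z - y"])
      (use GDERIV_moll[of \<delta> "z - y"] in \<open>auto intro!: derivative_eq_intros simp: gderiv_def\<close>)
  then show ?thesis by (simp add: gderiv_def)
qed

lemma GDERIV_imp_dir_deriv:
  assumes "GDERIV f z :> D"
  shows "((\<lambda>s. f (z + s *\<^sub>R b)) has_real_derivative D \<bullet> b) (at 0)"
proof -
  have "(f has_derivative (\<lambda>h. h \<bullet> D)) (at (z + 0 *\<^sub>R b))"
    using assms by (simp add: gderiv_def)
  then have "((\<lambda>s. f (z + s *\<^sub>R b)) has_derivative (\<lambda>s. (s *\<^sub>R b) \<bullet> D)) (at 0)"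
    by (rule has_derivative_compose[rotated]) (auto intro!: derivative_eq_intros)
  then show ?thesis
    by (simp add: has_field_derivative_def inner_commute mult_commute_abs)
qed

lemma moll_reflect_support:
  fixes z y :: "'c::euclidean_space"
  assumes "\<delta> > 0" "norm y > norm z + \<delta>" shows "moll \<delta> (z - y) = 0" "moll_grad \<delta> (z - y) = 0"
proof -
  have "norm (z - y) \<ge> \<delta>" using assms norm_triangle_ineq2[of y z] by (simp add: norm_minus_commute)
  then show "moll \<delta> (z - y) = 0" "moll_grad \<delta> (z - y) = 0"
    using assms by (auto intro: moll_eq_0 moll_grad_eq_0)
qed

text \<open>Every function below vanishes outside the cylinder; in particular the equation carries the
  vanishing initial datum, since its test functions need not vanish at time zero.\<close>
locale difference_equation =
  fixes \<Omega> :: "'a::euclidean_space set" and T p :: real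
    and w H :: "'a \<times> real \<Rightarrow> real" and G A :: "'a \<times> real \<Rightarrow> 'a"
  assumes \<Omega>: "open \<Omega>" "bounded \<Omega>" and p: "p > 1"
    and w_meas [measurable]: "w \<in> borel_measurable borel"
    and H_meas [measurable]: "H \<in> borel_measurable borel"
    and G_meas [measurable]: "G \<in> borel_measurable borel"
    and A_meas [measurable]: "A \<in> borel_measurable borel"
    and zero: "\<And>z. z \<notin> \<Omega> \<times> {0<..<T} \<Longrightarrow> w z = 0 \<and> H z = 0 \<and> G z = 0 \<and> A z = 0"
    and int_w: "integrable lborel w"
    and int_Gp: "integrable lborel (\<lambda>z. norm (G z) powr p)"
    and int_Aq: "integrable lborel (\<lambda>z. norm (A z) powr (p / (p - 1)))"
    and int_H: "\<And>K. compact K \<Longrightarrow> K \<subseteq> \<Omega> \<Longrightarrow> integrable lborel (\<lambda>z. indicator K (fst z) * H z)"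
    and weak_grad: "\<And>\<psi> \<psi>' \<nu> R. (\<And>z. ((\<lambda>s. \<psi> (z + s *\<^sub>R (\<nu>, 0))) has_real_derivative \<psi>' z) (at 0)) \<Longrightarrow>
        continuous_on UNIV \<psi> \<Longrightarrow> continuous_on UNIV \<psi>' \<Longrightarrow>
        (\<And>z. norm z > R \<Longrightarrow> \<psi> z = 0) \<Longrightarrow> (\<And>z. norm z > R \<Longrightarrow> \<psi>' z = 0) \<Longrightarrow>
        (\<integral>z. w z * \<psi>' z \<partial>lborel) = - (\<integral>z. \<psi> z * (G z \<bullet> \<nu>) \<partial>lborel)"
    and weak_eq: "\<And>\<phi> D. (\<And>z. GDERIV \<phi> z :> D z) \<Longrightarrow> continuous_on UNIV D \<Longrightarrow>
        compact (csupp \<phi>) \<Longrightarrow> csupp \<phi> \<subseteq> \<Omega> \<times> {..<T} \<Longrightarrow>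
        - (\<integral>z. w z * snd (D z) \<partial>lborel) + (\<integral>z. A z \<bullet> fst (D z) \<partial>lborel) = (\<integral>z. H z * \<phi> z \<partial>lborel)"
    and monotone: "AE z in lborel. 0 \<le> G z \<bullet> A z"
    and sign: "AE z in lborel. w z * H z \<le> 0"
begin

lemma Q_bounded: "bounded (\<Omega> \<times> {0<..<T})" and Q_borel: "\<Omega> \<times> {0<..<T} \<in> sets borel"
  using \<Omega> by (auto intro!: bounded_Times borel_open open_Times)

lemma int_G: "integrable lborel G"
  by (rule integrable_of_powr[OF G_meas Q_bounded Q_borel _ _ int_Gp]) (use zero p in auto)

lemma int_A: "integrable lborel A"
  by (rule integrable_of_powr[OF A_meas Q_bounded Q_borel _ _ int_Aq]) (use zero p in \<open>auto simp: le_divide_eq\<close>)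

lemma int_A_inner: "integrable lborel (\<lambda>z. A z \<bullet> b)"
  by (intro integrable_inner_left int_A)

text \<open>\<open>weak_grad\<close> admits test functions that cross the boundary of \<Omega>,
  which is how the zero boundary values enter. Hence the identity holds at every z, not only at
  distance \<delta> inside the cylinder.\<close>

lemma mollify_deriv_w:
  assumes \<delta>: "\<delta> > 0"
  shows "mollify_deriv \<delta> w (\<nu>, 0) z = mollify \<delta> G z \<bullet> \<nu>"
proof -
  have "(\<integral>y. w y * (- moll_grad \<delta> (z - y) \<bullet> (\<nu>, 0)) \<partial>lborel)
      = - (\<integral>y. moll \<delta> (z - y) * (G y \<bullet> \<nu>) \<partial>lborel)"
  proof (rule weak_grad[where R = "norm z + \<delta>"])
    show "((\<lambda>s. moll \<delta> (z - (y + s *\<^sub>R (\<nu>, 0)))) has_real_derivative - moll_grad \<delta> (z - y) \<bullet> (\<nu>, 0)) (at 0)" for y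
      by (rule GDERIV_imp_dir_deriv[OF GDERIV_moll_reflect])
    show "continuous_on UNIV (\<lambda>y. moll \<delta> (z - y))"
      by (intro continuous_on_compose2[OF continuous_on_moll] continuous_intros) auto
    show "continuous_on UNIV (\<lambda>y. - moll_grad \<delta> (z - y) \<bullet> (\<nu>, 0))"
      by (intro continuous_intros continuous_on_compose2[OF continuous_on_moll_grad]) auto
  qed (simp_all add: moll_reflect_support[OF \<delta>])
  then have "mollify_deriv \<delta> w (\<nu>, 0) z = mollify \<delta> (\<lambda>y. G y \<bullet> \<nu>) z"
    by (simp add: mollify_deriv_def mollify_def mult.commute)
  also have "\<dots> = mollify \<delta> G z \<bullet> \<nu>"
    by (rule mollify_bounded_linear[OF bounded_linear_inner_left int_G \<delta>])
  finally show ?thesis .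
qed

text \<open>The test function is the kernel reflected about z. Its support may reach below t = 0,
  where everything vanishes; only the lateral boundary and the final time have to be
  avoided.\<close>

lemma mollified_equation:
  assumes \<delta>: "\<delta> > 0" and z: "cball z \<delta> \<subseteq> \<Omega> \<times> {..<T}"
  shows "mollify_deriv \<delta> w (0, 1) z - (\<Sum>b\<in>Basis. mollify_deriv \<delta> (\<lambda>y. A y \<bullet> b) (b, 0) z) = mollify \<delta> H z"
proof -
  have supp: "csupp (\<lambda>y. moll \<delta> (z - y)) \<subseteq> cball z \<delta>"
    unfolding csupp_def using moll_eq_0[OF \<delta>, of "z - _"]
    by (intro closure_minimal) (auto simp: dist_norm, meson le_cases)
  have "- (\<integral>y. w y * snd (- moll_grad \<delta> (z - y)) \<partial>lborel) + (\<integral>y. A y \<bullet> fst (- moll_grad \<delta> (z - y)) \<partial>lborel)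
      = (\<integral>y. H y * moll \<delta> (z - y) \<partial>lborel)"
  proof (rule weak_eq)
    show "continuous_on UNIV (\<lambda>y. - moll_grad \<delta> (z - y))"
      by (intro continuous_intros continuous_on_compose2[OF continuous_on_moll_grad]) auto
    show "compact (csupp (\<lambda>y. moll \<delta> (z - y)))"
      using supp by (auto simp: csupp_def compact_eq_bounded_closed intro: bounded_subset[OF bounded_cball])
  qed (use supp z in \<open>auto intro: GDERIV_moll_reflect\<close>)
  moreover have "(\<integral>y. A y \<bullet> fst (moll_grad \<delta> (z - y)) \<partial>lborel)
      = (\<Sum>b\<in>Basis. mollify_deriv \<delta> (\<lambda>y. A y \<bullet> b) (b, 0) z)"
  proof -
    have "A y \<bullet> fst (moll_grad \<delta> (z - y)) = (\<Sum>b\<in>Basis. (moll_grad \<delta> (z - y) \<bullet> (b, 0)) * (A y \<bullet> b))" for y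
      by (subst euclidean_inner) (simp add: inner_prod_def mult.commute)
    then show ?thesis
      unfolding mollify_deriv_def
      using integrable_moll_grad_mult[OF int_A_inner \<delta>] by simp
  qed
  ultimately show ?thesis
    by (simp add: mollify_deriv_def mollify_def inner_prod_def mult.commute)
qed

end

lemma borel_measurable_fst_snd:
  "(fst :: 'a::second_countable_topology \<times> 'b::second_countable_topology \<Rightarrow> 'a) \<in> borel_measurable borel"
  "(snd :: 'a \<times> 'b \<Rightarrow> 'b) \<in> borel_measurable borel"
  by (auto intro!: borel_measurable_continuous_onI continuous_intros)

section \<open>The energy inequality\<close>

context difference_equation
begin

text \<open>The two surviving terms come from differentiating \<zeta> in time and \<eta> in space.
  \<open>K\<close> and \<open>d0\<close> describe a compact set around the support of \<eta> with
  room for the kernel. \<open>absS\<close> appears because the time derivative meets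
  \<open>sgnS\<close> and has to be written as a derivative.\<close>

lemma energy_inequality:
  fixes \<eta> :: "'a \<Rightarrow> real" and \<eta>' :: "'a \<Rightarrow> 'a \<Rightarrow> real"
  assumes \<eta>_D: "\<And>b x. ((\<lambda>s. \<eta> (x + s *\<^sub>R b)) has_real_derivative \<eta>' b x) (at 0)"
    and \<eta>_cont: "continuous_on UNIV \<eta>" "\<And>b. continuous_on UNIV (\<eta>' b)"
    and \<eta>_bd: "\<And>x. 0 \<le> \<eta> x" "\<And>x. \<eta> x \<le> 1" "\<And>b x. b \<in> Basis \<Longrightarrow> \<bar>\<eta>' b x\<bar> \<le> M"
    and K: "compact K" "K \<subseteq> \<Omega>" and d0: "d0 > 0" "\<And>x. \<eta> x \<noteq> 0 \<Longrightarrow> cball x d0 \<subseteq> K"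
    and \<eta>'_K: "\<And>b x. \<eta>' b x \<noteq> 0 \<Longrightarrow> x \<in> K"
    and T': "0 < T'" "T' < T"
  shows "(\<integral>z. 2 * max 0 (T' - snd z) * \<eta> (fst z) * absS (w z) \<partial>lborel)
    \<le> - (\<integral>z. (max 0 (T' - snd z))\<^sup>2 * (sgnS (w z) * (\<Sum>b\<in>Basis. \<eta>' b (fst z) * (A z \<bullet> b))) \<partial>lborel)"
    and "integrable lborel (\<lambda>z. 2 * max 0 (T' - snd z) * \<eta> (fst z) * absS (w z))"
proof -
  note [measurable] = borel_measurable_continuous_onI[OF \<eta>_cont(1)] borel_measurable_continuous_onI[OF \<eta>_cont(2)]
  have M0: "M \<ge> 0"
  proof -
    obtain b :: 'a where "b \<in> Basis" using nonempty_Basis by blast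
    then show ?thesis using \<eta>_bd(3)[of b 0] by linarith
  qed
  \<comment> \<open>\<open>H\<close> is integrable only over compact parts of \<Omega>; cut down to
    \<open>K\<close> it is integrable on the whole space and can be mollified.\<close>
  define Hk where "Hk z = indicator K (fst z) * H z" for z
  have K_borel [measurable]: "K \<in> sets borel" using K by (auto intro: borel_compact)
  have [measurable]: "Hk \<in> borel_measurable borel"
  proof -
    have "(\<lambda>z. indicat_real K (fst z)) \<in> borel_measurable (borel :: ('a \<times> real) measure)"
      by (rule measurable_compose[OF borel_measurable_fst_snd(1) borel_measurable_indicator[OF K_borel]])
    then show ?thesis unfolding Hk_def[abs_def] by measurable
  qed
  have int_Hk: "integrable lborel Hk" unfolding Hk_def by (rule int_H[OF K])
  define q where "q = p / (p - 1)"
  define m1 where "m1 z = norm (A z) powr q + norm (G z) powr p" for z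
  define m where "m z = \<bar>w z\<bar> + norm (A z) + m1 z + \<bar>Hk z\<bar>" for z
  note intA = integrable_norm[OF int_A] and intw = integrable_abs[OF int_w] and intHk = integrable_abs[OF int_Hk]
  have int_m1: "integrable lborel m1"
    unfolding m1_def q_def using int_Gp int_Aq by auto
  have int_m: "integrable lborel m" unfolding m_def
    by (intro Bochner_Integration.integrable_add intA intw intHk int_m1)
  have [measurable]: "m1 \<in> borel_measurable borel" "m \<in> borel_measurable borel"
    using borel_measurable_integrable[OF int_m1] borel_measurable_integrable[OF int_m] by auto
  \<comment> \<open>Mollifying the tuple yields one sequence of radii along which all five
    components converge almost everywhere.\<close>
  define F where "F z = (w z, G z, A z, Hk z, m z)" for z
  have int_F: "integrable lborel F"
  proof (rule Bochner_Integration.integrable_bound)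
    show "integrable lborel (\<lambda>z. \<bar>w z\<bar> + (norm (G z) + (norm (A z) + (\<bar>Hk z\<bar> + \<bar>m z\<bar>))))"
      by (intro Bochner_Integration.integrable_add integrable_abs integrable_norm int_w int_G int_A int_Hk int_m)
    have "norm (F z) \<le> \<bar>w z\<bar> + (norm (G z) + (norm (A z) + (\<bar>Hk z\<bar> + \<bar>m z\<bar>)))" for z
      unfolding F_def by (intro order_trans[OF norm_Pair_le] add_mono) auto
    then show "AE z in lborel. norm (F z) \<le> norm (\<bar>w z\<bar> + (norm (G z) + (norm (A z) + (\<bar>Hk z\<bar> + \<bar>m z\<bar>))))"
      by (intro AE_I2) (smt (verit, best) norm_ge_zero real_norm_def)
    show "F \<in> borel_measurable lborel" unfolding F_def by measurable
  qed
  \<comment> \<open>The square makes \<zeta> continuously differentiable at T', and the derivative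
    is the weight on the left of the claim, up to sign.\<close>
  define \<zeta> where "\<zeta> t = (max 0 (T' - t))\<^sup>2" for t
  have \<zeta>_D: "((\<lambda>s. \<zeta> (t + s)) has_real_derivative - 2 * max 0 (T' - t)) (at 0)" for t
  proof -
    have "((\<lambda>s. (max 0 (T' - (t + s)))\<^sup>2) has_real_derivative (2 * max 0 (T' - (t + 0))) * (- 1)) (at 0)"
      by (rule DERIV_chain2[OF DERIV_max_0_square]) (auto intro!: derivative_eq_intros)
    then show ?thesis by (simp add: \<zeta>_def)
  qed
  have \<zeta>_cont: "continuous_on UNIV \<zeta>" unfolding \<zeta>_def[abs_def] by (intro continuous_intros)
  have [measurable]: "\<zeta> \<in> borel_measurable borel" by (rule borel_measurable_continuous_onI[OF \<zeta>_cont])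
  \<comment> \<open>Three demands on the radius: \<open>d0\<close> keeps the kernel over
    \<open>K\<close>, T - T' keeps it before the final time, and 1 makes the mollified w and G
    vanish for times up to -1.\<close>
  define d where "d = min d0 (min (T - T') 1)"
  have d: "d > 0" "d \<le> d0" "d \<le> T - T'" "d \<le> 1" using d0 T' by (auto simp: d_def)
  obtain RK where RK: "\<And>x. x \<in> K \<Longrightarrow> norm x \<le> RK" "RK > 0"
    using compact_imp_bounded[OF K(1)] by (auto simp: bounded_pos)
  have \<eta>_K: "x \<in> K" if "\<eta> x \<noteq> 0" for x using d0(2)[OF that] d0(1) by auto
  \<comment> \<open>The integrand of the energy identity as a function of the values of w,
    \<nabla>w, A and H, so that the mollified identity and its limit are the same expression with
    different arguments.\<close>
  define I where "I W Gd Ad Hd z = 2 * max 0 (T' - snd z) * \<eta> (fst z) * absS W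
      + \<zeta> (snd z) * (sgnS W * (\<Sum>b\<in>Basis. \<eta>' b (fst z) * (Ad \<bullet> b))
        + \<eta> (fst z) * (sgnS' W * (Gd \<bullet> Ad) - sgnS W * Hd))"
    for W :: real and Gd Ad :: 'a and Hd :: real and z :: "'a \<times> real"
  have vanish: "mollify \<delta> w z = 0" "mollify \<delta> G z = 0" if "0 < \<delta>" "\<delta> < d" "snd z \<le> -1" for \<delta> z
  proof -
    have neg: "snd y < 0" if "y \<in> ball z \<delta>" for y
    proof -
      have "dist (snd z) (snd y) \<le> dist z y" by (rule dist_snd_le)
      then show ?thesis using that \<open>\<delta> < d\<close> \<open>snd z \<le> -1\<close> d(4) by (auto simp: dist_real_def)
    qed
    have "w y = 0" "G y = 0" if "y \<in> ball z \<delta>" for y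
      using zero[of y] neg[OF that] by (auto simp: mem_Times_iff)
    then have "mollify \<delta> w z = mollify \<delta> (\<lambda>_. 0) z" "mollify \<delta> G z = mollify \<delta> (\<lambda>_. 0) z"
      using that by (auto intro!: mollify_local_cong)
    then show "mollify \<delta> w z = 0" "mollify \<delta> G z = 0" using that by (simp_all add: mollify_const)
  qed
  have zero_I: "(\<integral>z. I (mollify \<delta> w z) (mollify \<delta> G z) (mollify \<delta> A z) (mollify \<delta> Hk z) z \<partial>lborel) = 0"
    if \<delta>: "0 < \<delta>" "\<delta> < d" for \<delta>
  proof -
    define W where "W = mollify \<delta> w"
    define Wt where "Wt = mollify_deriv \<delta> w (0, 1)"
    define Gd where "Gd = mollify \<delta> G"
    define Ad where "Ad b z = mollify \<delta> A z \<bullet> b" for b z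
    define DA where "DA b = mollify_deriv \<delta> (\<lambda>y. A y \<bullet> b) (b, 0)" for b
    define Hd where "Hd = mollify \<delta> Hk"
    have Ad_eq: "Ad b = mollify \<delta> (\<lambda>y. A y \<bullet> b)" for b
      unfolding Ad_def by (rule ext, rule mollify_bounded_linear[OF bounded_linear_inner_left int_A \<delta>(1), symmetric])
    have cont: "continuous_on UNIV W" "continuous_on UNIV Wt" "continuous_on UNIV Gd" "continuous_on UNIV (Ad b)"
      "continuous_on UNIV (DA b)" for b
      unfolding W_def Wt_def Gd_def Ad_eq DA_def
      by (intro continuous_on_mollify continuous_on_mollify_deriv int_w int_G int_A_inner \<delta>)+
    have W_D: "((\<lambda>s. W (z + s *\<^sub>R (0, 1))) has_real_derivative Wt z) (at 0)" for z
      unfolding W_def Wt_def by (rule DERIV_mollify[OF int_w \<delta>(1)])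
    have W_Db: "((\<lambda>s. W (z + s *\<^sub>R (b, 0))) has_real_derivative (Gd z \<bullet> b)) (at 0)" for z b
      using DERIV_mollify[OF int_w \<delta>(1), of z "(b, 0)"] unfolding W_def Gd_def mollify_deriv_w[OF \<delta>(1)] .
    have A_Db: "((\<lambda>s. Ad b (z + s *\<^sub>R (b, 0))) has_real_derivative DA b z) (at 0)" for z b
      unfolding Ad_eq DA_def by (rule DERIV_mollify[OF int_A_inner \<delta>(1)])
    note cont2 = cont \<eta>_cont continuous_on_compose2[OF \<eta>_cont(1), of UNIV fst]
      continuous_on_compose2[OF \<eta>_cont(2), of UNIV fst]
      continuous_on_compose2[OF \<zeta>_cont, of UNIV snd]
      continuous_on_compose2[OF continuous_on_absS cont(1)]
      continuous_on_compose2[OF continuous_on_sgnS cont(1)]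
      continuous_on_compose2[OF continuous_on_sgnS' cont(1)]
    \<comment> \<open>A ball that contains K \<times> [-1, T'], outside of which all integrands
      vanish.\<close>
    define R0 where "R0 = RK + 1 + T'"
    have supp: "fst z \<notin> K \<or> snd z > T' \<or> snd z \<le> -1" if "norm z > R0" for z :: "'a \<times> real"
    proof (rule ccontr)
      assume neg: "\<not> ?thesis"
      have "norm z \<le> norm (fst z) + norm (snd z)" using norm_Pair_le[of "fst z" "snd z"] by simp
      also have "\<dots> \<le> RK + (1 + T')" using neg RK(1)[of "fst z"] T' by (intro add_mono) auto
      finally show False using that by (simp add: R0_def)
    qed
    \<comment> \<open>\<open>g1\<close> is the time derivative of the compactly supported
      \<open>f1\<close>, and \<open>g2 b\<close> is the derivative of \<open>f2 b\<close> in
      direction b. All of them integrate to zero, so no boundary or initial terms appear.\<close>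
    define g1 where "g1 z = - 2 * max 0 (T' - snd z) * \<eta> (fst z) * absS (W z) + \<zeta> (snd z) * \<eta> (fst z) * (sgnS (W z) * Wt z)" for z
    define f1 where "f1 z = \<zeta> (snd z) * \<eta> (fst z) * absS (W z)" for z
    define g2 where "g2 b z = \<zeta> (snd z) * (\<eta>' b (fst z) * sgnS (W z) * Ad b z
        + \<eta> (fst z) * (sgnS' (W z) * (Gd z \<bullet> b)) * Ad b z + \<eta> (fst z) * sgnS (W z) * DA b z)" for b z
    define f2 where "f2 b z = \<zeta> (snd z) * (\<eta> (fst z) * sgnS (W z) * Ad b z)" for b z
    have nK: "\<eta> x = 0" "\<eta>' b x = 0" if "x \<notin> K" for x b
      using \<eta>_K[of x] \<eta>'_K[of b x] that by auto
    have van: "W z = 0" "Gd z = 0" if "snd z \<le> -1" for z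
      using vanish[OF \<delta> that] by (auto simp: W_def Gd_def)
    have \<zeta>0: "\<zeta> t = 0" if "t > T'" for t using that by (simp add: \<zeta>_def)
    have g1_cont: "continuous_on UNIV g1" unfolding g1_def by (intro continuous_intros cont2) auto
    have g1_supp: "g1 z = 0" if "norm z > R0" for z
      using supp[OF that] nK(1)[of "fst z"] van[of z] \<zeta>0[of "snd z"] unfolding g1_def by auto
    have g1_int: "(\<integral>z. g1 z \<partial>lborel) = 0"
    proof (rule integral_dir_deriv_eq_0[where f = f1 and b = "(0, 1)" and R = R0])
      show "((\<lambda>s. f1 (z + s *\<^sub>R (0, 1))) has_real_derivative g1 z) (at 0)" for z
      proof -
        have absD: "((\<lambda>s. absS (W (z + s *\<^sub>R (0, 1)))) has_real_derivative sgnS (W z) * Wt z) (at 0)"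
          using DERIV_chain2[OF DERIV_absS W_D[of z]] by (simp add: zero_prod_def[symmetric])
        have "((\<lambda>s. \<zeta> (snd z + s) * \<eta> (fst z) * absS (W (z + s *\<^sub>R (0, 1)))) has_real_derivative
            (- 2 * max 0 (T' - snd z)) * \<eta> (fst z) * absS (W (z + 0 *\<^sub>R (0, 1))) + sgnS (W z) * Wt z * (\<zeta> (snd z + 0) * \<eta> (fst z))) (at 0)"
          by (rule DERIV_mult[OF DERIV_cmult_right[OF \<zeta>_D] absD])
        then show ?thesis by (simp add: f1_def g1_def zero_prod_def[symmetric] algebra_simps)
      qed
      show "continuous_on UNIV f1" unfolding f1_def by (intro continuous_intros cont2) auto
      show "f1 z = 0" if "norm z > R0" for z
        using supp[OF that] nK(1)[of "fst z"] van[of z] \<zeta>0[of "snd z"] unfolding f1_def by auto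
    qed (use g1_cont g1_supp in auto)
    have g2_cont: "continuous_on UNIV (g2 b)" for b unfolding g2_def by (intro continuous_intros cont2) auto
    have g2_supp: "g2 b z = 0" if "norm z > R0" for z b
      using supp[OF that] nK(1)[of "fst z"] nK(2)[of "fst z" b] van[of z] \<zeta>0[of "snd z"] unfolding g2_def by auto
    have g2_int: "(\<integral>z. g2 b z \<partial>lborel) = 0" for b
    proof (rule integral_dir_deriv_eq_0[where f = "f2 b" and b = "(b, 0)" and R = R0])
      show "((\<lambda>s. f2 b (z + s *\<^sub>R (b, 0))) has_real_derivative g2 b z) (at 0)" for z
      proof -
        have sgnD: "((\<lambda>s. sgnS (W (z + s *\<^sub>R (b, 0)))) has_real_derivative sgnS' (W z) * (Gd z \<bullet> b)) (at 0)"
          using DERIV_chain2[OF DERIV_sgnS W_Db[of z b]] by (simp add: zero_prod_def[symmetric])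
        have "((\<lambda>s. \<zeta> (snd z) * (\<eta> (fst z + s *\<^sub>R b) * sgnS (W (z + s *\<^sub>R (b, 0))) * Ad b (z + s *\<^sub>R (b, 0)))) has_real_derivative
          \<zeta> (snd z) * ((\<eta>' b (fst z) * sgnS (W (z + 0 *\<^sub>R (b, 0))) + sgnS' (W z) * (Gd z \<bullet> b) * \<eta> (fst z + 0 *\<^sub>R b)) * Ad b (z + 0 *\<^sub>R (b, 0))
             + DA b z * (\<eta> (fst z + 0 *\<^sub>R b) * sgnS (W (z + 0 *\<^sub>R (b, 0)))))) (at 0)"
          by (rule DERIV_cmult[OF DERIV_mult[OF DERIV_mult[OF \<eta>_D sgnD] A_Db]])
        then show ?thesis by (simp add: f2_def g2_def zero_prod_def[symmetric] algebra_simps)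
      qed
      show "continuous_on UNIV (f2 b)" unfolding f2_def by (intro continuous_intros cont2) auto
      show "f2 b z = 0" if "norm z > R0" for z
        using supp[OF that] nK(1)[of "fst z"] van[of z] \<zeta>0[of "snd z"] unfolding f2_def by auto
    qed (use g2_cont g2_supp in auto)
    \<comment> \<open>Where the weight is nonzero the kernel ball lies over \<open>K\<close> and
      before T, so the mollified equation applies there and \<open>H\<close> and \<open>Hk\<close>
      have the same mollification.\<close>
    have pde: "\<zeta> (snd z) * \<eta> (fst z) * (Wt z - (\<Sum>b\<in>Basis. DA b z) - Hd z) = 0" for z
    proof (cases "\<eta> (fst z) = 0 \<or> snd z > T'")
      case False
      have sub: "fst y \<in> K \<and> snd y < T" if "y \<in> cball z \<delta>" for y
      proof -
        have "dist (fst z) (fst y) \<le> dist z y" "dist (snd z) (snd y) \<le> dist z y"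
          by (rule dist_fst_le dist_snd_le)+
        then have "fst y \<in> cball (fst z) d0" "\<bar>snd z - snd y\<bar> < T - T'"
          using that \<delta> d by (auto simp: dist_real_def)
        then show ?thesis using d0(2)[of "fst z"] False by auto
      qed
      then have "cball z \<delta> \<subseteq> \<Omega> \<times> {..<T}" using K(2) by (auto simp: mem_Times_iff)
      from mollified_equation[OF \<delta>(1) this]
      have "Wt z - (\<Sum>b\<in>Basis. DA b z) = mollify \<delta> H z" by (simp add: Wt_def DA_def)
      also have "\<dots> = Hd z" unfolding Hd_def
        using sub by (intro mollify_local_cong[OF \<delta>(1)]) (auto simp: Hk_def)
      finally show ?thesis by simp
    qed (use \<zeta>0 in auto)
    \<comment> \<open>The second derivatives in disguise, \<open>Wt\<close> and \<open>DA\<close>,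
      cancel after adding \<open>sgnS\<close> of the mollified w times the weighted
      equation.\<close>
    have I_eq: "I (mollify \<delta> w z) (mollify \<delta> G z) (mollify \<delta> A z) (mollify \<delta> Hk z) z
        = - g1 z + (\<Sum>b\<in>Basis. g2 b z)" for z
    proof -
      have inner: "mollify \<delta> G z \<bullet> mollify \<delta> A z = (\<Sum>b\<in>Basis. (Gd z \<bullet> b) * Ad b z)"
        unfolding Gd_def Ad_def by (rule euclidean_inner)
      have "I (mollify \<delta> w z) (mollify \<delta> G z) (mollify \<delta> A z) (mollify \<delta> Hk z) z
        = 2 * max 0 (T' - snd z) * \<eta> (fst z) * absS (W z) + \<zeta> (snd z) * (sgnS (W z) * (\<Sum>b\<in>Basis. \<eta>' b (fst z) * Ad b z)
            + \<eta> (fst z) * (sgnS' (W z) * (\<Sum>b\<in>Basis. (Gd z \<bullet> b) * Ad b z) - sgnS (W z) * Hd z))"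
        unfolding I_def inner by (simp add: W_def Ad_def Hd_def)
      moreover have "(\<Sum>b\<in>Basis. g2 b z) = \<zeta> (snd z) * (sgnS (W z) * (\<Sum>b\<in>Basis. \<eta>' b (fst z) * Ad b z)
          + \<eta> (fst z) * (sgnS' (W z) * (\<Sum>b\<in>Basis. (Gd z \<bullet> b) * Ad b z)) + \<eta> (fst z) * sgnS (W z) * (\<Sum>b\<in>Basis. DA b z))"
        unfolding g2_def sum_distrib_left sum.distrib[symmetric]
        by (intro sum.cong refl) (simp add: algebra_simps)
      moreover have "sgnS (W z) * (\<zeta> (snd z) * \<eta> (fst z) * (Wt z - (\<Sum>b\<in>Basis. DA b z) - Hd z)) = 0"
        by (simp only: pde mult_zero_right)
      ultimately show ?thesis unfolding g1_def by (simp only:) (simp add: algebra_simps)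
    qed
    have "integrable lborel g1" "\<And>b. integrable lborel (g2 b)"
      using integrable_bounded_continuous_cball[OF g1_cont g1_supp]
        integrable_bounded_continuous_cball[OF g2_cont g2_supp] by auto
    then show ?thesis unfolding I_eq by (simp add: g1_int g2_int)
  qed
  \<comment> \<open>One constant that exceeds each of the three weights occurring in
    \<open>P1_le\<close>, \<open>P2_le\<close> and \<open>P3_le\<close>; M bounds the partial
    derivatives of \<eta>.\<close>
  define C where "C = 2 * (T' + 1) + (T' + 1)\<^sup>2 * (real DIM('a) * M + 1)"
  have C: "2 * (T' + 1) \<le> C" "(T' + 1)\<^sup>2 * (real DIM('a) * M) \<le> C" "(T' + 1)\<^sup>2 \<le> C" "C \<ge> 0"
    unfolding C_def using T' M0 by (auto simp: algebra_simps)
  \<comment> \<open>The weights grow without bound as t tends to minus infinity, so they are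
    estimated for times from -1 on only; earlier the mollified w and G are zero and the integrand
    with them.\<close>
  have time: "max 0 (T' - snd z) \<le> T' + 1" "0 \<le> \<zeta> (snd z)" "\<zeta> (snd z) \<le> (T' + 1)\<^sup>2" if "snd z \<ge> -1" for z :: "'a \<times> real"
    using that T' by (auto simp: \<zeta>_def intro!: power_mono)
  have sum_le: "\<bar>\<Sum>b\<in>Basis. \<eta>' b x * (Ad \<bullet> b)\<bar> \<le> real DIM('a) * M * norm Ad" for x and Ad :: 'a
  proof -
    have "\<bar>\<eta>' b x * (Ad \<bullet> b)\<bar> \<le> M * norm Ad" if "b \<in> Basis" for b
      unfolding abs_mult using \<eta>_bd(3)[OF that] Basis_le_norm[OF that, of Ad] M0 by (intro mult_mono) auto
    then have "\<bar>\<Sum>b\<in>Basis. \<eta>' b x * (Ad \<bullet> b)\<bar> \<le> (\<Sum>b\<in>(Basis::'a set). M * norm Ad)"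
      by (intro order_trans[OF sum_abs] sum_mono)
    then show ?thesis by simp
  qed
  have P1_le: "\<bar>2 * max 0 (T' - snd z) * \<eta> (fst z) * absS W\<bar> \<le> C * \<bar>W\<bar>" if "snd z \<ge> -1" for z :: "'a \<times> real" and W
  proof -
    have "\<bar>2 * max 0 (T' - snd z) * \<eta> (fst z) * absS W\<bar> = 2 * max 0 (T' - snd z) * \<eta> (fst z) * absS W"
      using \<eta>_bd(1) absS_bounds(1) by simp
    also have "\<dots> \<le> (2 * (T' + 1)) * 1 * \<bar>W\<bar>"
      using time[OF that] T' \<eta>_bd absS_bounds by (intro mult_mono) auto
    also have "\<dots> \<le> C * \<bar>W\<bar>" using C by (simp add: mult_right_mono)
    finally show ?thesis .
  qed
  have P2_le: "\<bar>\<zeta> (snd z) * (sgnS W * (\<Sum>b\<in>Basis. \<eta>' b (fst z) * (Ad \<bullet> b)))\<bar> \<le> C * norm Ad"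
    if "snd z \<ge> -1" for z :: "'a \<times> real" and W and Ad :: 'a
  proof -
    have "\<bar>\<zeta> (snd z) * (sgnS W * (\<Sum>b\<in>Basis. \<eta>' b (fst z) * (Ad \<bullet> b)))\<bar>
        \<le> (T' + 1)\<^sup>2 * (1 * (real DIM('a) * M * norm Ad))"
      unfolding abs_mult using time[OF that] sum_le abs_sgnS_le(1) M0 by (intro mult_mono) auto
    also have "\<dots> \<le> C * norm Ad" using mult_right_mono[OF C(2), of "norm Ad"] by (simp add: mult.assoc)
    finally show ?thesis .
  qed
  have P3_le: "\<bar>\<zeta> (snd z) * (\<eta> (fst z) * (sgnS' W * (Gd \<bullet> Ad) - sgnS W * Hd))\<bar> \<le> C * (norm Ad * norm Gd + \<bar>Hd\<bar>)"
    if "snd z \<ge> -1" for z :: "'a \<times> real" and W Hd and Ad Gd :: 'a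
  proof -
    have "\<bar>sgnS' W * (Gd \<bullet> Ad) - sgnS W * Hd\<bar> \<le> \<bar>sgnS' W\<bar> * \<bar>Gd \<bullet> Ad\<bar> + \<bar>sgnS W\<bar> * \<bar>Hd\<bar>"
      using abs_triangle_ineq4[of "sgnS' W * (Gd \<bullet> Ad)" "sgnS W * Hd"] by (simp add: abs_mult)
    also have "\<dots> \<le> 1 * (norm Ad * norm Gd) + 1 * \<bar>Hd\<bar>"
      using sgnS'_bounds[of W] abs_sgnS_le(1)[of W] Cauchy_Schwarz_ineq2[of Gd Ad]
      by (intro add_mono mult_mono) (auto simp: mult.commute)
    finally have "\<bar>sgnS' W * (Gd \<bullet> Ad) - sgnS W * Hd\<bar> \<le> norm Ad * norm Gd + \<bar>Hd\<bar>" by simp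
    then have "\<bar>\<zeta> (snd z) * (\<eta> (fst z) * (sgnS' W * (Gd \<bullet> Ad) - sgnS W * Hd))\<bar>
        \<le> C * (1 * (norm Ad * norm Gd + \<bar>Hd\<bar>))"
      unfolding abs_mult using time[OF that] \<eta>_bd C by (intro mult_mono) auto
    then show ?thesis by simp
  qed
  \<comment> \<open>The product of the mollified A and G is bounded by the mollification of the
    Young bound \<open>m1\<close>. Thus the whole integrand lies below C times a mollification of
    the fixed integrable \<open>m\<close>, the varying majorant for the limit.\<close>
  have I_le: "\<bar>I (mollify \<delta> w z) (mollify \<delta> G z) (mollify \<delta> A z) (mollify \<delta> Hk z) z\<bar> \<le> C * mollify \<delta> m z"
    if \<delta>: "0 < \<delta>" "\<delta> < d" for \<delta> z
  proof -
    have prod: "norm (mollify \<delta> A z) * norm (mollify \<delta> G z) \<le> mollify \<delta> m1 z"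
    proof -
      have "norm (mollify \<delta> A z) * norm (mollify \<delta> G z)
          \<le> mollify \<delta> (\<lambda>y. norm (A y)) z * mollify \<delta> (\<lambda>y. norm (G y)) z"
        by (intro mult_mono norm_mollify_le norm_ge_zero order_trans[OF norm_ge_zero norm_mollify_le])
      also have "\<dots> \<le> mollify \<delta> (\<lambda>y. norm (A y) powr q) z + mollify \<delta> (\<lambda>y. norm (G y) powr p) z"
        unfolding q_def using p
        by (intro mollify_mult_le integrable_norm int_A int_G int_Aq int_Gp \<delta> Young_powr) auto
      also have "\<dots> = mollify \<delta> m1 z"
        unfolding m1_def q_def by (rule mollify_add[symmetric]) (use int_Aq int_Gp \<delta> in auto)
      finally show ?thesis .
    qed
    have m_eq: "mollify \<delta> m z = mollify \<delta> (\<lambda>y. \<bar>w y\<bar>) z + mollify \<delta> (\<lambda>y. norm (A y)) z + mollify \<delta> m1 z + mollify \<delta> (\<lambda>y. \<bar>Hk y\<bar>) z"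
      unfolding m_def
      by (simp only: mollify_add intA intw intHk int_m1 Bochner_Integration.integrable_add \<delta>(1))
    have n: "\<bar>mollify \<delta> w z\<bar> \<le> mollify \<delta> (\<lambda>y. \<bar>w y\<bar>) z" "norm (mollify \<delta> A z) \<le> mollify \<delta> (\<lambda>y. norm (A y)) z"
      "\<bar>mollify \<delta> Hk z\<bar> \<le> mollify \<delta> (\<lambda>y. \<bar>Hk y\<bar>) z"
      using norm_mollify_le[of \<delta> w z] norm_mollify_le[of \<delta> A z] norm_mollify_le[of \<delta> Hk z] by simp_all
    define tot where "tot = \<bar>mollify \<delta> w z\<bar> + norm (mollify \<delta> A z) + (norm (mollify \<delta> A z) * norm (mollify \<delta> G z) + \<bar>mollify \<delta> Hk z\<bar>)"
    have tot_le: "tot \<le> mollify \<delta> m z" unfolding tot_def m_eq using n prod by linarith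
    have "\<bar>I (mollify \<delta> w z) (mollify \<delta> G z) (mollify \<delta> A z) (mollify \<delta> Hk z) z\<bar> \<le> C * tot"
    proof (cases "snd z \<ge> -1")
      case True
      show ?thesis
        unfolding I_def tot_def
        using P1_le[OF True, of "mollify \<delta> w z"] P2_le[OF True, of "mollify \<delta> w z" "mollify \<delta> A z"]
          P3_le[OF True, of "mollify \<delta> w z" "mollify \<delta> G z" "mollify \<delta> A z" "mollify \<delta> Hk z"]
        unfolding distrib_left[of C] distrib_left[of "\<zeta> (snd z)"] by linarith
    next
      case False
      then have "I (mollify \<delta> w z) (mollify \<delta> G z) (mollify \<delta> A z) (mollify \<delta> Hk z) z = 0"
        using vanish[OF \<delta>, of z] by (simp add: I_def)
      moreover have "tot \<ge> 0" unfolding tot_def by auto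
      ultimately show ?thesis using C by simp
    qed
    also have "\<dots> \<le> C * mollify \<delta> m z" by (intro mult_left_mono tot_le C)
    finally show ?thesis .
  qed
  obtain \<delta> where \<delta>: "\<And>n. \<delta> n > 0" "\<And>n. \<delta> n < d" "\<delta> \<longlonglongrightarrow> 0"
    "AE z in lborel. (\<lambda>n. mollify (\<delta> n) F z) \<longlonglongrightarrow> F z"
    using mollify_AE_subseq[OF int_F d(1)] by blast
  have comp: "mollify \<delta> w z = fst (mollify \<delta> F z)" "mollify \<delta> G z = fst (snd (mollify \<delta> F z))"
    "mollify \<delta> A z = fst (snd (snd (mollify \<delta> F z)))" "mollify \<delta> Hk z = fst (snd (snd (snd (mollify \<delta> F z))))"
    "mollify \<delta> m z = snd (snd (snd (snd (mollify \<delta> F z))))" if "\<delta> > 0" for \<delta> z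
  proof -
    note bl = bounded_linear_fst bounded_linear_snd
    note bl2 = bounded_linear_compose[OF bl(1) bl(2)]
    note s2 = bounded_linear_compose[OF bl(2) bl(2)]
    note s3 = bounded_linear_compose[OF bl(2) s2]
    note s4 = bounded_linear_compose[OF bl(2) s3]
    show "mollify \<delta> w z = fst (mollify \<delta> F z)"
      using mollify_bounded_linear[OF bl(1) int_F that, of z] by (simp add: F_def)
    show "mollify \<delta> G z = fst (snd (mollify \<delta> F z))"
      using mollify_bounded_linear[OF bl2 int_F that, of z] by (simp add: F_def)
    show "mollify \<delta> A z = fst (snd (snd (mollify \<delta> F z)))"
      using mollify_bounded_linear[OF bounded_linear_compose[OF bl(1) s2] int_F that, of z] by (simp add: F_def)
    show "mollify \<delta> Hk z = fst (snd (snd (snd (mollify \<delta> F z))))"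
      using mollify_bounded_linear[OF bounded_linear_compose[OF bl(1) s3] int_F that, of z] by (simp add: F_def)
    show "mollify \<delta> m z = snd (snd (snd (snd (mollify \<delta> F z))))"
      using mollify_bounded_linear[OF s4 int_F that, of z] by (simp add: F_def)
  qed
  have lim: "AE z in lborel. (\<lambda>n. mollify (\<delta> n) w z) \<longlonglongrightarrow> w z \<and> (\<lambda>n. mollify (\<delta> n) G z) \<longlonglongrightarrow> G z \<and>
      (\<lambda>n. mollify (\<delta> n) A z) \<longlonglongrightarrow> A z \<and> (\<lambda>n. mollify (\<delta> n) Hk z) \<longlonglongrightarrow> Hk z \<and> (\<lambda>n. mollify (\<delta> n) m z) \<longlonglongrightarrow> m z"
    using \<delta>(4)
  proof eventually_elim
    case (elim z)
    note s1 = tendsto_snd[OF elim] 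
    note s2 = tendsto_snd[OF s1] note s3 = tendsto_snd[OF s2] note s4 = tendsto_snd[OF s3]
    show ?case
      using tendsto_fst[OF elim] tendsto_fst[OF s1] tendsto_fst[OF s2] tendsto_fst[OF s3] s4
      unfolding comp[OF \<delta>(1)] by (simp add: F_def)
  qed
  define J where "J z = I (w z) (G z) (A z) (Hk z) z" for z
  have I_meas: "(\<lambda>z. I (W z) (Gd z) (Ad z) (Hd z) z) \<in> borel_measurable borel"
    if "W \<in> borel_measurable borel" "Gd \<in> borel_measurable borel" "Ad \<in> borel_measurable borel" "Hd \<in> borel_measurable borel"
    for W Gd Ad Hd
  proof -
    note [measurable] = that
    have [measurable]: "(\<lambda>z. \<eta> (fst z)) \<in> borel_measurable (borel :: ('a \<times> real) measure)"
      "(\<lambda>z. \<eta>' b (fst z)) \<in> borel_measurable (borel :: ('a \<times> real) measure)"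
      "(\<lambda>z. \<zeta> (snd z)) \<in> borel_measurable (borel :: ('a \<times> real) measure)"
      "snd \<in> borel_measurable (borel :: ('a \<times> real) measure)" for b
      by (auto intro!: borel_measurable_continuous_onI continuous_on_compose2[OF \<eta>_cont(1)] continuous_on_compose2[OF \<eta>_cont(2)]
          continuous_on_compose2[OF \<zeta>_cont] continuous_intros)
    show ?thesis unfolding I_def by measurable
  qed
  have meas_moll: "mollify (\<delta> n) w \<in> borel_measurable borel" "mollify (\<delta> n) G \<in> borel_measurable borel"
    "mollify (\<delta> n) A \<in> borel_measurable borel" "mollify (\<delta> n) Hk \<in> borel_measurable borel" for n
    by (intro borel_measurable_continuous_onI continuous_on_mollify int_w int_G int_A int_Hk \<delta>)+
  have L1: "(\<lambda>n. \<integral>z. \<bar>C * mollify (\<delta> n) m z - C * m z\<bar> \<partial>lborel) \<longlonglongrightarrow> 0"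
  proof -
    have "filterlim \<delta> (at_right 0) sequentially"
      using \<delta> by (auto simp: filterlim_at intro!: always_eventually) (metis less_irrefl)
    then have "(\<lambda>n. \<integral>z. norm (mollify (\<delta> n) m z - m z) \<partial>lborel) \<longlonglongrightarrow> 0"
      by (rule filterlim_compose[OF mollify_tendsto_L1[OF int_m]])
    then have "(\<lambda>n. C * (\<integral>z. norm (mollify (\<delta> n) m z - m z) \<partial>lborel)) \<longlonglongrightarrow> 0"
      by (rule tendsto_mult_right_zero)
    then show ?thesis using C(4) by (simp add: right_diff_distrib[symmetric] abs_mult)
  qed
  have lim_I: "AE z in lborel. (\<lambda>n. I (mollify (\<delta> n) w z) (mollify (\<delta> n) G z) (mollify (\<delta> n) A z) (mollify (\<delta> n) Hk z) z) \<longlonglongrightarrow> J z"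
    using lim
  proof eventually_elim
    case (elim z)
    then have l: "(\<lambda>n. mollify (\<delta> n) w z) \<longlonglongrightarrow> w z" "(\<lambda>n. mollify (\<delta> n) G z) \<longlonglongrightarrow> G z"
      "(\<lambda>n. mollify (\<delta> n) A z) \<longlonglongrightarrow> A z" "(\<lambda>n. mollify (\<delta> n) Hk z) \<longlonglongrightarrow> Hk z" by auto
    show ?case unfolding I_def J_def
      by (intro tendsto_intros l continuous_on_tendsto_compose[OF continuous_on_absS l(1)]
          continuous_on_tendsto_compose[OF continuous_on_sgnS l(1)] continuous_on_tendsto_compose[OF continuous_on_sgnS' l(1)]) auto
  qed
  have lim_m: "AE z in lborel. (\<lambda>n. C * mollify (\<delta> n) m z) \<longlonglongrightarrow> C * m z"
    using lim by eventually_elim (auto intro!: tendsto_intros)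
  have J_meas: "J \<in> borel_measurable lborel"
    unfolding J_def using I_meas[of w G A Hk] by simp
  have s_meas: "(\<lambda>z. I (mollify (\<delta> n) w z) (mollify (\<delta> n) G z) (mollify (\<delta> n) A z) (mollify (\<delta> n) Hk z) z) \<in> borel_measurable lborel" for n
    using I_meas[OF meas_moll[of n]] by simp
  have intmn: "integrable lborel (\<lambda>z. C * mollify (\<delta> n) m z)" for n
    using integrable_mollify[OF int_m \<delta>(1)] by simp
  note dct = dominated_convergence_L1_bound[OF s_meas J_meas intmn _ L1 lim_I lim_m I_le[OF \<delta>(1,2)]]
  have int_J: "integrable lborel J" using int_m by (intro dct(2)) auto
  have "(\<lambda>n. \<integral>z. I (mollify (\<delta> n) w z) (mollify (\<delta> n) G z) (mollify (\<delta> n) A z) (mollify (\<delta> n) Hk z) z \<partial>lborel) \<longlonglongrightarrow> (\<integral>z. J z \<partial>lborel)"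
    using int_m by (intro dct(1)) auto
  then have J0: "(\<integral>z. J z \<partial>lborel) = 0"
    unfolding zero_I[OF \<delta>(1,2)] by (simp add: LIMSEQ_const_iff)
  define P1 where "P1 z = 2 * max 0 (T' - snd z) * \<eta> (fst z) * absS (w z)" for z
  define P2 where "P2 z = \<zeta> (snd z) * (sgnS (w z) * (\<Sum>b\<in>Basis. \<eta>' b (fst z) * (A z \<bullet> b)))" for z
  \<comment> \<open>The part with a sign: monotonicity makes its first summand nonnegative and the
    sign of w * H its second, so dropping it turns the identity into the inequality.\<close>
  define P3 where "P3 z = \<zeta> (snd z) * (\<eta> (fst z) * (sgnS' (w z) * (G z \<bullet> A z) - sgnS (w z) * Hk z))" for z
  have J_eq: "J z = P1 z + P2 z + P3 z" for z
    unfolding J_def I_def P1_def P2_def P3_def by (simp add: distrib_left)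
  have w0: "w z = 0" if "snd z < -1" for z using zero[of z] that by (auto simp: mem_Times_iff)
  have P1_int: "integrable lborel P1"
  proof (rule Bochner_Integration.integrable_bound)
    show "integrable lborel (\<lambda>z. C * \<bar>w z\<bar>)" using intw by simp
    show "P1 \<in> borel_measurable lborel" using I_meas[of w "\<lambda>_. 0" "\<lambda>_. 0" "\<lambda>_. 0"] unfolding I_def P1_def by simp
    have "\<bar>P1 z\<bar> \<le> C * \<bar>w z\<bar>" for z
      using P1_le[of z "w z"] w0[of z] C(4) by (cases "snd z \<ge> -1") (auto simp: P1_def)
    then show "AE z in lborel. norm (P1 z) \<le> norm (C * \<bar>w z\<bar>)" using C(4) by (simp add: abs_mult)
  qed
  have P2_int: "integrable lborel P2"
  proof (rule Bochner_Integration.integrable_bound)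
    show "integrable lborel (\<lambda>z. C * norm (A z))" using intA by simp
    show "P2 \<in> borel_measurable lborel"
    proof -
      have "(\<lambda>z. I (w z) 0 (A z) 0 z - I (w z) 0 0 0 z) \<in> borel_measurable borel"
        using I_meas[of w "\<lambda>_. 0" A "\<lambda>_. 0"] I_meas[of w "\<lambda>_. 0" "\<lambda>_. 0" "\<lambda>_. 0"] by simp
      then show ?thesis unfolding I_def P2_def by simp
    qed
    have "\<bar>P2 z\<bar> \<le> C * norm (A z)" for z
      using P2_le[of z "w z" "A z"] w0[of z] C(4) by (cases "snd z \<ge> -1") (auto simp: P2_def)
    then show "AE z in lborel. norm (P2 z) \<le> norm (C * norm (A z))" using C(4) by (simp add: abs_mult)
  qed
  have P3_nonneg: "AE z in lborel. 0 \<le> P3 z"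
    using monotone sign
  proof eventually_elim
    case (elim z)
    have "sgnS (w z) * Hk z \<le> 0"
      using sgnS_mult_nonpos[OF elim(2)] by (simp add: Hk_def mult.left_commute indicator_def)
    moreover have "0 \<le> sgnS' (w z) * (G z \<bullet> A z)" using elim(1) sgnS'_bounds(1) by simp
    ultimately show ?case unfolding P3_def \<zeta>_def using \<eta>_bd(1) by (intro mult_nonneg_nonneg) auto
  qed
  have "(\<integral>z. P1 z + P2 z \<partial>lborel) \<le> (\<integral>z. J z \<partial>lborel)"
    using P3_nonneg P1_int P2_int int_J unfolding J_eq by (intro integral_mono_AE) auto
  then have "(\<integral>z. P1 z \<partial>lborel) \<le> - (\<integral>z. P2 z \<partial>lborel)"
    using P1_int P2_int J0 by simp
  then show "(\<integral>z. 2 * max 0 (T' - snd z) * \<eta> (fst z) * absS (w z) \<partial>lborel)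
    \<le> - (\<integral>z. (max 0 (T' - snd z))\<^sup>2 * (sgnS (w z) * (\<Sum>b\<in>Basis. \<eta>' b (fst z) * (A z \<bullet> b))) \<partial>lborel)"
    by (simp add: P1_def P2_def \<zeta>_def)
  show "integrable lborel (\<lambda>z. 2 * max 0 (T' - snd z) * \<eta> (fst z) * absS (w z))"
    using P1_int by (simp add: P1_def[abs_def])
qed

end

section \<open>The boundary layer\<close>

lemma smooth_on_partial:
  assumes "smooth_on U f" "b \<in> Basis"
  obtains g where "continuous_on U g" "\<And>x. x \<in> U \<Longrightarrow> ((\<lambda>s. f (x + s *\<^sub>R b)) has_real_derivative g x) (at 0)"
proof -
  obtain F where F: "f \<in> F" "\<forall>g\<in>F. continuous_on U g \<and>
      (\<forall>b\<in>Basis. \<exists>g'\<in>F. \<forall>x\<in>U. ((\<lambda>s. g (x + s *\<^sub>R b)) has_real_derivative g' x) (at 0))"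
    using assms(1) unfolding smooth_on_def by blast
  with assms(2) obtain g' where "g' \<in> F" "\<forall>x\<in>U. ((\<lambda>s. f (x + s *\<^sub>R b)) has_real_derivative g' x) (at 0)"
    by blast
  with F show ?thesis by (intro that[of g']) auto
qed

lemma infdist_lessE:
  assumes "infdist x A < e" "A \<noteq> {}"
  obtains a where "a \<in> A" "dist x a < e"
proof -
  have "bdd_below (dist x ` A)" by (rule bdd_belowI2[of _ 0]) simp
  then show ?thesis
    using assms that unfolding infdist_notempty[OF assms(2)] by (auto simp: cINF_less_iff)
qed

lemma bounded_Compl_nonempty:
  fixes \<Omega> :: "'a::euclidean_space set"
  assumes "bounded \<Omega>" shows "- \<Omega> \<noteq> {}"
proof
  assume "- \<Omega> = {}"
  then have "\<Omega> = UNIV" by blast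
  then show False using assms not_bounded_UNIV by blast
qed

text \<open>\<nu> is the normalised gradient of a defining function \<rho> at x0. Along the segment
  from a nearby exterior point y to the shifted point q, the gradient stays close to its value at
  x0. The gain over the distance 4\<epsilon> in direction \<nu> outweighs the possible loss between
  y and x, so \<rho> increases from a nonnegative value.\<close>

lemma smooth_domain_exit_direction:
  fixes \<Omega> :: "'a::euclidean_space set"
  assumes dom: "smooth_domain \<Omega>" and x0: "x0 \<in> frontier \<Omega>"
  obtains r \<nu> where "r > 0" "norm \<nu> = 1"
    "\<And>x \<epsilon>. x \<in> ball x0 r \<Longrightarrow> 0 < \<epsilon> \<Longrightarrow> \<epsilon> < r \<Longrightarrow> infdist x (- \<Omega>) < \<epsilon> \<Longrightarrow> x + (4 * \<epsilon>) *\<^sub>R \<nu> \<notin> \<Omega>"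
proof -
  from dom x0 obtain U \<rho> where U: "open U" "x0 \<in> U" "smooth_on U \<rho>"
    and D: "\<And>x. x \<in> U \<Longrightarrow> (\<rho> has_derivative (\<lambda>v. grad \<rho> x \<bullet> v)) (at x)"
    and nz: "\<And>x. x \<in> U \<Longrightarrow> grad \<rho> x \<noteq> 0" and \<Omega>U: "\<Omega> \<inter> U = {x\<in>U. \<rho> x < 0}"
    unfolding smooth_domain_def by metis
  have bdd: "bounded \<Omega>" using dom by (simp add: smooth_domain_def)
  have Dir: "((\<lambda>s. \<rho> (x + s *\<^sub>R b)) has_real_derivative grad \<rho> (x + s *\<^sub>R b) \<bullet> b) (at s)" if "x + s *\<^sub>R b \<in> U" for x b s
  proof -
    have "((\<lambda>s. \<rho> (x + s *\<^sub>R b)) has_derivative (\<lambda>h. grad \<rho> (x + s *\<^sub>R b) \<bullet> (h *\<^sub>R b))) (at s)"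
      by (rule has_derivative_compose[where g = \<rho> and f = "\<lambda>s. x + s *\<^sub>R b"])
        (use D[OF that] in \<open>auto intro!: derivative_eq_intros\<close>)
    then show ?thesis by (simp add: has_field_derivative_def mult_commute_abs)
  qed
  \<comment> \<open>\<open>smooth_on\<close> provides continuous partial derivatives only;
    identifying them with the components of \<open>grad\<close> makes the gradient
    continuous.\<close>
  have "continuous_on U (\<lambda>x. grad \<rho> x \<bullet> b)" if b: "b \<in> Basis" for b
  proof -
    obtain g where g: "continuous_on U g" "\<And>x. x \<in> U \<Longrightarrow> ((\<lambda>s. \<rho> (x + s *\<^sub>R b)) has_real_derivative g x) (at 0)"
      using smooth_on_partial[OF U(3) b] by metis
    have "grad \<rho> x \<bullet> b = g x" if "x \<in> U" for x
      using DERIV_unique[OF Dir[of x 0 b] g(2)[of x]] that by simp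
    then show ?thesis using g(1) by (simp cong: continuous_on_cong)
  qed
  then have "continuous_on U (\<lambda>x. \<Sum>b\<in>Basis. (grad \<rho> x \<bullet> b) *\<^sub>R b)"
    by (intro continuous_on_sum continuous_on_scaleR continuous_on_const)
  then have cont: "continuous_on U (grad \<rho>)" by (simp add: euclidean_representation)
  define n where "n = grad \<rho> x0"
  have n: "norm n > 0" using nz[OF U(2)] by (simp add: n_def)
  have "isCont (grad \<rho>) x0" using cont U by (simp add: continuous_on_eq_continuous_at)
  then obtain d where d: "d > 0" "\<And>x. dist x x0 < d \<Longrightarrow> dist (grad \<rho> x) n < norm n / 4"
    using n unfolding continuous_at_eps_delta n_def by (metis zero_less_divide_iff zero_less_numeral)
  obtain d' where d': "d' > 0" "ball x0 d' \<subseteq> U" using U openE by blast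
  \<comment> \<open>The point x is within r of x0, y is within a further \<epsilon> < r, and q is
    within a further 4\<epsilon>; so the whole segment from y to q lies in the ball of radius 6 *
    r.\<close>
  define r where "r = min d d' / 6"
  have r: "r > 0" "6 * r \<le> d" "6 * r \<le> d'" using d d' by (auto simp: r_def)
  define \<nu> where "\<nu> = n /\<^sub>R norm n"
  have \<nu>: "norm \<nu> = 1" "n \<bullet> \<nu> = norm n"
    using n by (auto simp: \<nu>_def dot_square_norm power2_eq_square)
  note ne = bounded_Compl_nonempty[OF bdd]
  show ?thesis
  proof (rule that[OF r(1) \<nu>(1)])
    fix x \<epsilon> assume x: "x \<in> ball x0 r" and \<epsilon>: "0 < \<epsilon>" "\<epsilon> < r" and dx: "infdist x (- \<Omega>) < \<epsilon>"
    obtain y where y: "y \<in> - \<Omega>" "dist x y < \<epsilon>"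
      using infdist_lessE[OF dx ne] by blast
    define q where "q = x + (4 * \<epsilon>) *\<^sub>R \<nu>"
    have "dist x0 y < 6 * r"
      using dist_triangle[of x0 y x] x y \<epsilon> r(1) by simp
    moreover have "dist x q = 4 * \<epsilon>" using \<epsilon> by (simp add: q_def dist_norm \<nu>)
    then have "dist x0 q < 6 * r"
      using dist_triangle[of x0 q x] x \<epsilon> r(1) by simp
    ultimately have seg: "y + s *\<^sub>R (q - y) \<in> ball x0 (6 * r)" if "0 \<le> s" "s \<le> 1" for s
    proof -
      have "(1 - s) *\<^sub>R y + s *\<^sub>R q \<in> ball x0 (6 * r)"
        using \<open>dist x0 y < 6 * r\<close> \<open>dist x0 q < 6 * r\<close> that by (intro convexD[OF convex_ball]) auto
      then show ?thesis by (simp add: algebra_simps)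
    qed
    have inU: "ball x0 (6 * r) \<subseteq> U" using d'(2) r(3) by (meson subset_ball subset_trans)
    have Dseg: "((\<lambda>s. \<rho> (y + s *\<^sub>R (q - y))) has_real_derivative grad \<rho> (y + s *\<^sub>R (q - y)) \<bullet> (q - y)) (at s)"
      if "0 \<le> s" "s \<le> 1" for s
      using seg[OF that] inU by (intro Dir) auto
    obtain s where s: "0 < s" "s < 1"
      "\<rho> (y + 1 *\<^sub>R (q - y)) - \<rho> (y + 0 *\<^sub>R (q - y)) = (1 - 0) * (grad \<rho> (y + s *\<^sub>R (q - y)) \<bullet> (q - y))"
      using MVT2[OF zero_less_one Dseg] by blast
    define g where "g = grad \<rho> (y + s *\<^sub>R (q - y))"
    have "dist (y + s *\<^sub>R (q - y)) x0 < d"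
      using seg[of s] s r(2) by (simp add: dist_commute)
    then have gn: "norm (g - n) < norm n / 4" using d(2) by (simp add: g_def dist_norm)
    have "\<bar>(g - n) \<bullet> \<nu>\<bar> \<le> norm n / 4"
      using Cauchy_Schwarz_ineq2[of "g - n" \<nu>] gn \<nu> by simp
    then have g\<nu>: "norm n - norm n / 4 \<le> g \<bullet> \<nu>"
      using \<nu>(2) inner_diff_left[of g n \<nu>] by linarith
    \<comment> \<open>The unit of comparison: moving 4\<epsilon> along \<nu> gains at least 3P
      because the gradient component is at least 3/4 of norm n, and moving from y to x loses at most
      2P because norm g \<le> 2 * norm n.\<close>
    define P where "P = \<epsilon> * norm n"
    have "P > 0" using \<epsilon> n by (simp add: P_def)
    have "4 * \<epsilon> * (norm n - norm n / 4) = 3 * P" by (simp add: P_def right_diff_distrib)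
    moreover have "4 * \<epsilon> * (norm n - norm n / 4) \<le> 4 * \<epsilon> * (g \<bullet> \<nu>)"
      by (rule mult_left_mono[OF g\<nu>]) (use \<epsilon> in simp)
    ultimately have 1: "3 * P \<le> 4 * \<epsilon> * (g \<bullet> \<nu>)" by simp
    have "norm g \<le> norm n + norm (g - n)" using norm_triangle_ineq[of n "g - n"] by simp
    then have "norm g \<le> 2 * norm n" using gn n by linarith
    then have "\<bar>g \<bullet> (x - y)\<bar> \<le> 2 * norm n * \<epsilon>"
      using y(2) by (intro order_trans[OF Cauchy_Schwarz_ineq2] mult_mono) (auto simp: dist_norm)
    then have 2: "- (2 * P) \<le> g \<bullet> (x - y)" by (simp add: P_def abs_le_iff mult.commute)
    have "g \<bullet> (q - y) = 4 * \<epsilon> * (g \<bullet> \<nu>) + g \<bullet> (x - y)"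
      by (simp add: q_def inner_diff_right inner_add_right)
    also have "\<dots> \<ge> 3 * P + - (2 * P)" by (rule add_mono[OF 1 2])
    finally have "g \<bullet> (q - y) > 0" using \<open>P > 0\<close> by simp
    then have "\<rho> q > \<rho> y" using s(3) by (simp add: g_def)
    moreover have "\<rho> y \<ge> 0" using y(1) seg[of 0] inU \<Omega>U by force
    ultimately show "x + (4 * \<epsilon>) *\<^sub>R \<nu> \<notin> \<Omega>"
      using \<Omega>U seg[of 1] inU unfolding q_def[symmetric] by force
  qed
qed

section \<open>Estimates along segments that leave the domain\<close>

context difference_equation
begin

text \<open>At the end of the shift w is zero, so \<bar>w\<bar> is an increment over length s and is
  controlled by s times the gradient. The argument is carried out for the mollified w, which is
  differentiable. The truncation of the weight at c is what makes L^1 errors of the mollification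
  harmless.\<close>

lemma weighted_shift_estimate:
  assumes E [measurable]: "E \<in> sets borel" and L [measurable]: "L \<in> sets borel" and s: "s > 0" and \<nu>: "norm \<nu> = 1"
    and exit: "\<And>z. z \<in> E \<Longrightarrow> fst z + s *\<^sub>R \<nu> \<notin> \<Omega>"
    and sub: "\<And>z r. z \<in> E \<Longrightarrow> 0 \<le> r \<Longrightarrow> r \<le> s \<Longrightarrow> z + r *\<^sub>R (\<nu>, 0) \<in> L"
    and c: "c \<ge> 0"
  shows "(\<integral>z. indicator E z * min (norm (A z)) c * \<bar>w z\<bar> \<partial>lborel)
    \<le> s * (\<integral>z. indicator L z * (norm (A z) powr (p / (p - 1)) + norm (G z) powr p) \<partial>lborel)"
proof -
  define q where "q = p / (p - 1)"
  define e where "e = ((\<nu>, 0) :: 'a \<times> real)"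
  define m where "m z = indicator E z * min (norm (A z)) c" for z
  define B where "B = (\<integral>z. indicator L z * (norm (A z) powr q + norm (G z) powr p) \<partial>lborel)"
  have m_meas [measurable]: "m \<in> borel_measurable borel" unfolding m_def by measurable
  have m_bd: "0 \<le> m z" "m z \<le> c" "m z \<le> norm (A z)" for z using c by (auto simp: m_def indicator_def)
  have int_mult: "integrable lborel (\<lambda>z. m z * f z)" if "integrable lborel f" for f :: "'a \<times> real \<Rightarrow> real"
  proof (rule Bochner_Integration.integrable_bound)
    show "integrable lborel (\<lambda>z. c * f z)" using that by simp
    show "(\<lambda>z. m z * f z) \<in> borel_measurable lborel" using borel_measurable_integrable[OF that] by simp
    show "AE z in lborel. norm (m z * f z) \<le> norm (c * f z)"
      using m_bd c by (auto simp: abs_mult intro!: mult_right_mono)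
  qed
  have int_m: "integrable lborel m"
    by (rule Bochner_Integration.integrable_bound[OF integrable_norm[OF int_A]]) (use m_bd in auto)
  have int_LB: "integrable lborel (\<lambda>z. indicator L z * (norm (A z) powr q + norm (G z) powr p))"
  proof (rule Bochner_Integration.integrable_bound)
    show "integrable lborel (\<lambda>z. norm (A z) powr q + norm (G z) powr p)" using int_Aq int_Gp by (simp add: q_def)
    show "AE z in lborel. norm (indicat_real L z * (norm (A z) powr q + norm (G z) powr p)) \<le> norm (norm (A z) powr q + norm (G z) powr p)"
      by (auto simp: indicator_def)
  qed measurable
  \<comment> \<open>Young's inequality separates A at z from G at the shifted point; the shift in
    the second term is undone by translation invariance, and both points lie in
    \<open>L\<close>.\<close>
  have shiftG: "(\<integral>z. m z * norm (G (z + r *\<^sub>R e)) \<partial>lborel) \<le> B" if r: "0 \<le> r" "r \<le> s" for r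
  proof -
    note intAq = int_Aq[folded q_def]
    have i1: "integrable lborel (\<lambda>z. indicator L z * norm (A z) powr q)"
      by (rule Bochner_Integration.integrable_bound[OF intAq]) (auto simp: indicator_def)
    have i2: "integrable lborel (\<lambda>z. indicator L z * norm (G z) powr p)"
      by (rule Bochner_Integration.integrable_bound[OF int_Gp]) (auto simp: indicator_def)
    note i3 = lborel_integrable_translate[OF i2, of "r *\<^sub>R e"]
    have "(\<integral>z. m z * norm (G (z + r *\<^sub>R e)) \<partial>lborel)
        \<le> (\<integral>z. indicator L z * norm (A z) powr q + indicator L (z + r *\<^sub>R e) * norm (G (z + r *\<^sub>R e)) powr p \<partial>lborel)"
    proof (rule integral_mono)
      show "integrable lborel (\<lambda>z. m z * norm (G (z + r *\<^sub>R e)))"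
        by (intro int_mult integrable_norm lborel_integrable_translate int_G)
      show "integrable lborel (\<lambda>z. indicator L z * norm (A z) powr q + indicator L (z + r *\<^sub>R e) * norm (G (z + r *\<^sub>R e)) powr p)"
        using i1 i3 by (rule Bochner_Integration.integrable_add)
      fix z
      show "m z * norm (G (z + r *\<^sub>R e)) \<le> indicator L z * norm (A z) powr q + indicator L (z + r *\<^sub>R e) * norm (G (z + r *\<^sub>R e)) powr p"
      proof (cases "z \<in> E")
        case True
        have "z \<in> L" "z + r *\<^sub>R e \<in> L" using sub[OF True, of 0] sub[OF True, of r] s r by (auto simp: e_def zero_prod_def[symmetric])
        moreover have "m z * norm (G (z + r *\<^sub>R e)) \<le> norm (A z) * norm (G (z + r *\<^sub>R e))"
          using m_bd by (intro mult_right_mono) auto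
        moreover have "norm (A z) * norm (G (z + r *\<^sub>R e)) \<le> norm (A z) powr q + norm (G (z + r *\<^sub>R e)) powr p"
          unfolding q_def using p by (intro Young_powr) auto
        ultimately show ?thesis by simp
      qed (auto simp: m_def)
    qed
    also have "\<dots> = (\<integral>z. indicator L z * norm (A z) powr q \<partial>lborel) + (\<integral>z. indicator L (z + r *\<^sub>R e) * norm (G (z + r *\<^sub>R e)) powr p \<partial>lborel)"
      using i1 i3 by (rule Bochner_Integration.integral_add)
    also have "(\<integral>z. indicator L (z + r *\<^sub>R e) * norm (G (z + r *\<^sub>R e)) powr p \<partial>lborel) = (\<integral>z. indicator L z * norm (G z) powr p \<partial>lborel)"
      by (rule lborel_integral_translate[where f = "\<lambda>z. indicator L z * norm (G z) powr p"]) measurable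
    finally show ?thesis unfolding B_def using i1 i2 by (simp add: distrib_left)
  qed
  \<comment> \<open>The desired bound with explicit error terms, each of them c times an L^1
    distance to a mollification.\<close>
  have step: "(\<integral>z. m z * \<bar>w z\<bar> \<partial>lborel)
      \<le> s * (B + c * (\<integral>z. norm (mollify \<delta> G z - G z) \<partial>lborel)) + 2 * c * (\<integral>z. norm (mollify \<delta> w z - w z) \<partial>lborel)"
    if \<delta>: "\<delta> > 0" for \<delta>
  proof -
    define W where "W = mollify \<delta> w"
    have int_W: "integrable lborel W" unfolding W_def by (rule integrable_mollify[OF int_w \<delta>])
    have [measurable]: "W \<in> borel_measurable borel" using borel_measurable_integrable[OF int_W] by simp
    have int_Gd: "integrable lborel (mollify \<delta> G)" by (rule integrable_mollify[OF int_G \<delta>])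
    have [measurable]: "mollify \<delta> G \<in> borel_measurable borel" using borel_measurable_integrable[OF int_Gd] by simp
    \<comment> \<open>With the sign of the full increment built into the weight, the integral of
      absolute increments becomes linear in the shifted function and can be differentiated in the
      length of the shift.\<close>
    define \<sigma> where "\<sigma> z = sgn (W (z + s *\<^sub>R e) - W z) * m z" for z
    have [measurable]: "\<sigma> \<in> borel_measurable borel" unfolding \<sigma>_def by measurable
    have \<sigma>_le: "\<bar>\<sigma> z\<bar> \<le> m z" for z using m_bd by (auto simp: \<sigma>_def abs_mult sgn_if)
    have int_\<sigma>: "integrable lborel \<sigma>"
      by (rule Bochner_Integration.integrable_bound[OF int_m]) (use \<sigma>_le m_bd in auto)
    obtain M where M: "\<And>z. \<bar>mollify_deriv \<delta> w e z\<bar> \<le> M" using mollify_deriv_bounded[OF int_w \<delta>] by metis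
    have int_W\<sigma>: "integrable lborel (\<lambda>z. W (z + r *\<^sub>R e) * \<sigma> z)" for r
    proof (rule Bochner_Integration.integrable_bound[OF int_mult])
      show "integrable lborel (\<lambda>z. W (z + r *\<^sub>R e))" by (rule lborel_integrable_translate[OF int_W])
      have "\<bar>\<sigma> z\<bar> * \<bar>W (z + r *\<^sub>R e)\<bar> \<le> m z * \<bar>W (z + r *\<^sub>R e)\<bar>" for z
        by (intro mult_right_mono \<sigma>_le) auto
      then show "AE z in lborel. norm (W (z + r *\<^sub>R e) * \<sigma> z) \<le> norm (m z * W (z + r *\<^sub>R e))"
        using m_bd by (auto simp: abs_mult mult.commute)
    qed measurable
    have [measurable]: "mollify_deriv \<delta> w e \<in> borel_measurable borel"
      by (rule borel_measurable_continuous_onI[OF continuous_on_mollify_deriv[OF int_w \<delta>]])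
    have D: "((\<lambda>r. \<integral>z. W (z + r *\<^sub>R e) * \<sigma> z \<partial>lborel) has_real_derivative
        (\<integral>z. mollify_deriv \<delta> w e (z + r *\<^sub>R e) * \<sigma> z \<partial>lborel)) (at r)" for r
    proof (rule DERIV_integral_bounded[OF int_\<sigma>])
      show "((\<lambda>r. W (z + r *\<^sub>R e)) has_real_derivative mollify_deriv \<delta> w e (z + r *\<^sub>R e)) (at r)" for r z
        unfolding W_def by (rule dir_deriv_shift[OF DERIV_mollify[OF int_w \<delta>]])
      show "\<bar>mollify_deriv \<delta> w e (z + r *\<^sub>R e)\<bar> \<le> M" for r z by (rule M)
      show "integrable lborel (\<lambda>z. W (z + r *\<^sub>R e) * \<sigma> z)" for r by (rule int_W\<sigma>)
      show "(\<lambda>z. mollify_deriv \<delta> w e (z + r *\<^sub>R e)) \<in> borel_measurable borel" by measurable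
    qed
    \<comment> \<open>The mean value theorem is applied to the integral, not pointwise. A single
      shift r serves all z, and no integration over the segment is needed.\<close>
    obtain r where r: "0 < r" "r < s"
      "(\<integral>z. W (z + s *\<^sub>R e) * \<sigma> z \<partial>lborel) - (\<integral>z. W (z + 0 *\<^sub>R e) * \<sigma> z \<partial>lborel)
        = (s - 0) * (\<integral>z. mollify_deriv \<delta> w e (z + r *\<^sub>R e) * \<sigma> z \<partial>lborel)"
      using MVT2[OF s, of "\<lambda>r. \<integral>z. W (z + r *\<^sub>R e) * \<sigma> z \<partial>lborel" "\<lambda>r. \<integral>z. mollify_deriv \<delta> w e (z + r *\<^sub>R e) * \<sigma> z \<partial>lborel"] D
      by blast
    have "(\<integral>z. m z * \<bar>W (z + s *\<^sub>R e) - W z\<bar> \<partial>lborel) = (\<integral>z. W (z + s *\<^sub>R e) * \<sigma> z - W (z + 0 *\<^sub>R e) * \<sigma> z \<partial>lborel)"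
      by (intro Bochner_Integration.integral_cong refl)
        (simp add: \<sigma>_def sgn_if abs_if algebra_simps)
    also have "\<dots> = s * (\<integral>z. mollify_deriv \<delta> w e (z + r *\<^sub>R e) * \<sigma> z \<partial>lborel)"
      using r(3) int_W\<sigma>[of s] int_W\<sigma>[of 0] by simp
    also have "\<dots> \<le> s * (B + c * (\<integral>z. norm (mollify \<delta> G z - G z) \<partial>lborel))"
    proof (rule mult_left_mono)
      have i1: "integrable lborel (\<lambda>z. m z * norm (G (z + r *\<^sub>R e)))"
        by (intro int_mult integrable_norm lborel_integrable_translate int_G)
      have i2: "integrable lborel (\<lambda>z. c * norm (mollify \<delta> G (z + r *\<^sub>R e) - G (z + r *\<^sub>R e)))"
        by (intro integrable_mult_right integrable_norm Bochner_Integration.integrable_diff lborel_integrable_translate int_G int_Gd)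
      have "(\<integral>z. mollify_deriv \<delta> w e (z + r *\<^sub>R e) * \<sigma> z \<partial>lborel)
          \<le> (\<integral>z. m z * norm (G (z + r *\<^sub>R e)) + c * norm (mollify \<delta> G (z + r *\<^sub>R e) - G (z + r *\<^sub>R e)) \<partial>lborel)"
      proof (rule integral_mono')
        show "integrable lborel (\<lambda>z. m z * norm (G (z + r *\<^sub>R e)) + c * norm (mollify \<delta> G (z + r *\<^sub>R e) - G (z + r *\<^sub>R e)))"
          using i1 i2 by (rule Bochner_Integration.integrable_add)
        fix z
        let ?g = "mollify \<delta> G (z + r *\<^sub>R e)" and ?G = "G (z + r *\<^sub>R e)"
        have "mollify_deriv \<delta> w e (z + r *\<^sub>R e) * \<sigma> z \<le> \<bar>?g \<bullet> \<nu>\<bar> * \<bar>\<sigma> z\<bar>"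
          unfolding e_def mollify_deriv_w[OF \<delta>] by (metis abs_ge_self abs_mult)
        also have "\<dots> \<le> norm ?g * m z"
          using Cauchy_Schwarz_ineq2[of ?g \<nu>] \<nu> \<sigma>_le by (intro mult_mono) auto
        also have "\<dots> \<le> (norm ?G + norm (?g - ?G)) * m z"
          using norm_triangle_ineq[of ?G "?g - ?G"] m_bd by (intro mult_right_mono) auto
        also have "\<dots> \<le> m z * norm ?G + c * norm (?g - ?G)"
          using mult_right_mono[OF m_bd(2), of "norm (?g - ?G)" z] by (simp add: algebra_simps)
        finally show "mollify_deriv \<delta> w e (z + r *\<^sub>R e) * \<sigma> z \<le> m z * norm ?G + c * norm (?g - ?G)" .
        show "0 \<le> m z * norm ?G + c * norm (?g - ?G)" using m_bd c by auto
      qed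
      also have "\<dots> = (\<integral>z. m z * norm (G (z + r *\<^sub>R e)) \<partial>lborel) + (\<integral>z. c * norm (mollify \<delta> G (z + r *\<^sub>R e) - G (z + r *\<^sub>R e)) \<partial>lborel)"
        using i1 i2 by (rule Bochner_Integration.integral_add)
      also have "(\<integral>z. c * norm (mollify \<delta> G (z + r *\<^sub>R e) - G (z + r *\<^sub>R e)) \<partial>lborel) = (\<integral>z. c * norm (mollify \<delta> G z - G z) \<partial>lborel)"
        by (rule lborel_integral_translate[where f = "\<lambda>z. c * norm (mollify \<delta> G z - G z)"]) measurable
      finally show "(\<integral>z. mollify_deriv \<delta> w e (z + r *\<^sub>R e) * \<sigma> z \<partial>lborel) \<le> B + c * (\<integral>z. norm (mollify \<delta> G z - G z) \<partial>lborel)"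
        using shiftG[of r] r by simp
    qed (use s in auto)
    finally have main: "(\<integral>z. m z * \<bar>W (z + s *\<^sub>R e) - W z\<bar> \<partial>lborel) \<le> s * (B + c * (\<integral>z. norm (mollify \<delta> G z - G z) \<partial>lborel))" .
    \<comment> \<open>Replacing the mollified increment by \<bar>w\<bar> costs this error at z and
      at the shifted point, where w vanishes; hence the factor 2 * c above.\<close>
    define err where "err z = \<bar>W z - w z\<bar>" for z
    have int_err: "integrable lborel err" unfolding err_def using int_W int_w by auto
    have [measurable]: "err \<in> borel_measurable borel" using borel_measurable_integrable[OF int_err] by simp
    have j1: "integrable lborel (\<lambda>z. m z * \<bar>W (z + s *\<^sub>R e) - W z\<bar>)"
      by (intro int_mult integrable_abs Bochner_Integration.integrable_diff lborel_integrable_translate int_W)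
    have j2: "integrable lborel (\<lambda>z. c * err (z + s *\<^sub>R e) + c * err z)"
      by (intro Bochner_Integration.integrable_add integrable_mult_right lborel_integrable_translate int_err)
    have "(\<integral>z. m z * \<bar>w z\<bar> \<partial>lborel) \<le> (\<integral>z. m z * \<bar>W (z + s *\<^sub>R e) - W z\<bar> + (c * err (z + s *\<^sub>R e) + c * err z) \<partial>lborel)"
    proof (rule integral_mono)
      show "integrable lborel (\<lambda>z. m z * \<bar>w z\<bar>)" by (intro int_mult integrable_abs int_w)
      show "integrable lborel (\<lambda>z. m z * \<bar>W (z + s *\<^sub>R e) - W z\<bar> + (c * err (z + s *\<^sub>R e) + c * err z))"
        using j1 j2 by (rule Bochner_Integration.integrable_add)
      fix z
      show "m z * \<bar>w z\<bar> \<le> m z * \<bar>W (z + s *\<^sub>R e) - W z\<bar> + (c * err (z + s *\<^sub>R e) + c * err z)"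
      proof (cases "z \<in> E")
        case True
        have "w (z + s *\<^sub>R e) = 0" using zero[of "z + s *\<^sub>R e"] exit[OF True] by (auto simp: e_def mem_Times_iff)
        then have "\<bar>w z\<bar> \<le> \<bar>W (z + s *\<^sub>R e) - W z\<bar> + (err (z + s *\<^sub>R e) + err z)" unfolding err_def by linarith
        then have "m z * \<bar>w z\<bar> \<le> m z * \<bar>W (z + s *\<^sub>R e) - W z\<bar> + (m z * err (z + s *\<^sub>R e) + m z * err z)"
          using mult_left_mono[OF _ m_bd(1)] by (metis distrib_left)
        moreover have "m z * err (z + s *\<^sub>R e) \<le> c * err (z + s *\<^sub>R e)" "m z * err z \<le> c * err z"
          by (auto intro!: mult_right_mono m_bd simp: err_def)
        ultimately show ?thesis by linarith
      qed (use c in \<open>auto simp: m_def err_def\<close>)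
    qed
    also have "\<dots> = (\<integral>z. m z * \<bar>W (z + s *\<^sub>R e) - W z\<bar> \<partial>lborel) + (\<integral>z. c * err (z + s *\<^sub>R e) + c * err z \<partial>lborel)"
      using j1 j2 by (rule Bochner_Integration.integral_add)
    also have "(\<integral>z. c * err (z + s *\<^sub>R e) + c * err z \<partial>lborel) = 2 * c * (\<integral>z. err z \<partial>lborel)"
      using lborel_integrable_translate[OF int_err, of "s *\<^sub>R e"] int_err
      by (simp add: lborel_integral_translate)
    finally show ?thesis using main by (simp add: err_def W_def)
  qed
  have "((\<lambda>\<delta>. s * (B + c * (\<integral>z. norm (mollify \<delta> G z - G z) \<partial>lborel)) + 2 * c * (\<integral>z. norm (mollify \<delta> w z - w z) \<partial>lborel))
      \<longlongrightarrow> s * (B + c * 0) + 2 * c * 0) (at_right 0)"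
    by (intro tendsto_intros mollify_tendsto_L1 int_G int_w)
  moreover have "eventually (\<lambda>\<delta>. (\<integral>z. m z * \<bar>w z\<bar> \<partial>lborel)
      \<le> s * (B + c * (\<integral>z. norm (mollify \<delta> G z - G z) \<partial>lborel)) + 2 * c * (\<integral>z. norm (mollify \<delta> w z - w z) \<partial>lborel)) (at_right 0)"
    using eventually_at_right_less[of 0] by eventually_elim (rule step)
  ultimately have "(\<integral>z. m z * \<bar>w z\<bar> \<partial>lborel) \<le> s * (B + c * 0) + 2 * c * 0"
    by (rule tendsto_lowerbound) simp
  then show ?thesis by (simp add: m_def B_def q_def)
qed

text \<open>\<bar>sgnS s\<bar> \<le> \<bar>s\<bar> brings in the shift estimate, whose right-hand
  side does not depend on the truncation level. \<bar>sgnS s\<bar> \<le> 1 gives the majorant norm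
  (A z) under which the truncation is removed.\<close>

lemma boundary_layer_estimate:
  assumes E [measurable]: "E \<in> sets borel" and L: "L \<in> sets borel" and s: "s > 0" and \<nu>: "norm \<nu> = 1"
    and exit: "\<And>z. z \<in> E \<Longrightarrow> fst z + s *\<^sub>R \<nu> \<notin> \<Omega>"
    and sub: "\<And>z r. z \<in> E \<Longrightarrow> 0 \<le> r \<Longrightarrow> r \<le> s \<Longrightarrow> z + r *\<^sub>R (\<nu>, 0) \<in> L"
  shows "(\<integral>z. indicator E z * (\<bar>sgnS (w z)\<bar> * norm (A z)) \<partial>lborel)
    \<le> s * (\<integral>z. indicator L z * (norm (A z) powr (p / (p - 1)) + norm (G z) powr p) \<partial>lborel)"
proof -
  have le: "(\<integral>z. indicator E z * (\<bar>sgnS (w z)\<bar> * min (norm (A z)) (real n)) \<partial>lborel)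
      \<le> s * (\<integral>z. indicator L z * (norm (A z) powr (p / (p - 1)) + norm (G z) powr p) \<partial>lborel)" for n
  proof -
    have "(\<integral>z. indicator E z * (\<bar>sgnS (w z)\<bar> * min (norm (A z)) (real n)) \<partial>lborel)
      \<le> (\<integral>z. indicator E z * min (norm (A z)) (real n) * \<bar>w z\<bar> \<partial>lborel)"
    proof (rule integral_mono')
      show "integrable lborel (\<lambda>z. indicator E z * min (norm (A z)) (real n) * \<bar>w z\<bar>)"
      proof (rule Bochner_Integration.integrable_bound)
        show "integrable lborel (\<lambda>z. real n * \<bar>w z\<bar>)" using int_w by auto
        show "AE z in lborel. norm (indicator E z * min (norm (A z)) (real n) * \<bar>w z\<bar>) \<le> norm (real n * \<bar>w z\<bar>)"
          by (auto simp: indicator_def abs_mult intro!: mult_right_mono)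
      qed measurable
      show "indicator E z * (\<bar>sgnS (w z)\<bar> * min (norm (A z)) (real n)) \<le> indicator E z * min (norm (A z)) (real n) * \<bar>w z\<bar>" for z
        using mult_right_mono[OF abs_sgnS_le(2)[of "w z"], of "min (norm (A z)) (real n)"] by (auto simp: indicator_def mult.commute)
      show "0 \<le> indicator E z * min (norm (A z)) (real n) * \<bar>w z\<bar>" for z by auto
    qed
    also have "\<dots> \<le> s * (\<integral>z. indicator L z * (norm (A z) powr (p / (p - 1)) + norm (G z) powr p) \<partial>lborel)"
      by (rule weighted_shift_estimate[OF E L s \<nu> exit sub]) auto
    finally show ?thesis .
  qed
  have "(\<lambda>n. \<integral>z. indicator E z * (\<bar>sgnS (w z)\<bar> * min (norm (A z)) (real n)) \<partial>lborel)
      \<longlonglongrightarrow> (\<integral>z. indicator E z * (\<bar>sgnS (w z)\<bar> * norm (A z)) \<partial>lborel)"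
  proof (rule integral_dominated_convergence[where w = "\<lambda>z. norm (A z)"])
    show "AE z in lborel. (\<lambda>n. indicator E z * (\<bar>sgnS (w z)\<bar> * min (norm (A z)) (real n))) \<longlonglongrightarrow> indicator E z * (\<bar>sgnS (w z)\<bar> * norm (A z))"
    proof (rule AE_I2)
      fix z
      have "eventually (\<lambda>n. min (norm (A z)) (real n) = norm (A z)) sequentially"
        using eventually_ge_at_top[of "nat \<lceil>norm (A z)\<rceil>"] by eventually_elim linarith
      then have "(\<lambda>n. min (norm (A z)) (real n)) \<longlonglongrightarrow> norm (A z)" by (rule tendsto_eventually)
      then show "(\<lambda>n. indicator E z * (\<bar>sgnS (w z)\<bar> * min (norm (A z)) (real n))) \<longlonglongrightarrow> indicator E z * (\<bar>sgnS (w z)\<bar> * norm (A z))"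
        by (intro tendsto_intros)
    qed
    show "AE z in lborel. norm (indicator E z * (\<bar>sgnS (w z)\<bar> * min (norm (A z)) (real n))) \<le> norm (A z)" for n
    proof (rule AE_I2)
      fix z
      have "\<bar>sgnS (w z)\<bar> * min (norm (A z)) (real n) \<le> 1 * norm (A z)"
        using abs_sgnS_le(1)[of "w z"] by (intro mult_mono) auto
      then show "norm (indicator E z * (\<bar>sgnS (w z)\<bar> * min (norm (A z)) (real n))) \<le> norm (A z)"
        by (auto simp: indicator_def abs_mult)
    qed
  qed (use int_A in auto)
  then show ?thesis by (rule LIMSEQ_le_const2) (use le in auto)
qed

end

lemma infdist_Compl_ge_compact:
  fixes \<Omega> :: "'a::euclidean_space set"
  assumes "bounded \<Omega>" "e > 0"
  shows "compact {x. infdist x (- \<Omega>) \<ge> e}" "{x. infdist x (- \<Omega>) \<ge> e} \<subseteq> \<Omega>"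
proof -
  show sub: "{x. infdist x (- \<Omega>) \<ge> e} \<subseteq> \<Omega>"
  proof
    fix x assume x: "x \<in> {x. infdist x (- \<Omega>) \<ge> e}"
    show "x \<in> \<Omega>"
    proof (rule ccontr)
      assume "x \<notin> \<Omega>"
      then have "infdist x (- \<Omega>) = 0" by (intro infdist_zero) simp
      then show False using x assms(2) by simp
    qed
  qed
  have "closed {x. infdist x (- \<Omega>) \<ge> e}"
    by (intro closed_Collect_le continuous_intros)
  then show "compact {x. infdist x (- \<Omega>) \<ge> e}"
    using bounded_subset[OF assms(1) sub] by (simp add: compact_eq_bounded_closed)
qed

lemma near_frontier:
  fixes \<Omega> :: "'a::euclidean_space set"
  assumes "bounded \<Omega>" "x \<in> \<Omega>" "infdist x (- \<Omega>) < e"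
  obtains y where "y \<in> frontier \<Omega>" "dist x y < e"
proof -
  obtain y where y: "y \<in> - \<Omega>" "dist x y < e"
    using infdist_lessE[OF assms(3) bounded_Compl_nonempty[OF assms(1)]] by blast
  have "closed_segment x y \<inter> frontier \<Omega> \<noteq> {}"
    by (rule connected_Int_frontier) (use assms y in auto)
  then obtain y' where y': "y' \<in> closed_segment x y" "y' \<in> frontier \<Omega>" by blast
  have "dist x y' \<le> dist x y" using dist_in_closed_segment[OF y'(1)] by (simp add: dist_commute)
  then show ?thesis using y y' by (intro that[of y']) auto
qed

section \<open>Shrinking layers and vanishing of the difference\<close>

context difference_equation
begin

text \<open>Every point of the open set \<Omega> has positive distance to the complement and leaves
  the layers eventually; outside \<Omega> the integrand is zero.\<close>

lemma layer_integral_tendsto_0: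
  assumes \<epsilon>: "\<epsilon> \<longlonglongrightarrow> (0::real)"
  shows "(\<lambda>n. \<integral>z. indicator {z. infdist (fst z) (- \<Omega>) \<le> \<epsilon> n} z * (norm (A z) powr (p / (p - 1)) + norm (G z) powr p) \<partial>lborel) \<longlonglongrightarrow> 0"
proof -
  have [measurable]: "{z::'a \<times> real. infdist (fst z) (- \<Omega>) \<le> \<epsilon> n} \<in> sets borel" for n
    by (intro borel_closed closed_Collect_le continuous_intros)
  note ne = bounded_Compl_nonempty[OF \<Omega>(2)]
  have "(\<lambda>n. \<integral>z. indicator {z. infdist (fst z) (- \<Omega>) \<le> \<epsilon> n} z * (norm (A z) powr (p / (p - 1)) + norm (G z) powr p) \<partial>lborel)
      \<longlonglongrightarrow> (\<integral>z. 0 \<partial>(lborel :: ('a \<times> real) measure))"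
  proof (rule integral_dominated_convergence[where w = "\<lambda>z. norm (A z) powr (p / (p - 1)) + norm (G z) powr p"])
    show "AE z in lborel. (\<lambda>n. indicator {z. infdist (fst z) (- \<Omega>) \<le> \<epsilon> n} z * (norm (A z) powr (p / (p - 1)) + norm (G z) powr p)) \<longlonglongrightarrow> 0"
    proof (rule AE_I2)
      fix z :: "'a \<times> real"
      show "(\<lambda>n. indicator {z. infdist (fst z) (- \<Omega>) \<le> \<epsilon> n} z * (norm (A z) powr (p / (p - 1)) + norm (G z) powr p)) \<longlonglongrightarrow> 0"
      proof (cases "fst z \<in> \<Omega>")
        case True
        have "infdist (fst z) (- \<Omega>) > 0"
          using \<Omega>(1) ne True infdist_pos_not_in_closed[of "- \<Omega>" "fst z"] by auto
        then have "eventually (\<lambda>n. \<epsilon> n < infdist (fst z) (- \<Omega>)) sequentially"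
          using \<epsilon> by (rule order_tendstoD(2)[rotated])
        then have "eventually (\<lambda>n. indicator {z. infdist (fst z) (- \<Omega>) \<le> \<epsilon> n} z * (norm (A z) powr (p / (p - 1)) + norm (G z) powr p) = 0) sequentially"
          by eventually_elim (simp add: indicator_def)
        then show ?thesis by (rule tendsto_eventually)
      next
        case False
        then show ?thesis using zero[of z] by (simp add: mem_Times_iff)
      qed
    qed
    show "AE z in lborel. norm (indicat_real {z. infdist (fst z) (- \<Omega>) \<le> \<epsilon> n} z * (norm (A z) powr (p / (p - 1)) + norm (G z) powr p))
        \<le> norm (A z) powr (p / (p - 1)) + norm (G z) powr p" for n
      by (auto simp: indicator_def)
  qed (use int_Aq int_Gp in auto)
  then show ?thesis by simp
qed

text \<open>Exit directions are only local, so compactness of the frontier reduces the layer to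
  finitely many pieces with one direction each. Their number enters C.\<close>

lemma layer_bound:
  assumes dom: "smooth_domain \<Omega>"
  obtains e C where "e > 0" "C \<ge> 0" "\<And>\<epsilon>. 0 < \<epsilon> \<Longrightarrow> \<epsilon> < e \<Longrightarrow>
    (\<integral>z. indicator {z. fst z \<in> \<Omega> \<and> infdist (fst z) (- \<Omega>) \<le> 4 * \<epsilon>} z * (\<bar>sgnS (w z)\<bar> * norm (A z)) \<partial>lborel)
    \<le> C * \<epsilon> * (\<integral>z. indicator {z. infdist (fst z) (- \<Omega>) \<le> 25 * \<epsilon>} z * (norm (A z) powr (p / (p - 1)) + norm (G z) powr p) \<partial>lborel)"
proof -
  have "\<forall>x0\<in>frontier \<Omega>. \<exists>r \<nu>. r > 0 \<and> norm \<nu> = 1 \<and> (\<forall>x \<epsilon>. x \<in> ball x0 r \<longrightarrow> 0 < \<epsilon> \<longrightarrow> \<epsilon> < r \<longrightarrow> infdist x (- \<Omega>) < \<epsilon> \<longrightarrow> x + (4 * \<epsilon>) *\<^sub>R \<nu> \<notin> \<Omega>)"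
    by (metis smooth_domain_exit_direction[OF dom])
  then obtain r \<nu> where r: "\<And>x0. x0 \<in> frontier \<Omega> \<Longrightarrow> r x0 > 0" and \<nu>: "\<And>x0. x0 \<in> frontier \<Omega> \<Longrightarrow> norm (\<nu> x0) = 1"
    and exit: "\<And>x0 x \<epsilon>. x0 \<in> frontier \<Omega> \<Longrightarrow> x \<in> ball x0 (r x0) \<Longrightarrow> 0 < \<epsilon> \<Longrightarrow> \<epsilon> < r x0 \<Longrightarrow> infdist x (- \<Omega>) < \<epsilon> \<Longrightarrow> x + (4 * \<epsilon>) *\<^sub>R \<nu> x0 \<notin> \<Omega>"
    by metis
  have comp: "compact (frontier \<Omega>)" using \<Omega>(2) by (rule compact_frontier_bounded)
  then obtain S where S: "S \<subseteq> frontier \<Omega>" "finite S" "frontier \<Omega> \<subseteq> (\<Union>x\<in>S. ball x (r x))"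
    by (rule compactE_image[where C = "frontier \<Omega>" and f = "\<lambda>x. ball x (r x)"]) (use r in force)+
  \<comment> \<open>A Lebesgue number of the finite cover: a point of \<Omega> closer than e1 to the
    complement is closer than e1 to the frontier, hence in one of the balls.\<close>
  obtain e1 where e1: "e1 > 0" "(\<Union>x\<in>frontier \<Omega>. ball x e1) \<subseteq> (\<Union>x\<in>S. ball x (r x))"
    by (rule compact_subset_open_imp_ball_epsilon_subset[OF comp _ S(3)]) auto
  define e2 where "e2 = Min (insert e1 (r ` S))"
  have e2: "e2 > 0" "e2 \<le> e1" "\<And>x. x \<in> S \<Longrightarrow> e2 \<le> r x"
    using e1 S r by (auto simp: e2_def)
  show ?thesis
  proof (rule that[of "e2 / 6" "20 * real (card S)"])
    fix \<epsilon> assume \<epsilon>: "0 < \<epsilon>" "\<epsilon> < e2 / 6"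
    define L where "L = {z::'a \<times> real. infdist (fst z) (- \<Omega>) \<le> 25 * \<epsilon>}"
    define B where "B = (\<integral>z. indicator L z * (norm (A z) powr (p / (p - 1)) + norm (G z) powr p) \<partial>lborel)"
    define E where "E c = {z::'a \<times> real. fst z \<in> \<Omega> \<and> fst z \<in> ball c (r c) \<and> infdist (fst z) (- \<Omega>) \<le> 4 * \<epsilon>}" for c
    define E0 where "E0 = {z::'a \<times> real. fst z \<in> \<Omega> \<and> infdist (fst z) (- \<Omega>) \<le> 4 * \<epsilon>}"
    have L_b: "L \<in> sets borel" unfolding L_def by (intro borel_closed closed_Collect_le continuous_intros)
    have oc: "open {z::'a \<times> real. fst z \<in> \<Omega>}" "open {z::'a \<times> real. fst z \<in> ball c (r c)}"
      "closed {z::'a \<times> real. infdist (fst z) (- \<Omega>) \<le> 4 * \<epsilon>}" for c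
      using open_vimage_fst[OF \<Omega>(1)] open_vimage_fst[OF open_ball[of c "r c"]]
      by (auto simp: vimage_def intro!: closed_Collect_le continuous_intros)
    have E_b [measurable]: "E c \<in> sets borel" for c
    proof -
      have "E c = {z. fst z \<in> \<Omega>} \<inter> {z. fst z \<in> ball c (r c)} \<inter> {z. infdist (fst z) (- \<Omega>) \<le> 4 * \<epsilon>}"
        by (auto simp: E_def)
      then show ?thesis using oc by (auto intro!: sets.Int borel_open borel_closed simp del: mem_ball)
    qed
    \<comment> \<open>Distances at most 4\<epsilon> are strictly below 5\<epsilon>, so the exit
      direction at scale 5\<epsilon> applies with a shift of 4 * 5\<epsilon> = 20\<epsilon>. On the
      way the distance stays below 4\<epsilon> + 20\<epsilon> \<le> 25\<epsilon>. The bound e2 / 6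
      on \<epsilon> keeps 5\<epsilon> below the radii.\<close>
    have est: "(\<integral>z. indicator (E c) z * (\<bar>sgnS (w z)\<bar> * norm (A z)) \<partial>lborel) \<le> (20 * \<epsilon>) * B" if c: "c \<in> S" for c
      unfolding B_def
    proof (rule boundary_layer_estimate[OF E_b L_b])
      have cf: "c \<in> frontier \<Omega>" using c S by auto
      show "norm (\<nu> c) = 1" by (rule \<nu>[OF cf])
      show "fst z + (20 * \<epsilon>) *\<^sub>R \<nu> c \<notin> \<Omega>" if "z \<in> E c" for z
        using exit[OF cf, of "fst z" "5 * \<epsilon>"] that \<epsilon> e2(3)[OF c] by (auto simp: E_def)
      show "z + s *\<^sub>R (\<nu> c, 0) \<in> L" if "z \<in> E c" "0 \<le> s" "s \<le> 20 * \<epsilon>" for z s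
        using infdist_triangle[of "fst z + s *\<^sub>R \<nu> c" "- \<Omega>" "fst z"] that \<nu>[OF cf] by (auto simp: E_def L_def dist_norm)
    qed (use \<epsilon> in auto)
    have int_E: "integrable lborel (\<lambda>z. indicator X z * (\<bar>sgnS (w z)\<bar> * norm (A z)))" if [measurable]: "X \<in> sets borel" for X
    proof (rule Bochner_Integration.integrable_bound[OF integrable_norm[OF int_A]])
      have "\<bar>sgnS (w z)\<bar> * norm (A z) \<le> 1 * norm (A z)" for z
        using abs_sgnS_le(1)[of "w z"] by (intro mult_right_mono) auto
      then show "AE z in lborel. norm (indicator X z * (\<bar>sgnS (w z)\<bar> * norm (A z))) \<le> norm (norm (A z))"
        by (auto simp: indicator_def abs_mult)
    qed measurable
    have cover: "\<exists>c\<in>S. z \<in> E c" if zE: "z \<in> E0" for z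
    proof -
      have "infdist (fst z) (- \<Omega>) < e1" using zE \<epsilon> e2 by (auto simp: E0_def)
      then obtain y where y: "y \<in> frontier \<Omega>" "dist (fst z) y < e1"
        by (rule near_frontier[OF \<Omega>(2), rotated]) (use zE in \<open>auto simp: E0_def\<close>)
      have "fst z \<in> ball y e1" using y(2) by (simp add: dist_commute)
      then have "fst z \<in> (\<Union>x\<in>S. ball x (r x))" using e1(2) y(1) by blast
      then obtain c where "c \<in> S" "fst z \<in> ball c (r c)" by blast
      then show ?thesis using zE unfolding E0_def E_def by blast
    qed
    have "(\<integral>z. indicator E0 z * (\<bar>sgnS (w z)\<bar> * norm (A z)) \<partial>lborel)
        \<le> (\<integral>z. (\<Sum>c\<in>S. indicator (E c) z * (\<bar>sgnS (w z)\<bar> * norm (A z))) \<partial>lborel)"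
    proof (rule integral_mono')
      show "integrable lborel (\<lambda>z. \<Sum>c\<in>S. indicator (E c) z * (\<bar>sgnS (w z)\<bar> * norm (A z)))"
        by (intro Bochner_Integration.integrable_sum int_E E_b)
      fix z
      show "0 \<le> (\<Sum>c\<in>S. indicator (E c) z * (\<bar>sgnS (w z)\<bar> * norm (A z)))" by (intro sum_nonneg) auto
      then show "indicator E0 z * (\<bar>sgnS (w z)\<bar> * norm (A z)) \<le> (\<Sum>c\<in>S. indicator (E c) z * (\<bar>sgnS (w z)\<bar> * norm (A z)))"
      proof (cases "z \<in> E0")
        case True
        then obtain c where c: "c \<in> S" "z \<in> E c" using cover by blast
        have "indicator (E c) z * (\<bar>sgnS (w z)\<bar> * norm (A z)) \<le> (\<Sum>c\<in>S. indicator (E c) z * (\<bar>sgnS (w z)\<bar> * norm (A z)))"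
          by (rule member_le_sum[OF c(1)]) (use S in auto)
        then show ?thesis using True c by simp
      qed simp
    qed
    also have "\<dots> = (\<Sum>c\<in>S. \<integral>z. indicator (E c) z * (\<bar>sgnS (w z)\<bar> * norm (A z)) \<partial>lborel)"
      by (intro Bochner_Integration.integral_sum int_E E_b)
    also have "\<dots> \<le> (\<Sum>c\<in>S. (20 * \<epsilon>) * B)" by (intro sum_mono est)
    also have "\<dots> = 20 * real (card S) * \<epsilon> * B" by simp
    finally show "(\<integral>z. indicator {z. fst z \<in> \<Omega> \<and> infdist (fst z) (- \<Omega>) \<le> 4 * \<epsilon>} z * (\<bar>sgnS (w z)\<bar> * norm (A z)) \<partial>lborel)
      \<le> 20 * real (card S) * \<epsilon> * (\<integral>z. indicator {z. infdist (fst z) (- \<Omega>) \<le> 25 * \<epsilon>} z * (norm (A z) powr (p / (p - 1)) + norm (G z) powr p) \<partial>lborel)"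
      by (simp add: E0_def B_def L_def)
  qed (use e2 in auto)
qed

text \<open>The factor 1/\<epsilon> from the gradient of the cutoff cancels against the factor
  \<epsilon> of \<open>layer_bound\<close>. What is left is a constant times the integral over a
  layer that shrinks to the boundary.\<close>

lemma vanishes_inside:
  assumes dom: "smooth_domain \<Omega>" and T': "0 < T'" "T' < T" and e0: "e0 > 0"
  shows "AE z in lborel. infdist (fst z) (- \<Omega>) \<ge> e0 \<and> snd z < T' \<longrightarrow> w z = 0"
proof -
  obtain e C where e: "e > 0" and C: "C \<ge> 0" and layer: "\<And>\<epsilon>. 0 < \<epsilon> \<Longrightarrow> \<epsilon> < e \<Longrightarrow>
    (\<integral>z. indicator {z. fst z \<in> \<Omega> \<and> infdist (fst z) (- \<Omega>) \<le> 4 * \<epsilon>} z * (\<bar>sgnS (w z)\<bar> * norm (A z)) \<partial>lborel)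
    \<le> C * \<epsilon> * (\<integral>z. indicator {z. infdist (fst z) (- \<Omega>) \<le> 25 * \<epsilon>} z * (norm (A z) powr (p / (p - 1)) + norm (G z) powr p) \<partial>lborel)"
    by (rule layer_bound[OF dom]) (rule that)
  define B where "B \<epsilon> = (\<integral>z. indicator {z. infdist (fst z) (- \<Omega>) \<le> 25 * \<epsilon>} z * (norm (A z) powr (p / (p - 1)) + norm (G z) powr p) \<partial>lborel)" for \<epsilon>
  \<comment> \<open>On \<open>X\<close> every cutoff with 4\<epsilon> \<le> e0 equals 1, so
    \<open>f\<close> is a lower bound for the energy integrand that does not depend on
    \<epsilon>.\<close>
  define X where "X = {z::'a \<times> real. infdist (fst z) (- \<Omega>) \<ge> e0}"
  have X_b [measurable]: "X \<in> sets borel" unfolding X_def by (intro borel_closed closed_Collect_le continuous_intros)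
  define f where "f z = indicator X z * (2 * max 0 (T' - snd z) * absS (w z))" for z
  note [measurable] = borel_measurable_fst_snd
  have f_nonneg: "0 \<le> f z" for z using absS_bounds(1) by (auto simp: f_def)
  have key: "(\<integral>z. f z \<partial>lborel) \<le> (T'\<^sup>2 * real DIM('a) * C) * B \<epsilon>" and f_int: "integrable lborel f"
    if \<epsilon>: "0 < \<epsilon>" "\<epsilon> < e" "4 * \<epsilon> \<le> e0" for \<epsilon>
  proof -
    obtain \<eta> :: "'a \<Rightarrow> real" and \<eta>' where \<eta>:
      "\<And>b x. ((\<lambda>s. \<eta> (x + s *\<^sub>R b)) has_real_derivative \<eta>' b x) (at 0)"
      "continuous_on UNIV \<eta>" "\<And>b. continuous_on UNIV (\<eta>' b)"
      "\<And>x. 0 \<le> \<eta> x" "\<And>x. \<eta> x \<le> 1"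
      "\<And>b x. \<bar>\<eta>' b x\<bar> \<le> norm b / \<epsilon>"
      "\<And>x. \<eta> x \<noteq> 0 \<Longrightarrow> infdist x (- \<Omega>) > \<epsilon>"
      "\<And>x. infdist x (- \<Omega>) \<ge> 4 * \<epsilon> \<Longrightarrow> \<eta> x = 1"
      "\<And>b x. \<eta>' b x \<noteq> 0 \<Longrightarrow> infdist x (- \<Omega>) \<ge> \<epsilon> \<and> infdist x (- \<Omega>) \<le> 4 * \<epsilon>"
      by (rule cutoff_exists[OF \<Omega> \<epsilon>(1)]) (rule that)
    \<comment> \<open>\<eta> lives at distances above \<epsilon>. A ball of radius \<epsilon>/4
      around such a point stays at distances above 3\<epsilon>/4, well inside this compact
      set.\<close>
    let ?K = "{x. infdist x (- \<Omega>) \<ge> \<epsilon> / 2}"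
    have K: "compact ?K" "?K \<subseteq> \<Omega>" using infdist_Compl_ge_compact[OF \<Omega>(2), of "\<epsilon> / 2"] \<epsilon> by auto
    have sub: "cball x (\<epsilon> / 4) \<subseteq> ?K" if "\<eta> x \<noteq> 0" for x
    proof
      fix y assume "y \<in> cball x (\<epsilon> / 4)"
      then show "y \<in> ?K" using \<eta>(7)[OF that] infdist_triangle[of x "- \<Omega>" y] \<epsilon> by auto
    qed
    have bd: "\<bar>\<eta>' b x\<bar> \<le> 1 / \<epsilon>" if "b \<in> Basis" for b x using \<eta>(6)[of b x] that by simp
    have inK: "x \<in> ?K" if "\<eta>' b x \<noteq> 0" for b x using \<eta>(9)[OF that] \<epsilon> by auto
    have \<epsilon>4: "\<epsilon> / 4 > 0" using \<epsilon> by simp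
    define I1 where "I1 z = 2 * max 0 (T' - snd z) * \<eta> (fst z) * absS (w z)" for z
    define P where "P z = (max 0 (T' - snd z))\<^sup>2 * (sgnS (w z) * (\<Sum>b\<in>Basis. \<eta>' b (fst z) * (A z \<bullet> b)))" for z
    note EI = energy_inequality[OF \<eta>(1,2,3,4,5) bd K \<epsilon>4 sub inK T', folded I1_def P_def]
    have I1_int: "integrable lborel I1" using EI(2) by (simp add: I1_def[abs_def])
    have f_le: "f z \<le> I1 z" for z
      using \<eta>(8)[of "fst z"] \<eta>(4) absS_bounds(1) \<epsilon> by (auto simp: f_def I1_def X_def indicator_def)
    show f_int: "integrable lborel f"
    proof (rule Bochner_Integration.integrable_bound[OF I1_int])
      show "f \<in> borel_measurable lborel" unfolding f_def by measurable
      show "AE z in lborel. norm (f z) \<le> norm (I1 z)"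
      proof (rule AE_I2)
        fix z show "norm (f z) \<le> norm (I1 z)" using f_le[of z] f_nonneg[of z] by simp
      qed
    qed
    define E0 where "E0 = {z::'a \<times> real. fst z \<in> \<Omega> \<and> infdist (fst z) (- \<Omega>) \<le> 4 * \<epsilon>}"
    have [measurable]: "E0 \<in> sets borel"
    proof -
      have "E0 = {z. fst z \<in> \<Omega>} \<inter> {z. infdist (fst z) (- \<Omega>) \<le> 4 * \<epsilon>}" by (auto simp: E0_def)
      moreover have "open {z::'a \<times> real. fst z \<in> \<Omega>}" using open_vimage_fst[OF \<Omega>(1)] by (auto simp: vimage_def)
      moreover have "closed {z::'a \<times> real. infdist (fst z) (- \<Omega>) \<le> 4 * \<epsilon>}" by (intro closed_Collect_le continuous_intros)
      ultimately show ?thesis by (auto intro!: sets.Int borel_open borel_closed)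
    qed
    define g where "g z = (T'\<^sup>2 * (real DIM('a) / \<epsilon>)) * (indicator E0 z * (\<bar>sgnS (w z)\<bar> * norm (A z)))" for z
    have g_nonneg: "0 \<le> g z" for z using \<epsilon> by (auto simp: g_def)
    have P_le: "\<bar>P z\<bar> \<le> g z" for z
    proof (cases "z \<in> \<Omega> \<times> {0<..<T}")
      case False
      then show ?thesis using zero[OF False] g_nonneg[of z] by (simp add: P_def)
    next
      case zQ: True
      show ?thesis
      proof (cases "infdist (fst z) (- \<Omega>) \<le> 4 * \<epsilon>")
        case True
        have "\<bar>\<eta>' b (fst z) * (A z \<bullet> b)\<bar> \<le> 1 / \<epsilon> * norm (A z)" if "b \<in> Basis" for b
          unfolding abs_mult using bd[OF that] Basis_le_norm[OF that, of "A z"] \<epsilon> by (intro mult_mono) auto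
        then have "\<bar>\<Sum>b\<in>Basis. \<eta>' b (fst z) * (A z \<bullet> b)\<bar> \<le> (\<Sum>b\<in>(Basis::'a set). 1 / \<epsilon> * norm (A z))"
          by (intro order_trans[OF sum_abs] sum_mono)
        then have S: "\<bar>\<Sum>b\<in>Basis. \<eta>' b (fst z) * (A z \<bullet> b)\<bar> \<le> real DIM('a) / \<epsilon> * norm (A z)" by simp
        have "(max 0 (T' - snd z))\<^sup>2 \<le> T'\<^sup>2" using zQ T' by (intro power_mono) auto
        then have "\<bar>P z\<bar> \<le> T'\<^sup>2 * (\<bar>sgnS (w z)\<bar> * (real DIM('a) / \<epsilon> * norm (A z)))"
          unfolding P_def abs_mult using S by (intro mult_mono) auto
        also have "\<dots> = g z" using True zQ by (simp add: g_def E0_def mem_Times_iff)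
        finally show ?thesis .
      next
        case False
        then have "\<eta>' b (fst z) = 0" for b using \<eta>(9)[of b "fst z"] by blast
        then show ?thesis using g_nonneg[of z] by (simp add: P_def)
      qed
    qed
    have g_int: "integrable lborel g"
    proof -
      have "integrable lborel (\<lambda>z. indicator E0 z * (\<bar>sgnS (w z)\<bar> * norm (A z)))"
      proof (rule Bochner_Integration.integrable_bound[OF integrable_norm[OF int_A]])
        have "\<bar>sgnS (w z)\<bar> * norm (A z) \<le> 1 * norm (A z)" for z
          using abs_sgnS_le(1)[of "w z"] by (intro mult_right_mono) auto
        then show "AE z in lborel. norm (indicator E0 z * (\<bar>sgnS (w z)\<bar> * norm (A z))) \<le> norm (norm (A z))"
          by (auto simp: indicator_def abs_mult)
      qed measurable
      then show ?thesis unfolding g_def by (rule integrable_mult_right)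
    qed
    have "(\<integral>z. f z \<partial>lborel) \<le> (\<integral>z. I1 z \<partial>lborel)"
      by (intro integral_mono f_int I1_int f_le)
    also have "\<dots> \<le> - (\<integral>z. P z \<partial>lborel)" using EI(1) by (simp add: I1_def P_def)
    also have "\<dots> = (\<integral>z. - P z \<partial>lborel)" by simp
    also have "\<dots> \<le> (\<integral>z. g z \<partial>lborel)"
      using P_le g_nonneg by (intro integral_mono' g_int) (auto simp: abs_le_iff)
    also have "\<dots> = (T'\<^sup>2 * (real DIM('a) / \<epsilon>)) * (\<integral>z. indicator E0 z * (\<bar>sgnS (w z)\<bar> * norm (A z)) \<partial>lborel)"
      unfolding g_def by simp
    \<comment> \<open>Here the 1/\<epsilon> of the cutoff meets the \<epsilon> of the layer
      bound.\<close>
    also have "\<dots> \<le> (T'\<^sup>2 * (real DIM('a) / \<epsilon>)) * (C * \<epsilon> * B \<epsilon>)"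
      unfolding E0_def B_def using \<epsilon> by (intro mult_left_mono layer) auto
    also have "\<dots> = (T'\<^sup>2 * real DIM('a) * C) * B \<epsilon>" using \<epsilon> by simp
    finally show "(\<integral>z. f z \<partial>lborel) \<le> (T'\<^sup>2 * real DIM('a) * C) * B \<epsilon>" .
  qed
  define c where "c = min (e / 2) (e0 / 4)"
  have c: "c > 0" "c < e" "4 * c \<le> e0" using e e0 by (auto simp: c_def)
  define \<epsilon> where "\<epsilon> n = c * inverse (real (Suc n))" for n
  have inv: "inverse (real (Suc n)) \<le> 1" for n by (simp add: inverse_le_1_iff)
  have \<epsilon>: "0 < \<epsilon> n" "\<epsilon> n < e" "4 * \<epsilon> n \<le> e0" for n
  proof -
    have le: "\<epsilon> n \<le> c" unfolding \<epsilon>_def using mult_left_mono[OF inv, of c n] c by simp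
    show "0 < \<epsilon> n" using c by (simp add: \<epsilon>_def)
    show "\<epsilon> n < e" "4 * \<epsilon> n \<le> e0" using c le by linarith+
  qed
  have "\<epsilon> \<longlonglongrightarrow> 0" unfolding \<epsilon>_def by (rule tendsto_mult_right_zero[OF LIMSEQ_inverse_real_of_nat])
  then have "(\<lambda>n. 25 * \<epsilon> n) \<longlonglongrightarrow> 0" by (rule tendsto_mult_right_zero)
  then have "(\<lambda>n. B (\<epsilon> n)) \<longlonglongrightarrow> 0" unfolding B_def by (rule layer_integral_tendsto_0)
  then have "(\<lambda>n. (T'\<^sup>2 * real DIM('a) * C) * B (\<epsilon> n)) \<longlonglongrightarrow> 0" by (rule tendsto_mult_right_zero)
  then have "(\<integral>z. f z \<partial>lborel) \<le> 0" by (rule LIMSEQ_le_const) (use key[OF \<epsilon>] in auto)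
  then have "(\<integral>z. f z \<partial>lborel) = 0" using f_nonneg by (intro antisym Bochner_Integration.integral_nonneg)
  then have "AE z in lborel. f z = 0"
    using f_int[OF c] f_nonneg by (subst (asm) integral_nonneg_eq_0_iff_AE) auto
  then show ?thesis
    by eventually_elim (auto simp: f_def X_def indicator_def absS_eq_0_iff split: if_splits)
qed

theorem vanishes:
  assumes dom: "smooth_domain \<Omega>" and T: "T > 0"
  shows "AE z in lborel. w z = 0"
proof -
  \<comment> \<open>The double \<open>Suc\<close> gives \<epsilon> n < 1, so that the time T * (1 -
    \<epsilon> n) is positive.\<close>
  define \<epsilon> where "\<epsilon> n = inverse (real (Suc (Suc n)))" for n
  have \<epsilon>: "0 < \<epsilon> n" "\<epsilon> n < 1" for n by (auto simp: \<epsilon>_def inverse_less_1_iff)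
  have lim: "\<epsilon> \<longlonglongrightarrow> 0" unfolding \<epsilon>_def by (rule LIMSEQ_Suc[OF LIMSEQ_inverse_real_of_nat])
  have "AE z in lborel. infdist (fst z) (- \<Omega>) \<ge> \<epsilon> n \<and> snd z < T * (1 - \<epsilon> n) \<longrightarrow> w z = 0" for n
    using \<epsilon>[of n] T by (intro vanishes_inside[OF dom]) auto
  then have "AE z in lborel. \<forall>n. infdist (fst z) (- \<Omega>) \<ge> \<epsilon> n \<and> snd z < T * (1 - \<epsilon> n) \<longrightarrow> w z = 0"
    unfolding AE_all_countable by blast
  then show ?thesis
  proof eventually_elim
    case (elim z)
    show ?case
    proof (cases "z \<in> \<Omega> \<times> {0<..<T}")
      case True
      have pos: "infdist (fst z) (- \<Omega>) > 0"
        using closed_Compl[OF \<Omega>(1)] True bounded_Compl_nonempty[OF \<Omega>(2)] infdist_pos_not_in_closed[of "- \<Omega>" "fst z"] by auto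
      have "(\<lambda>n. T * (1 - \<epsilon> n)) \<longlonglongrightarrow> T * (1 - 0)" by (intro tendsto_intros lim)
      then have "eventually (\<lambda>n. snd z < T * (1 - \<epsilon> n)) sequentially"
        using True by (intro order_tendstoD(1)) auto
      moreover have "eventually (\<lambda>n. \<epsilon> n < infdist (fst z) (- \<Omega>)) sequentially"
        using lim pos by (intro order_tendstoD(2)) auto
      ultimately have "eventually (\<lambda>n. w z = 0) sequentially"
        by eventually_elim (use elim in \<open>auto intro: less_imp_le\<close>)
      then show ?thesis by simp
    qed (use zero in auto)
  qed
qed

end

section \<open>Test functions and weak derivatives\<close>

lemma grad_eqI:
  assumes "GDERIV f x :> D" shows "grad f x = D"
  unfolding grad_def
proof (rule some_equality[where P = "\<lambda>D. GDERIV f x :> D", OF assms])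
  fix D' assume "GDERIV f x :> D'"
  then have "(\<lambda>h. h \<bullet> D') = (\<lambda>h. h \<bullet> D)"
    using assms unfolding gderiv_def by (rule has_derivative_unique)
  then have "(D' - D) \<bullet> D' = (D' - D) \<bullet> D" by metis
  then have "(D' - D) \<bullet> (D' - D) = 0" by (simp add: inner_diff_right)
  then show "D' = D" by simp
qed

text \<open>\<open>smooth_on\<close> speaks of partial derivatives, \<open>grad\<close> of a total
  derivative. The increment is split into moves along one basis vector at a time; each is estimated
  by the mean value theorem and continuity of the partial derivative at x.\<close>

lemma continuous_partials_imp_GDERIV:
  fixes f :: "'a::euclidean_space \<Rightarrow> real"
  assumes D: "\<And>b x. b \<in> Basis \<Longrightarrow> ((\<lambda>s. f (x + s *\<^sub>R b)) has_real_derivative g b x) (at 0)"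
    and cont: "\<And>b. b \<in> Basis \<Longrightarrow> continuous_on UNIV (g b)"
  shows "GDERIV f x :> (\<Sum>b\<in>Basis. g b x *\<^sub>R b)"
proof -
  have claim: "\<exists>d>0. \<forall>h. norm h < d \<longrightarrow>
      \<bar>f (x + (\<Sum>b\<in>B. (h \<bullet> b) *\<^sub>R b)) - f x - (\<Sum>b\<in>B. (h \<bullet> b) * g b x)\<bar> \<le> e * norm h"
    if "finite B" "B \<subseteq> Basis" "e > 0" for B e
    using that
  proof (induction B arbitrary: e rule: finite_induct)
    case empty
    then show ?case by (intro exI[of _ 1]) auto
  next
    case (insert c B)
    then have c: "c \<in> Basis" by simp
    obtain d1 where d1: "d1 > 0" "\<And>h. norm h < d1 \<Longrightarrow>
        \<bar>f (x + (\<Sum>b\<in>B. (h \<bullet> b) *\<^sub>R b)) - f x - (\<Sum>b\<in>B. (h \<bullet> b) * g b x)\<bar> \<le> e / 2 * norm h"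
      using insert.IH[of "e / 2"] insert.prems by auto
    have "isCont (g c) x" using cont[OF c] by (simp add: continuous_on_eq_continuous_at)
    then obtain d2 where d2: "d2 > 0" "\<And>y. dist y x < d2 \<Longrightarrow> dist (g c y) (g c x) < e / 2"
      using insert.prems unfolding continuous_at_eps_delta by (metis half_gt_zero)
    \<comment> \<open>The number of coordinate moves, including the new direction c. Each has length
      at most norm h, so all intermediate points lie within N * norm h of x.\<close>
    define N where "N = real (card B) + 1"
    have N: "N > 0" by (simp add: N_def)
    show ?case
    proof (intro exI[of _ "min d1 (d2 / N)"] conjI allI impI)
      show "0 < min d1 (d2 / N)" using d1 d2 N by simp
      fix h :: 'a assume h: "norm h < min d1 (d2 / N)"
      define y where "y = x + (\<Sum>b\<in>B. (h \<bullet> b) *\<^sub>R b)"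
      \<comment> \<open>Subtracting the linear part leaves a function whose derivative is the
        oscillation of \<open>g c\<close>, below e / 2 near x.\<close>
      define k where "k s = f (y + s *\<^sub>R c) - s * g c x" for s
      have near: "dist (y + s *\<^sub>R c) x < d2" if "\<bar>s\<bar> \<le> \<bar>h \<bullet> c\<bar>" for s
      proof -
        have "norm ((\<Sum>b\<in>B. (h \<bullet> b) *\<^sub>R b) + s *\<^sub>R c) \<le> (\<Sum>b\<in>B. norm h) + norm h"
        proof (rule order_trans[OF norm_triangle_ineq add_mono])
          show "norm (\<Sum>b\<in>B. (h \<bullet> b) *\<^sub>R b) \<le> (\<Sum>b\<in>B. norm h)"
          proof (rule order_trans[OF norm_sum sum_mono])
            fix b assume "b \<in> B"
            then have "b \<in> Basis" using insert.prems by auto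
            then show "norm ((h \<bullet> b) *\<^sub>R b) \<le> norm h" using Basis_le_norm[of b h] by simp
          qed
          show "norm (s *\<^sub>R c) \<le> norm h" using that Basis_le_norm[OF c, of h] c by simp
        qed
        also have "\<dots> = N * norm h" by (simp add: N_def algebra_simps)
        also have "\<dots> < d2" using h N by (simp add: less_divide_eq mult.commute)
        finally show ?thesis by (simp add: y_def dist_norm add.assoc)
      qed
      have "norm (k (h \<bullet> c) - k 0) \<le> e / 2 * norm (h \<bullet> c - 0)"
      proof (rule field_differentiable_bound[where S = "{- \<bar>h \<bullet> c\<bar>..\<bar>h \<bullet> c\<bar>}" and f' = "\<lambda>s. g c (y + s *\<^sub>R c) - g c x"])
        fix s assume s: "s \<in> {- \<bar>h \<bullet> c\<bar>..\<bar>h \<bullet> c\<bar>}"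
        have "((\<lambda>s. f (y + s *\<^sub>R c)) has_real_derivative g c (y + s *\<^sub>R c)) (at s)"
          by (rule dir_deriv_shift[OF D[OF c]])
        then have "(k has_real_derivative g c (y + s *\<^sub>R c) - g c x) (at s)"
          unfolding k_def[abs_def] by (auto intro!: derivative_eq_intros)
        then show "(k has_field_derivative g c (y + s *\<^sub>R c) - g c x) (at s within {- \<bar>h \<bullet> c\<bar>..\<bar>h \<bullet> c\<bar>})"
          by (rule has_field_derivative_at_within)
        show "norm (g c (y + s *\<^sub>R c) - g c x) \<le> e / 2"
          using d2(2)[OF near[of s]] s by (simp add: dist_norm abs_le_iff)
      qed auto
      also have "\<dots> \<le> e / 2 * norm h"
        using Basis_le_norm[OF c, of h] insert.prems by (intro mult_left_mono) auto
      finally have 1: "\<bar>k (h \<bullet> c) - k 0\<bar> \<le> e / 2 * norm h" by simp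
      have 2: "\<bar>f y - f x - (\<Sum>b\<in>B. (h \<bullet> b) * g b x)\<bar> \<le> e / 2 * norm h"
        using d1(2)[of h] h by (simp add: y_def)
      have eq1: "x + (\<Sum>b\<in>insert c B. (h \<bullet> b) *\<^sub>R b) = y + (h \<bullet> c) *\<^sub>R c"
        using insert.hyps by (simp add: y_def)
      have eq2: "(\<Sum>b\<in>insert c B. (h \<bullet> b) * g b x) = (h \<bullet> c) * g c x + (\<Sum>b\<in>B. (h \<bullet> b) * g b x)"
        using insert.hyps by simp
      have "f (x + (\<Sum>b\<in>insert c B. (h \<bullet> b) *\<^sub>R b)) - f x - (\<Sum>b\<in>insert c B. (h \<bullet> b) * g b x)
          = (k (h \<bullet> c) - k 0) + (f y - f x - (\<Sum>b\<in>B. (h \<bullet> b) * g b x))"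
        unfolding eq1 eq2 k_def by simp
      also have "\<bar>\<dots>\<bar> \<le> e / 2 * norm h + e / 2 * norm h"
        by (rule order_trans[OF abs_triangle_ineq add_mono[OF 1 2]])
      finally show "\<bar>f (x + (\<Sum>b\<in>insert c B. (h \<bullet> b) *\<^sub>R b)) - f x - (\<Sum>b\<in>insert c B. (h \<bullet> b) * g b x)\<bar> \<le> e * norm h"
        by (simp add: field_simps)
    qed
  qed
  show ?thesis
    unfolding gderiv_def has_derivative_at_alt
  proof (intro conjI allI impI)
    show "bounded_linear (\<lambda>h. h \<bullet> (\<Sum>b\<in>Basis. g b x *\<^sub>R b))" by (rule bounded_linear_inner_left)
    fix e :: real assume "0 < e"
    then obtain d where d: "d > 0" "\<And>h. norm h < d \<Longrightarrow>
      \<bar>f (x + (\<Sum>b\<in>Basis. (h \<bullet> b) *\<^sub>R b)) - f x - (\<Sum>b\<in>Basis. (h \<bullet> b) * g b x)\<bar> \<le> e * norm h"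
      using claim[of Basis e] by auto
    show "\<exists>d>0. \<forall>y. norm (y - x) < d \<longrightarrow> norm (f y - f x - (y - x) \<bullet> (\<Sum>b\<in>Basis. g b x *\<^sub>R b)) \<le> e * norm (y - x)"
    proof (intro exI[of _ d] conjI allI impI d(1))
      fix y assume "norm (y - x) < d"
      from d(2)[OF this] show "norm (f y - f x - (y - x) \<bullet> (\<Sum>b\<in>Basis. g b x *\<^sub>R b)) \<le> e * norm (y - x)"
        by (simp add: euclidean_representation inner_sum_right mult.commute)
    qed
  qed
qed

lemma test_fun_GDERIV:
  fixes \<phi> :: "'a::euclidean_space \<Rightarrow> real"
  assumes "test_fun U \<phi>"
  shows "GDERIV \<phi> x :> grad \<phi> x" "continuous_on UNIV (grad \<phi>)"
proof -
  have "\<forall>b\<in>Basis. \<exists>g. continuous_on UNIV g \<and> (\<forall>x. ((\<lambda>s. \<phi> (x + s *\<^sub>R b)) has_real_derivative g x) (at 0))"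
    using assms unfolding test_fun_def by (metis UNIV_I smooth_on_partial)
  then obtain g where g: "\<And>b. b \<in> Basis \<Longrightarrow> continuous_on UNIV (g b)"
    "\<And>b x. b \<in> Basis \<Longrightarrow> ((\<lambda>s. \<phi> (x + s *\<^sub>R b)) has_real_derivative g b x) (at 0)"
    by metis
  have D: "GDERIV \<phi> x :> (\<Sum>b\<in>Basis. g b x *\<^sub>R b)" for x
    using g by (intro continuous_partials_imp_GDERIV)
  then have eq: "grad \<phi> = (\<lambda>x. \<Sum>b\<in>Basis. g b x *\<^sub>R b)" by (auto intro: grad_eqI)
  show "GDERIV \<phi> x :> grad \<phi> x" unfolding eq by (rule D)
  show "continuous_on UNIV (grad \<phi>)" unfolding eq using g(1) by (intro continuous_intros)
qed

lemma GDERIV_imp_continuous_on: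
  assumes "\<And>x. GDERIV f x :> D x" shows "continuous_on UNIV f"
  using assms unfolding gderiv_def by (meson continuous_at_imp_continuous_on has_derivative_continuous)

lemma csupp_outside:
  fixes f :: "'a::euclidean_space \<Rightarrow> real"
  assumes "x \<notin> csupp f"
  shows "f x = 0" "GDERIV f x :> D \<Longrightarrow> D = 0"
proof -
  show "f x = 0" using assms closure_subset[of "{x. f x \<noteq> 0}"] by (auto simp: csupp_def)
  have out: "f y = 0" if "y \<in> - csupp f" for y
    using that closure_subset[of "{x. f x \<noteq> 0}"] by (auto simp: csupp_def)
  have "open (- csupp f)" unfolding csupp_def by (intro open_Compl closed_closure)
  then have "(f has_derivative (\<lambda>h. 0)) (at x)"
    by (rule has_derivative_transform_within_open[OF has_derivative_const[of 0]]) (use assms out in auto)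
  then have "GDERIV f x :> 0" by (simp add: gderiv_def)
  moreover assume "GDERIV f x :> D"
  ultimately show "D = 0" using grad_eqI by metis
qed

lemma bounded_csupp:
  assumes "compact (csupp f)"
  obtains R where "\<And>x. norm x > R \<Longrightarrow> x \<notin> csupp f"
proof -
  obtain R where "\<And>x. x \<in> csupp f \<Longrightarrow> norm x \<le> R"
    using compact_imp_bounded[OF assms] by (auto simp: bounded_iff)
  then show ?thesis by (intro that[of R]) force
qed

text \<open>In place of Hoelder's inequality: f / l \<le> 1 + (f / l) powr q gives f \<le> l + l
  powr (1 - q) * f powr q on \<Omega> for every l > 0, and l is at our disposal because \<Omega> has
  finite measure.\<close>

lemma tendsto_L1_of_Lp:
  fixes f :: "nat \<Rightarrow> 'a::euclidean_space \<Rightarrow> real"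
  assumes q: "q \<ge> 1" and \<Omega>: "\<Omega> \<in> sets borel" "emeasure lborel \<Omega> < \<infinity>"
    and f: "\<And>n x. 0 \<le> f n x" "\<And>n x. x \<notin> \<Omega> \<Longrightarrow> f n x = 0" "\<And>n. f n \<in> borel_measurable borel"
    and int: "\<And>n. integrable lborel (\<lambda>x. f n x powr q)"
    and lim: "(\<lambda>n. \<integral>x. f n x powr q \<partial>lborel) \<longlonglongrightarrow> 0"
  shows "(\<lambda>n. \<integral>x. f n x \<partial>lborel) \<longlonglongrightarrow> 0"
proof (rule tendstoI)
  fix e :: real assume e: "e > 0"
  \<comment> \<open>The added 1 avoids division by zero when \<Omega> is null, and the product of l
    and the measure of \<Omega> is at most e / 2.\<close>
  define l where "l = e / (2 * (measure lborel \<Omega> + 1))"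
  have l: "l > 0" using e by (simp add: l_def add_nonneg_pos)
  have l\<Omega>: "l * measure lborel \<Omega> < e"
  proof -
    have "l * measure lborel \<Omega> \<le> l * (measure lborel \<Omega> + 1)" using l by simp
    also have "\<dots> = e / 2" using measure_nonneg[of lborel \<Omega>] by (simp add: l_def field_simps add_nonneg_eq_0_iff)
    finally show ?thesis using e by simp
  qed
  have le: "f n x \<le> l * indicator \<Omega> x + l powr (1 - q) * f n x powr q" for n x
  proof (cases "x \<in> \<Omega>")
    case True
    have "f n x / l \<le> 1 + (f n x / l) powr q" using f(1) l q by (intro le_one_plus_powr) auto
    then have "f n x \<le> l * (1 + (f n x / l) powr q)" using l by (simp add: divide_le_eq mult.commute)
    also have "(f n x / l) powr q = f n x powr q / l powr q" using f(1) l by (simp add: powr_divide)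
    also have "l * (1 + f n x powr q / l powr q) = l * indicator \<Omega> x + l powr (1 - q) * f n x powr q"
      using l True by (simp add: distrib_left powr_diff)
    finally show ?thesis .
  qed (use f in auto)
  have int_\<Omega>: "integrable lborel (\<lambda>x. l * indicator \<Omega> x :: real)"
    using \<Omega> by (intro integrable_mult_right integrable_real_indicator) auto
  have bound: "(\<integral>x. f n x \<partial>lborel) \<le> l * measure lborel \<Omega> + l powr (1 - q) * (\<integral>x. f n x powr q \<partial>lborel)" for n
  proof -
    have "(\<integral>x. f n x \<partial>lborel) \<le> (\<integral>x. l * indicator \<Omega> x + l powr (1 - q) * f n x powr q \<partial>lborel)"
      using le f(1) l int int_\<Omega> by (intro integral_mono') (auto intro: order_trans[OF f(1) le])
    also have "\<dots> = l * measure lborel \<Omega> + l powr (1 - q) * (\<integral>x. f n x powr q \<partial>lborel)"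
      using int int_\<Omega> \<Omega> by simp
    finally show ?thesis .
  qed
  have "(\<lambda>n. l * measure lborel \<Omega> + l powr (1 - q) * (\<integral>x. f n x powr q \<partial>lborel)) \<longlonglongrightarrow> l * measure lborel \<Omega> + l powr (1 - q) * 0"
    by (intro tendsto_intros lim)
  then have "eventually (\<lambda>n. l * measure lborel \<Omega> + l powr (1 - q) * (\<integral>x. f n x powr q \<partial>lborel) < e) sequentially"
    using l\<Omega> by (intro order_tendstoD(2)) auto
  then show "eventually (\<lambda>n. dist (\<integral>x. f n x \<partial>lborel) 0 < e) sequentially"
  proof eventually_elim
    case (elim n)
    have "0 \<le> (\<integral>x. f n x \<partial>lborel)" using f(1) by (intro Bochner_Integration.integral_nonneg)
    then show ?case using bound[of n] elim by simp
  qed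
qed

lemma powr_add_le:
  fixes x y q :: real
  assumes "x \<ge> 0" "y \<ge> 0" "q \<ge> 0"
  shows "(x + y) powr q \<le> 2 powr q * (x powr q + y powr q)"
proof -
  have "(x + y) powr q \<le> (2 * max x y) powr q" using assms by (intro powr_mono2) auto
  also have "\<dots> = 2 powr q * (max x y) powr q" using assms by (simp add: powr_mult)
  also have "\<dots> \<le> 2 powr q * (x powr q + y powr q)"
    using assms by (intro mult_left_mono) (auto simp: max_def)
  finally show ?thesis .
qed

lemma integrable_powr_diff:
  fixes f g :: "'a::euclidean_space \<Rightarrow> 'b::euclidean_space"
  assumes [measurable]: "f \<in> borel_measurable borel" "g \<in> borel_measurable borel"
    and int: "integrable lborel (\<lambda>x. norm (f x) powr q)" "integrable lborel (\<lambda>x. norm (g x) powr q)" and q: "q \<ge> 0"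
  shows "integrable lborel (\<lambda>x. norm (f x - g x) powr q)"
proof (rule Bochner_Integration.integrable_bound)
  show "integrable lborel (\<lambda>x. 2 powr q * (norm (f x) powr q + norm (g x) powr q))" using int by auto
  have "norm (f x - g x) powr q \<le> 2 powr q * (norm (f x) powr q + norm (g x) powr q)" for x
    using q by (intro order_trans[OF powr_mono2 powr_add_le]) (auto intro: norm_triangle_ineq4)
  then show "AE x in lborel. norm (norm (f x - g x) powr q) \<le> norm (2 powr q * (norm (f x) powr q + norm (g x) powr q))"
    by (auto simp: abs_mult)
qed measurable

lemma integrable_powr_continuous:
  fixes f :: "'a::euclidean_space \<Rightarrow> 'b::euclidean_space"
  assumes "continuous_on UNIV f" "\<And>x. norm x > R \<Longrightarrow> f x = 0" "q > 0"
  shows "integrable lborel (\<lambda>x. norm (f x) powr q)"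
proof (rule integrable_bounded_continuous_cball[where R = R])
  show "continuous_on UNIV (\<lambda>x. norm (f x) powr q)"
    by (rule continuous_on_powr') (use assms in \<open>auto intro: continuous_intros\<close>)
qed (use assms in auto)

lemma integrable_bounded_mult:
  fixes k f :: "'a::euclidean_space \<Rightarrow> real"
  assumes "integrable lborel f" "k \<in> borel_measurable borel" "\<And>x. \<bar>k x\<bar> \<le> c"
  shows "integrable lborel (\<lambda>x. k x * f x)"
proof (rule Bochner_Integration.integrable_bound)
  show "integrable lborel (\<lambda>x. c * f x)" using assms by simp
  show "(\<lambda>x. k x * f x) \<in> borel_measurable lborel" using assms borel_measurable_integrable[OF assms(1)] by simp
  have "\<bar>k x\<bar> * \<bar>f x\<bar> \<le> \<bar>c\<bar> * \<bar>f x\<bar>" for x using assms(3)[of x] by (intro mult_right_mono) auto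
  then show "AE x in lborel. norm (k x * f x) \<le> norm (c * f x)" by (simp add: abs_mult)
qed

text \<open>Integration by parts against \<phi> n has no boundary term since \<phi> n is compactly
  supported in \<Omega>, whatever \<psi> does there. The formula survives the limit, so the zero
  extension of a W_0^{1,p} function has a weak gradient across the boundary.\<close>

lemma weak_derivative_of_approximation:
  fixes a :: "'a::euclidean_space \<Rightarrow> real" and g :: "'a \<Rightarrow> 'a"
  assumes \<Omega>: "open \<Omega>" "bounded \<Omega>" and p: "p > 1"
    and [measurable]: "a \<in> borel_measurable borel" "g \<in> borel_measurable borel"
    and zero: "\<And>x. x \<notin> \<Omega> \<Longrightarrow> a x = 0 \<and> g x = 0"
    and int: "integrable lborel (\<lambda>x. \<bar>a x\<bar> powr p)" "integrable lborel (\<lambda>x. norm (g x) powr p)"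
    and test: "\<And>n. test_fun \<Omega> (\<phi> n)"
    and lim: "(\<lambda>n. \<integral>x. \<bar>\<phi> n x - a x\<bar> powr p \<partial>lborel) \<longlonglongrightarrow> 0"
      "(\<lambda>n. \<integral>x. norm (grad (\<phi> n) x - g x) powr p \<partial>lborel) \<longlonglongrightarrow> 0"
    and \<psi>: "\<And>x. ((\<lambda>s. \<psi> (x + s *\<^sub>R \<nu>)) has_real_derivative \<psi>' x) (at 0)"
      "continuous_on UNIV \<psi>" "continuous_on UNIV \<psi>'" "\<And>x. \<bar>\<psi> x\<bar> \<le> M" "\<And>x. \<bar>\<psi>' x\<bar> \<le> M"
  shows "(\<integral>x. a x * \<psi>' x \<partial>lborel) = - (\<integral>x. \<psi> x * (g x \<bullet> \<nu>) \<partial>lborel)"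
proof -
  have M0: "0 \<le> M" using \<psi>(4)[of 0] by linarith
  note [measurable] = borel_measurable_continuous_onI[OF \<psi>(2)] borel_measurable_continuous_onI[OF \<psi>(3)]
  have \<Omega>_b: "\<Omega> \<in> sets borel" "emeasure lborel \<Omega> < \<infinity>"
    using \<Omega> emeasure_bounded_finite[OF \<Omega>(2)] by auto
  have cont: "continuous_on UNIV (\<phi> n)" "continuous_on UNIV (grad (\<phi> n))" for n
    using GDERIV_imp_continuous_on[OF test_fun_GDERIV(1)[OF test]] test_fun_GDERIV(2)[OF test] by auto
  have supp: "csupp (\<phi> n) \<subseteq> \<Omega>" "compact (csupp (\<phi> n))" for n
    using test[of n] by (auto simp: test_fun_def)
  have \<phi>_out: "\<phi> n x = 0" "grad (\<phi> n) x = 0" if "x \<notin> csupp (\<phi> n)" for n x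
    using csupp_outside[OF that] test_fun_GDERIV(1)[OF test] by auto
  note [measurable] = borel_measurable_continuous_onI[OF cont(1)] borel_measurable_continuous_onI[OF cont(2)]
  obtain R where R: "\<And>n x. norm x > R \<Longrightarrow> \<phi> n x = 0" "\<And>n x. norm x > R \<Longrightarrow> grad (\<phi> n) x = 0"
  proof -
    obtain R where "\<And>x. x \<in> \<Omega> \<Longrightarrow> norm x \<le> R" using \<Omega>(2) by (auto simp: bounded_iff)
    then have "x \<notin> csupp (\<phi> n)" if "norm x > R" for n x using supp(1)[of n] that by force
    then show ?thesis using that \<phi>_out by metis
  qed
  have L1a: "(\<lambda>n. \<integral>x. \<bar>\<phi> n x - a x\<bar> \<partial>lborel) \<longlonglongrightarrow> 0"
  proof (rule tendsto_L1_of_Lp[OF _ \<Omega>_b, of p])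
    show "\<bar>\<phi> n x - a x\<bar> = 0" if "x \<notin> \<Omega>" for n x using zero[OF that] \<phi>_out[of x n] supp(1)[of n] that by auto
    show "integrable lborel (\<lambda>x. \<bar>\<phi> n x - a x\<bar> powr p)" for n
      using integrable_powr_diff[of "\<phi> n" a p] integrable_powr_continuous[of "\<phi> n" R p] cont(1) R(1) int p by simp
  qed (use p lim in auto)
  have L1g: "(\<lambda>n. \<integral>x. norm (grad (\<phi> n) x - g x) \<partial>lborel) \<longlonglongrightarrow> 0"
  proof (rule tendsto_L1_of_Lp[OF _ \<Omega>_b, of p])
    show "norm (grad (\<phi> n) x - g x) = 0" if "x \<notin> \<Omega>" for n x using zero[OF that] \<phi>_out[of x n] supp(1)[of n] that by auto
    show "integrable lborel (\<lambda>x. norm (grad (\<phi> n) x - g x) powr p)" for n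
      using integrable_powr_diff[of "grad (\<phi> n)" g p] integrable_powr_continuous[of "grad (\<phi> n)" R p] cont(2) R(2) int p by simp
  qed (use p lim in auto)
  have int_a: "integrable lborel a"
    by (rule integrable_of_powr[of a \<Omega> p]) (use \<Omega> \<Omega>_b zero int p in auto)
  have int_g: "integrable lborel g"
    by (rule integrable_of_powr[of g \<Omega> p]) (use \<Omega> \<Omega>_b zero int p in auto)
  have int_\<phi>: "integrable lborel (\<phi> n)" "integrable lborel (grad (\<phi> n))" for n
    using integrable_bounded_continuous_cball[OF cont(1) R(1)] integrable_bounded_continuous_cball[OF cont(2) R(2)] by auto
  note mult_int = integrable_bounded_mult
  have parts: "(\<integral>x. \<psi>' x * \<phi> n x \<partial>lborel) = - (\<integral>x. \<psi> x * (grad (\<phi> n) x \<bullet> \<nu>) \<partial>lborel)" for n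
  proof -
    have "(\<integral>x. \<psi>' x * \<phi> n x + \<psi> x * (grad (\<phi> n) x \<bullet> \<nu>) \<partial>lborel) = 0"
    proof (rule integral_dir_deriv_eq_0[where f = "\<lambda>x. \<psi> x * \<phi> n x" and b = \<nu> and R = R])
      show "((\<lambda>s. \<psi> (x + s *\<^sub>R \<nu>) * \<phi> n (x + s *\<^sub>R \<nu>)) has_real_derivative \<psi>' x * \<phi> n x + \<psi> x * (grad (\<phi> n) x \<bullet> \<nu>)) (at 0)" for x
        using DERIV_mult[OF \<psi>(1)[of x] GDERIV_imp_dir_deriv[OF test_fun_GDERIV(1)[OF test[of n], of x], of \<nu>]]
        by (simp add: mult.commute)
    qed (use \<psi> cont R in \<open>auto intro!: continuous_intros\<close>)
    then show ?thesis
      using mult_int[OF int_\<phi>(1)[of n] _ \<psi>(5)] mult_int[OF integrable_inner_left[OF int_\<phi>(2)[of n], of \<nu>] _ \<psi>(4)] by simp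
  qed
  have "(\<lambda>n. \<integral>x. \<psi>' x * \<phi> n x \<partial>lborel) \<longlonglongrightarrow> (\<integral>x. \<psi>' x * a x \<partial>lborel)"
  proof (rule LIM_zero_cancel, rule Lim_null_comparison[OF _ tendsto_mult_right_zero[OF L1a, of M]], rule always_eventually, rule allI)
    fix n
    have "norm ((\<integral>x. \<psi>' x * \<phi> n x \<partial>lborel) - (\<integral>x. \<psi>' x * a x \<partial>lborel)) = \<bar>\<integral>x. \<psi>' x * (\<phi> n x - a x) \<partial>lborel\<bar>"
      using mult_int[OF int_\<phi>(1)[of n] _ \<psi>(5)] mult_int[OF int_a _ \<psi>(5)] by (simp add: right_diff_distrib)
    also have "\<dots> \<le> (\<integral>x. \<bar>\<psi>' x * (\<phi> n x - a x)\<bar> \<partial>lborel)" by (rule integral_abs_bound)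
    also have "\<dots> \<le> (\<integral>x. M * \<bar>\<phi> n x - a x\<bar> \<partial>lborel)"
      using int_\<phi>(1)[of n] int_a \<psi>(5) M0 by (intro integral_mono') (auto simp: abs_mult intro!: mult_right_mono)
    finally show "norm ((\<integral>x. \<psi>' x * \<phi> n x \<partial>lborel) - (\<integral>x. \<psi>' x * a x \<partial>lborel)) \<le> M * (\<integral>x. \<bar>\<phi> n x - a x\<bar> \<partial>lborel)" by simp
  qed
  moreover have "(\<lambda>n. \<integral>x. \<psi> x * (grad (\<phi> n) x \<bullet> \<nu>) \<partial>lborel) \<longlonglongrightarrow> (\<integral>x. \<psi> x * (g x \<bullet> \<nu>) \<partial>lborel)"
  proof (rule LIM_zero_cancel, rule Lim_null_comparison[OF _ tendsto_mult_right_zero[OF L1g, of "M * norm \<nu>"]], rule always_eventually, rule allI)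
    fix n
    have le: "\<bar>\<psi> x * ((grad (\<phi> n) x - g x) \<bullet> \<nu>)\<bar> \<le> M * norm \<nu> * norm (grad (\<phi> n) x - g x)" for x
    proof -
      have "\<bar>\<psi> x\<bar> * \<bar>(grad (\<phi> n) x - g x) \<bullet> \<nu>\<bar> \<le> M * (norm (grad (\<phi> n) x - g x) * norm \<nu>)"
        by (intro mult_mono \<psi>(4) Cauchy_Schwarz_ineq2 M0) auto
      then show ?thesis by (simp add: abs_mult mult_ac)
    qed
    have "norm ((\<integral>x. \<psi> x * (grad (\<phi> n) x \<bullet> \<nu>) \<partial>lborel) - (\<integral>x. \<psi> x * (g x \<bullet> \<nu>) \<partial>lborel)) = \<bar>\<integral>x. \<psi> x * ((grad (\<phi> n) x - g x) \<bullet> \<nu>) \<partial>lborel\<bar>"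
      using mult_int[OF integrable_inner_left[OF int_\<phi>(2)[of n], of \<nu>] _ \<psi>(4)] mult_int[OF integrable_inner_left[OF int_g, of \<nu>] _ \<psi>(4)]
      by (simp add: right_diff_distrib inner_diff_left)
    also have "\<dots> \<le> (\<integral>x. \<bar>\<psi> x * ((grad (\<phi> n) x - g x) \<bullet> \<nu>)\<bar> \<partial>lborel)" by (rule integral_abs_bound)
    also have "\<dots> \<le> (\<integral>x. M * norm \<nu> * norm (grad (\<phi> n) x - g x) \<partial>lborel)"
      using int_\<phi>(2)[of n] int_g M0 le by (intro integral_mono') auto
    finally show "norm ((\<integral>x. \<psi> x * (grad (\<phi> n) x \<bullet> \<nu>) \<partial>lborel) - (\<integral>x. \<psi> x * (g x \<bullet> \<nu>) \<partial>lborel)) \<le> M * norm \<nu> * (\<integral>x. norm (grad (\<phi> n) x - g x) \<partial>lborel)" by simp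
  qed
  then have "(\<lambda>n. \<integral>x. \<psi>' x * \<phi> n x \<partial>lborel) \<longlonglongrightarrow> - (\<integral>x. \<psi> x * (g x \<bullet> \<nu>) \<partial>lborel)"
    unfolding parts by (rule tendsto_minus)
  ultimately show ?thesis
    using LIMSEQ_unique by (fastforce simp: mult.commute)
qed

section \<open>Borel representatives\<close>

text \<open>The notions of solution integrate against \<open>lebesgue\<close>, while translation,
  slicing and mollification work over \<open>lborel\<close>. An almost everywhere equal Borel
  function carries integrals from one to the other.\<close>

lemma lebesgue_integral_cong_lborel:
  fixes f g :: "'a::euclidean_space \<Rightarrow> 'b::euclidean_space"
  assumes g: "g \<in> borel_measurable borel" and ae: "AE x in lborel. f x = g x"
  shows "integral\<^sup>L lebesgue f = integral\<^sup>L lborel g" and "integrable lebesgue f \<longleftrightarrow> integrable lborel g"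
proof -
  have gl: "g \<in> borel_measurable lebesgue" using g by (simp add: measurable_completion)
  have ae': "AE x in lebesgue. g x = f x" using AE_completion[OF ae] by (simp add: eq_commute)
  have fl: "f \<in> borel_measurable lebesgue" by (rule borel_measurable_AE[OF gl ae'])
  have "integral\<^sup>L lebesgue f = integral\<^sup>L lebesgue g"
    using ae' by (intro integral_cong_AE fl gl) (auto simp: eq_commute)
  then show "integral\<^sup>L lebesgue f = integral\<^sup>L lborel g" using g by (simp add: integral_completion)
  have "integrable lebesgue f \<longleftrightarrow> integrable lebesgue g"
    using ae' by (intro integrable_cong_AE fl gl) (auto simp: eq_commute)
  then show "integrable lebesgue f \<longleftrightarrow> integrable lborel g" using g by (simp add: integrable_completion)
qed

text \<open>The existence of Borel versions is available for real functions, so it is applied to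
  each component. Multiplying by the indicator of Q performs the extension by zero in the same
  step.\<close>

lemma borel_representative:
  fixes k :: "'a::euclidean_space \<Rightarrow> 'b::euclidean_space"
  assumes k: "k \<in> borel_measurable (restrict_space lebesgue Q)" and Q: "open Q"
  obtains k' where "k' \<in> borel_measurable borel" "\<And>z. z \<notin> Q \<Longrightarrow> k' z = 0" "AE z in lborel. z \<in> Q \<longrightarrow> k' z = k z"
proof -
  have Q_b [measurable]: "Q \<in> sets borel" using Q by auto
  have "Q \<in> sets lebesgue" using Q_b by simp
  then have "(\<lambda>z. indicator Q z *\<^sub>R k z) \<in> borel_measurable lebesgue"
    using k by (subst (asm) borel_measurable_restrict_space_iff) auto
  then have m: "(\<lambda>z. (indicator Q z *\<^sub>R k z) \<bullet> b) \<in> borel_measurable lebesgue" for b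
    by (intro borel_measurable_inner borel_measurable_const)
  have "\<forall>b. \<exists>g. g \<in> borel_measurable borel \<and> (AE z in lborel. (indicator Q z *\<^sub>R k z) \<bullet> b = g z)"
  proof
    fix b
    obtain g where "g \<in> borel_measurable lborel" "AE z in lborel. (indicator Q z *\<^sub>R k z) \<bullet> b = g z"
      using completion_ex_borel_measurable_real[OF m[of b]] by blast
    then show "\<exists>g. g \<in> borel_measurable borel \<and> (AE z in lborel. (indicator Q z *\<^sub>R k z) \<bullet> b = g z)"
      by (intro exI[of _ g]) auto
  qed
  from choice[OF this] obtain g
    where g: "\<And>b. g b \<in> borel_measurable borel" "\<And>b. AE z in lborel. (indicator Q z *\<^sub>R k z) \<bullet> b = g b z"
    by blast
  define k' where "k' z = indicator Q z *\<^sub>R (\<Sum>b\<in>Basis. g b z *\<^sub>R b)" for z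
  have [measurable]: "g b \<in> borel_measurable borel" for b by (rule g)
  have "AE z in lborel. \<forall>b\<in>(Basis::'b set). (indicator Q z *\<^sub>R k z) \<bullet> b = g b z"
    using g(2) by (intro AE_finite_allI) auto
  then have "AE z in lborel. z \<in> Q \<longrightarrow> k' z = k z"
  proof eventually_elim
    case (elim z)
    show ?case
    proof
      assume z: "z \<in> Q"
      have "k' z = (\<Sum>b\<in>Basis. (k z \<bullet> b) *\<^sub>R b)"
        unfolding k'_def using z elim by (auto intro!: sum.cong)
      then show "k' z = k z" by (simp add: euclidean_representation)
    qed
  qed
  moreover have "k' \<in> borel_measurable borel" unfolding k'_def by measurable
  ultimately show ?thesis by (intro that[of k']) (auto simp: k'_def)
qed

lemma AE_lborel_slice:
  fixes P :: "'a::euclidean_space \<times> 'b::euclidean_space \<Rightarrow> bool"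
  assumes "AE z in lborel. P z"
  shows "AE t in lborel. AE x in lborel. P (x, t)"
proof -
  obtain N where N: "N \<in> null_sets lborel" "{z. \<not> P z} \<subseteq> N"
    using assms unfolding eventually_ae_filter by auto
  have "AE z in lborel \<Otimes>\<^sub>M (lborel::'b measure). z \<notin> N"
    unfolding lborel_prod by (rule AE_not_in[OF N(1)])
  then have "AE x in lborel. AE t in lborel. (x, t) \<notin> N" by (rule lborel_pair.AE_pair)
  \<comment> \<open>Exchanging the two quantifiers needs a measurable set, so the Borel null set
    \<open>N\<close> stands in for the exceptional set of \<open>P\<close>.\<close>
  moreover have set: "{z \<in> space (lborel \<Otimes>\<^sub>M lborel). (fst z, snd z) \<notin> N} \<in> sets (lborel \<Otimes>\<^sub>M (lborel::'b measure))"
  proof -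
    have "- N \<in> sets lborel" using N(1) by auto
    moreover have "{z \<in> space lborel. (fst z, snd z) \<notin> N} = - N" by auto
    ultimately show ?thesis unfolding lborel_prod by simp
  qed
  ultimately have "AE t in lborel. AE x in lborel. (x, t) \<notin> N"
    using lborel_pair.AE_commute[OF set] by blast
  then show ?thesis
  proof eventually_elim
    case (elim t)
    then show ?case by eventually_elim (use N(2) in auto)
  qed
qed

text \<open>Measurability of a z (G z) is not immediate since a is measurable for fixed \<xi> only.
  For simple functions in place of G there are finitely many \<xi>; continuity in \<xi> then passes
  to the limit off a null set.\<close>

lemma caratheodory_representative:
  fixes a :: "'a::euclidean_space \<times> real \<Rightarrow> 'a \<Rightarrow> 'a"
  assumes cara: "caratheodory Q a" and G: "G \<in> borel_measurable (restrict_space lebesgue Q)" and Q: "open Q"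
  obtains k where "k \<in> borel_measurable borel" "\<And>z. z \<notin> Q \<Longrightarrow> k z = 0" "AE z in lborel. z \<in> Q \<longrightarrow> k z = a z (G z)"
proof -
  let ?M = "restrict_space lebesgue Q"
  have sp: "space ?M = Q" by (simp add: space_restrict_space)
  obtain F where F: "\<And>i. simple_function ?M (F i)" "\<And>z. z \<in> Q \<Longrightarrow> (\<lambda>i. F i z) \<longlonglongrightarrow> G z"
    using borel_measurable_implies_sequence_metric[OF G, of 0] unfolding sp by blast
  have meas: "(\<lambda>z. a z (F i z)) \<in> borel_measurable ?M" for i
  proof (rule measurable_compose_countable'[where f = "\<lambda>\<xi> z. a z \<xi>" and I = "F i ` space ?M"])
    show "(\<lambda>z. a z \<xi>) \<in> borel_measurable ?M" for \<xi> using cara by (simp add: caratheodory_def)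
    show "F i \<in> measurable ?M (count_space (F i ` space ?M))" 
      using simple_functionD(2)[OF F(1)[of i]] by (auto simp: measurable_def)
  qed (use simple_functionD(1)[OF F(1)[of i]] in \<open>auto intro: countable_finite\<close>)
  have "AE z in lborel. z \<in> Q \<longrightarrow> continuous_on UNIV (a z)"
    using cara by (simp add: caratheodory_def AE_completion_iff)
  then obtain N where N: "N \<in> null_sets lborel" "{z. \<not> (z \<in> Q \<longrightarrow> continuous_on UNIV (a z))} \<subseteq> N"
    unfolding eventually_ae_filter by auto
  \<comment> \<open>On \<open>N\<close> continuity may fail and the approximation need not converge,
    so the value is reset to 0 there.\<close>
  define g where "g z = (if z \<in> N then 0 else a z (G z))" for z
  have N_M: "N \<inter> space ?M \<in> sets ?M"
    using N(1) Q by (auto simp: sets_restrict_space sp)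
  have "g \<in> borel_measurable ?M"
  proof (rule borel_measurable_LIMSEQ_metric)
    show "(\<lambda>z. if z \<in> N then 0 else a z (F i z)) \<in> borel_measurable ?M" for i
      using N_M by (intro measurable_If_set meas) auto
    fix z assume "z \<in> space ?M"
    then have z: "z \<in> Q" by (simp add: sp)
    show "(\<lambda>i. if z \<in> N then 0 else a z (F i z)) \<longlonglongrightarrow> g z"
    proof (cases "z \<in> N")
      case False
      then have "continuous_on UNIV (a z)" using N(2) z by auto
      then have "(\<lambda>i. a z (F i z)) \<longlonglongrightarrow> a z (G z)"
        by (rule continuous_on_tendsto_compose) (use F(2)[OF z] in auto)
      then show ?thesis using False by (simp add: g_def)
    qed (simp add: g_def)
  qed
  then obtain k where k: "k \<in> borel_measurable borel" "\<And>z. z \<notin> Q \<Longrightarrow> k z = 0" "AE z in lborel. z \<in> Q \<longrightarrow> k z = g z"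
    using borel_representative[OF _ Q] by blast
  have "AE z in lborel. z \<in> Q \<longrightarrow> k z = a z (G z)"
    using k(3) AE_not_in[OF N(1)] by eventually_elim (auto simp: g_def)
  with k show ?thesis by (intro that[of k]) auto
qed

text \<open>A solution in the form required by subtraction: Borel functions on the whole space that
  vanish outside the cylinder. The term with the initial datum keeps its original form because it
  only has to cancel.\<close>

locale energy_representative =
  fixes \<Omega> :: "'a::euclidean_space set" and T p :: real and a :: "'a \<times> real \<Rightarrow> 'a \<Rightarrow> 'a"
    and h :: "real \<Rightarrow> ennreal" and f :: "'a \<times> real \<Rightarrow> real" and u0 :: "'a \<Rightarrow> real"
    and u u' H' :: "'a \<times> real \<Rightarrow> real" and G' A' :: "'a \<times> real \<Rightarrow> 'a"
  assumes meas: "u' \<in> borel_measurable borel" "H' \<in> borel_measurable borel" "G' \<in> borel_measurable borel" "A' \<in> borel_measurable borel"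
    and zero: "\<And>z. z \<notin> \<Omega> \<times> {0<..<T} \<Longrightarrow> u' z = 0 \<and> H' z = 0 \<and> G' z = 0 \<and> A' z = 0"
    and int_u: "integrable lborel u'" and int_Gp: "integrable lborel (\<lambda>z. norm (G' z) powr p)"
    and int_Aq: "integrable lborel (\<lambda>z. norm (A' z) powr (p / (p - 1)))"
    and int_H: "\<And>K. compact K \<Longrightarrow> K \<subseteq> \<Omega> \<Longrightarrow> integrable lborel (\<lambda>z. indicator K (fst z) * H' z)"
    and weak_grad: "\<And>\<psi> \<psi>' \<nu> R. (\<And>z. ((\<lambda>s. \<psi> (z + s *\<^sub>R (\<nu>, 0))) has_real_derivative \<psi>' z) (at 0)) \<Longrightarrow>
        continuous_on UNIV \<psi> \<Longrightarrow> continuous_on UNIV \<psi>' \<Longrightarrow>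
        (\<And>z. norm z > R \<Longrightarrow> \<psi> z = 0) \<Longrightarrow> (\<And>z. norm z > R \<Longrightarrow> \<psi>' z = 0) \<Longrightarrow>
        (\<integral>z. u' z * \<psi>' z \<partial>lborel) = - (\<integral>z. \<psi> z * (G' z \<bullet> \<nu>) \<partial>lborel)"
    and weak_eq: "\<And>\<phi> D. (\<And>z. GDERIV \<phi> z :> D z) \<Longrightarrow> continuous_on UNIV D \<Longrightarrow>
        compact (csupp \<phi>) \<Longrightarrow> csupp \<phi> \<subseteq> \<Omega> \<times> {..<T} \<Longrightarrow>
        - (\<integral>z. u' z * snd (D z) \<partial>lborel) - (LINT x:\<Omega>|lebesgue. u0 x * \<phi> (x, 0)) + (\<integral>z. A' z \<bullet> fst (D z) \<partial>lborel) = (\<integral>z. H' z * \<phi> z \<partial>lborel)"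
    and ae: "AE z in lborel. z \<in> \<Omega> \<times> {0<..<T} \<longrightarrow> u' z = u z \<and> A' z = a z (G' z) \<and> 0 \<le> u z \<and>
        h (u z) * ennreal (f z) < \<infinity> \<and> H' z = enn2real (h (u z) * ennreal (f z))"

lemma finite_energy_representative:
  fixes \<Omega> :: "'a::euclidean_space set" and u :: "'a \<times> real \<Rightarrow> real"
  assumes \<Omega>: "open \<Omega>" "bounded \<Omega>" and p: "p > 1"
    and cara: "caratheodory (\<Omega> \<times> {0<..<T}) a"
    and growth: "AE z in lebesgue. z \<in> \<Omega> \<times> {0<..<T} \<longrightarrow> (\<forall>\<xi>. norm (a z \<xi>) \<le> \<beta> * norm \<xi> powr (p - 1))" and \<beta>: "\<beta> > 0"
    and u: "finite_energy_solution \<Omega> T p a h f u0 u"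
  obtains u' H' G' A' where "energy_representative \<Omega> T p a h f u0 u u' H' G' A'"
proof -
  define Q where "Q = \<Omega> \<times> {0<..<T}"
  have Q: "open Q" "bounded Q" "Q \<in> sets borel"
    using \<Omega> by (auto simp: Q_def intro!: open_Times bounded_Times borel_open)
  from u obtain G where ds: "dist_solution \<Omega> T a h f u0 u G"
    and int_u: "set_integrable lebesgue Q (\<lambda>z. \<bar>u z\<bar> powr p)"
    and int_G: "set_integrable lebesgue Q (\<lambda>z. norm (G z) powr p)"
    and approx: "AE t in lborel. t \<in> {0<..<T} \<longrightarrow>
        (\<exists>\<phi>s :: nat \<Rightarrow> 'a \<Rightarrow> real. (\<forall>n. test_fun \<Omega> (\<phi>s n)) \<and>
           (\<lambda>n. LINT x:\<Omega>|lebesgue. \<bar>\<phi>s n x - u (x, t)\<bar> powr p) \<longlonglongrightarrow> 0 \<and>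
           (\<lambda>n. LINT x:\<Omega>|lebesgue. norm (grad (\<phi>s n) x - G (x, t)) powr p) \<longlonglongrightarrow> 0)"
    unfolding finite_energy_solution_def Q_def by blast
  define hf where "hf z = h (u z) * ennreal (f z)" for z
  note d1 = ds[unfolded dist_solution_def, folded Q_def]
  note d2 = conjunct2[OF d1] note d3 = conjunct2[OF d2] note d4 = conjunct2[OF d3]
  note u_meas = conjunct1[OF d1] and G_meas = conjunct1[OF d2] and u_nonneg = conjunct1[OF d3]
  note local = conjunct1[OF d4, folded hf_def, rule_format]
    and eq = conjunct2[OF conjunct2[OF conjunct2[OF d4]], folded hf_def, rule_format]
  \<comment> \<open>Measurability of h(u) f is stated under a quantifier over compact sets; the
    empty set extracts it.\<close>
  have hf_meas: "hf \<in> borel_measurable (restrict_space lebesgue Q)"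
    using local[of "{}"] by (simp add: hf_def[abs_def])
  have hf_fin: "(\<integral>\<^sup>+ z. hf z * indicator (K \<times> {0<..<T}) z \<partial>lborel) < \<infinity>" if "compact K" "K \<subseteq> \<Omega>" for K
    using local[of K] that by (simp add: nn_integral_completion)
  obtain u' where u': "u' \<in> borel_measurable borel" "\<And>z. z \<notin> Q \<Longrightarrow> u' z = 0" "AE z in lborel. z \<in> Q \<longrightarrow> u' z = u z"
    using borel_representative[OF u_meas Q(1)] by blast
  obtain G' where G': "G' \<in> borel_measurable borel" "\<And>z. z \<notin> Q \<Longrightarrow> G' z = 0" "AE z in lborel. z \<in> Q \<longrightarrow> G' z = G z"
    using borel_representative[OF G_meas Q(1)] by blast
  have "(\<lambda>z. enn2real (hf z)) \<in> borel_measurable (restrict_space lebesgue Q)"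
    using hf_meas by (rule measurable_compose) measurable
  then obtain H' where H': "H' \<in> borel_measurable borel" "\<And>z. z \<notin> Q \<Longrightarrow> H' z = 0" "AE z in lborel. z \<in> Q \<longrightarrow> H' z = enn2real (hf z)"
    using borel_representative[OF _ Q(1)] by blast
  obtain A' where A': "A' \<in> borel_measurable borel" "\<And>z. z \<notin> Q \<Longrightarrow> A' z = 0" "AE z in lborel. z \<in> Q \<longrightarrow> A' z = a z (G z)"
    using caratheodory_representative[OF cara[folded Q_def] G_meas Q(1)] by blast
  note [measurable] = u'(1) G'(1) H'(1) A'(1)
  have int_u'p: "integrable lborel (\<lambda>z. \<bar>u' z\<bar> powr p)"
  proof -
    have "AE z in lborel. indicator Q z *\<^sub>R \<bar>u z\<bar> powr p = \<bar>u' z\<bar> powr p"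
      using u'(3) by eventually_elim (auto simp: indicator_def u'(2))
    then show ?thesis
      using int_u lebesgue_integral_cong_lborel(2)[of "\<lambda>z. \<bar>u' z\<bar> powr p" "\<lambda>z. indicator Q z *\<^sub>R \<bar>u z\<bar> powr p"]
      by (simp add: set_integrable_def)
  qed
  have int_G'p: "integrable lborel (\<lambda>z. norm (G' z) powr p)"
  proof -
    have "AE z in lborel. indicator Q z *\<^sub>R norm (G z) powr p = norm (G' z) powr p"
      using G'(3) by eventually_elim (auto simp: indicator_def G'(2))
    then show ?thesis
      using int_G lebesgue_integral_cong_lborel(2)[of "\<lambda>z. norm (G' z) powr p" "\<lambda>z. indicator Q z *\<^sub>R norm (G z) powr p"]
      by (simp add: set_integrable_def)
  qed
  have int_u': "integrable lborel u'"
    by (rule integrable_of_powr[of u' Q p]) (use Q u' int_u'p p in auto)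
  have A'_eq: "AE z in lborel. z \<in> Q \<longrightarrow> A' z = a z (G' z)"
    using A'(3) G'(3) by eventually_elim auto
  \<comment> \<open>The growth condition raised to the power p / (p - 1), since (p - 1) * (p / (p -
    1)) = p.\<close>
  have int_A'q: "integrable lborel (\<lambda>z. norm (A' z) powr (p / (p - 1)))"
  proof (rule Bochner_Integration.integrable_bound)
    show "integrable lborel (\<lambda>z. \<beta> powr (p / (p - 1)) * norm (G' z) powr p)" using int_G'p by simp
    have "AE z in lborel. z \<in> Q \<longrightarrow> (\<forall>\<xi>. norm (a z \<xi>) \<le> \<beta> * norm \<xi> powr (p - 1))"
      using growth by (simp add: AE_completion_iff Q_def)
    with A'_eq show "AE z in lborel. norm (norm (A' z) powr (p / (p - 1))) \<le> norm (\<beta> powr (p / (p - 1)) * norm (G' z) powr p)"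
    proof eventually_elim
      case (elim z)
      show ?case
      proof (cases "z \<in> Q")
        case True
        then have "norm (A' z) \<le> \<beta> * norm (G' z) powr (p - 1)" using elim by auto
        then have "norm (A' z) powr (p / (p - 1)) \<le> (\<beta> * norm (G' z) powr (p - 1)) powr (p / (p - 1))"
          using p by (intro powr_mono2) auto
        also have "\<dots> = \<beta> powr (p / (p - 1)) * norm (G' z) powr p"
          using p \<beta> by (simp add: powr_mult powr_powr)
        finally show ?thesis by simp
      qed (simp add: A'(2))
    qed
  qed measurable
  have int_H': "integrable lborel (\<lambda>z. indicator K (fst z) * H' z)" if K: "compact K" "K \<subseteq> \<Omega>" for K
  proof (rule integrableI_bounded)
    have K_b: "K \<in> sets borel" using K by (auto intro: borel_compact)
    have "(\<lambda>z. indicat_real K (fst z)) \<in> borel_measurable (borel :: ('a \<times> real) measure)"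
      by (rule measurable_compose[OF borel_measurable_fst_snd(1) borel_measurable_indicator[OF K_b]])
    then show "(\<lambda>z. indicator K (fst z) * H' z) \<in> borel_measurable lborel" by simp
    have "(\<integral>\<^sup>+ z. ennreal (norm (indicator K (fst z) * H' z)) \<partial>lborel) \<le> (\<integral>\<^sup>+ z. hf z * indicator (K \<times> {0<..<T}) z \<partial>lborel)"
    proof (rule nn_integral_mono_AE)
      show "AE z in lborel. ennreal (norm (indicator K (fst z) * H' z)) \<le> hf z * indicator (K \<times> {0<..<T}) z"
        using H'(3)
      proof eventually_elim
        case (elim z)
        show ?case
        proof (cases "z \<in> Q \<and> fst z \<in> K")
          case True
          then have "z \<in> K \<times> {0<..<T}" by (auto simp: Q_def mem_Times_iff)
          moreover have "ennreal (enn2real (hf z)) \<le> hf z"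
            by (cases "hf z" rule: ennreal_cases) auto
          ultimately show ?thesis using True elim by simp
        next
          case False
          then have "indicator K (fst z) * H' z = 0" using H'(2)[of z] by auto
          then show ?thesis by (simp only: norm_zero ennreal_0 zero_le)
        qed
      qed
    qed
    also have "\<dots> < \<infinity>" by (rule hf_fin[OF K])
    finally show "(\<integral>\<^sup>+ z. ennreal (norm (indicator K (fst z) * H' z)) \<partial>lborel) < \<infinity>" .
  qed
  \<comment> \<open>\<open>enn2real\<close> sends \<infinity> to 0, which would destroy the monotone
    dependence of h(u) f on u. Local integrability excludes infinite values almost everywhere on
    each compact set, and countably many compact sets exhaust \<Omega>.\<close>
  have hf_finite: "AE z in lborel. z \<in> Q \<longrightarrow> hf z < \<infinity>"
  proof -
    define K where "K n = {x. infdist x (- \<Omega>) \<ge> inverse (real (Suc n))}" for n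
    have K: "compact (K n)" "K n \<subseteq> \<Omega>" for n
      using infdist_Compl_ge_compact[OF \<Omega>(2), of "inverse (real (Suc n))"] by (auto simp: K_def)
    have "AE z in lebesgue. hf z * indicator Q z * indicator (K n \<times> {0<..<T}) z \<noteq> \<infinity>" for n
    proof (rule nn_integral_PInf_AE)
      \<comment> \<open>\<open>hf\<close> is measurable on Q only, hence the factor
        \<open>indicator Q\<close> before passing to the whole space.\<close>
      have hfQ: "(\<lambda>z. hf z * indicator Q z) \<in> borel_measurable lebesgue"
        using hf_meas Q(3) by (subst (asm) borel_measurable_restrict_space_iff_ennreal) auto
      have "K n \<times> {0<..<T} \<in> sets borel"
        using K(1)[of n] by (intro borel_Times) (auto intro: borel_compact)
      then have "K n \<times> {0<..<T} \<in> sets lebesgue" by simp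
      then have "(indicator (K n \<times> {0<..<T}) :: _ \<Rightarrow> ennreal) \<in> borel_measurable lebesgue"
        by (rule borel_measurable_indicator)
      then show "(\<lambda>z. hf z * indicator Q z * indicator (K n \<times> {0<..<T}) z) \<in> borel_measurable lebesgue"
        by (rule borel_measurable_times_ennreal[OF hfQ])
      have "(\<integral>\<^sup>+ z. hf z * indicator Q z * indicator (K n \<times> {0<..<T}) z \<partial>lebesgue) \<le> (\<integral>\<^sup>+ z. hf z * indicator (K n \<times> {0<..<T}) z \<partial>lebesgue)"
        by (intro nn_integral_mono) (auto simp: indicator_def)
      also have "\<dots> < \<infinity>" using hf_fin[OF K] by (simp add: nn_integral_completion)
      finally show "(\<integral>\<^sup>+ z. hf z * indicator Q z * indicator (K n \<times> {0<..<T}) z \<partial>lebesgue) \<noteq> \<infinity>" by simp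
    qed
    then have "AE z in lborel. \<forall>n. hf z * indicator Q z * indicator (K n \<times> {0<..<T}) z \<noteq> \<infinity>"
      unfolding AE_completion_iff AE_all_countable by blast
    then show ?thesis
    proof eventually_elim
      case (elim z)
      show ?case
      proof
        assume z: "z \<in> Q"
        then have "infdist (fst z) (- \<Omega>) > 0"
          using closed_Compl[OF \<Omega>(1)] bounded_Compl_nonempty[OF \<Omega>(2)] infdist_pos_not_in_closed[of "- \<Omega>" "fst z"]
          by (auto simp: Q_def)
        then obtain n where "inverse (real (Suc n)) < infdist (fst z) (- \<Omega>)" using reals_Archimedean by blast
        then have "z \<in> K n \<times> {0<..<T}" using z by (auto simp: K_def Q_def mem_Times_iff)
        then show "hf z < \<infinity>" using elim[rule_format, of n] z by (simp add: less_top)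
      qed
    qed
  qed
  have weak_grad: "(\<integral>z. u' z * \<psi>' z \<partial>lborel) = - (\<integral>z. \<psi> z * (G' z \<bullet> \<nu>) \<partial>lborel)"
    if \<psi>: "\<And>z. ((\<lambda>s. \<psi> (z + s *\<^sub>R (\<nu>, 0))) has_real_derivative \<psi>' z) (at 0)"
      "continuous_on UNIV \<psi>" "continuous_on UNIV \<psi>'" "\<And>z. norm z > R \<Longrightarrow> \<psi> z = 0" "\<And>z. norm z > R \<Longrightarrow> \<psi>' z = 0"
    for \<psi> \<psi>' \<nu> R
  proof -
    obtain M1 where M1: "\<And>z. norm (\<psi> z) \<le> M1" using bounded_continuous_cball[OF \<psi>(2) \<psi>(4)] by metis
    obtain M2 where M2: "\<And>z. norm (\<psi>' z) \<le> M2" using bounded_continuous_cball[OF \<psi>(3) \<psi>(5)] by metis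
    define M where "M = max M1 M2"
    have M: "\<bar>\<psi> z\<bar> \<le> M" "\<bar>\<psi>' z\<bar> \<le> M" for z using M1[of z] M2[of z] by (auto simp: M_def)
    note [measurable] = borel_measurable_continuous_onI[OF \<psi>(2)] borel_measurable_continuous_onI[OF \<psi>(3)]
    have int_G': "integrable lborel G'"
      by (rule integrable_of_powr[of G' Q p]) (use Q G' int_G'p p in auto)
    have i1: "integrable lborel (\<lambda>z. \<psi>' z * u' z)" by (rule integrable_bounded_mult[OF int_u' _ M(2)]) simp
    have i2: "integrable lborel (\<lambda>z. \<psi> z * (G' z \<bullet> \<nu>))"
      by (rule integrable_bounded_mult[OF integrable_inner_left[OF int_G'] _ M(1)]) simp
    have slice_int: "AE t in lborel. integrable lborel (\<lambda>x. f (x, t))" and slice_eq: "(\<integral>t. (\<integral>x. f (x, t) \<partial>lborel) \<partial>lborel) = (\<integral>z. f z \<partial>lborel)"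
      and slice_meas: "(\<lambda>t. \<integral>x. f (x, t) \<partial>lborel) \<in> borel_measurable lborel"
      if "integrable lborel f" for f :: "'a \<times> real \<Rightarrow> real"
    proof -
      have int: "integrable (lborel \<Otimes>\<^sub>M lborel) (case_prod (\<lambda>x t. f (x, t)))" using that by (simp add: lborel_prod)
      from lborel_pair.AE_integrable_snd[OF int] lborel_pair.integral_snd[OF int]
      show "AE t in lborel. integrable lborel (\<lambda>x. f (x, t))" "(\<integral>t. (\<integral>x. f (x, t) \<partial>lborel) \<partial>lborel) = (\<integral>z. f z \<partial>lborel)"
        by (simp_all add: lborel_prod)
      show "(\<lambda>t. \<integral>x. f (x, t) \<partial>lborel) \<in> borel_measurable lborel"
        using lborel_pair.integrable_snd[OF int] by (rule borel_measurable_integrable)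
    qed
    \<comment> \<open>The derivative is purely spatial, so t is a parameter: for almost every t the
      approximating sequence gives the identity on the slice, and integration over t
      finishes.\<close>
    have "AE t in lborel. (\<integral>x. \<psi>' (x, t) * u' (x, t) \<partial>lborel) = - (\<integral>x. \<psi> (x, t) * (G' (x, t) \<bullet> \<nu>) \<partial>lborel)"
      using approx AE_lborel_slice[OF u'(3)] AE_lborel_slice[OF G'(3)] slice_int[OF int_u'p] slice_int[OF int_G'p]
    proof eventually_elim
      case (elim t)
      show ?case
      proof (cases "t \<in> {0<..<T}")
        case False
        then have "u' (x, t) = 0" "G' (x, t) = 0" for x by (auto intro!: u'(2) G'(2) simp: Q_def)
        then show ?thesis by simp
      next
        case True
        with elim(1) obtain \<phi> :: "nat \<Rightarrow> 'a \<Rightarrow> real" where \<phi>: "\<And>n. test_fun \<Omega> (\<phi> n)"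
           "(\<lambda>n. LINT x:\<Omega>|lebesgue. \<bar>\<phi> n x - u (x, t)\<bar> powr p) \<longlonglongrightarrow> 0"
           "(\<lambda>n. LINT x:\<Omega>|lebesgue. norm (grad (\<phi> n) x - G (x, t)) powr p) \<longlonglongrightarrow> 0"
          by auto
        have mPair: "(\<lambda>x. (x, t)) \<in> borel_measurable (borel :: 'a measure)"
          by (intro borel_measurable_continuous_onI continuous_intros)
        have m1 [measurable]: "(\<lambda>x. u' (x, t)) \<in> borel_measurable borel" "(\<lambda>x. G' (x, t)) \<in> borel_measurable borel"
          using measurable_compose[OF mPair u'(1)] measurable_compose[OF mPair G'(1)] by auto
        have z0: "u' (x, t) = 0 \<and> G' (x, t) = 0" if "x \<notin> \<Omega>" for x using that by (auto intro!: u'(2) G'(2) simp: Q_def)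
        have \<phi>0: "\<phi> n x = 0" "grad (\<phi> n) x = 0" if "x \<notin> \<Omega>" for n x
        proof -
          have "x \<notin> csupp (\<phi> n)" using \<phi>(1)[of n] that by (auto simp: test_fun_def)
          from csupp_outside[OF this] test_fun_GDERIV(1)[OF \<phi>(1)] show "\<phi> n x = 0" "grad (\<phi> n) x = 0" by auto
        qed
        have [measurable]: "\<phi> n \<in> borel_measurable borel" "grad (\<phi> n) \<in> borel_measurable borel" for n
          using GDERIV_imp_continuous_on[OF test_fun_GDERIV(1)[OF \<phi>(1)]] test_fun_GDERIV(2)[OF \<phi>(1)]
          by (auto intro: borel_measurable_continuous_onI)
        have c1: "(LINT x:\<Omega>|lebesgue. \<bar>\<phi> n x - u (x, t)\<bar> powr p) = (\<integral>x. \<bar>\<phi> n x - u' (x, t)\<bar> powr p \<partial>lborel)" for n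
          unfolding set_lebesgue_integral_def
        proof (rule lebesgue_integral_cong_lborel(1))
          show "AE x in lborel. indicator \<Omega> x *\<^sub>R \<bar>\<phi> n x - u (x, t)\<bar> powr p = \<bar>\<phi> n x - u' (x, t)\<bar> powr p"
            using elim(2)
          proof eventually_elim
            case (elim x)
            then show ?case using True z0[of x] \<phi>0[of x n] by (cases "x \<in> \<Omega>") (auto simp: Q_def)
          qed
        qed measurable
        have c2: "(LINT x:\<Omega>|lebesgue. norm (grad (\<phi> n) x - G (x, t)) powr p) = (\<integral>x. norm (grad (\<phi> n) x - G' (x, t)) powr p \<partial>lborel)" for n
          unfolding set_lebesgue_integral_def
        proof (rule lebesgue_integral_cong_lborel(1))
          show "AE x in lborel. indicator \<Omega> x *\<^sub>R norm (grad (\<phi> n) x - G (x, t)) powr p = norm (grad (\<phi> n) x - G' (x, t)) powr p"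
            using elim(3)
          proof eventually_elim
            case (elim x)
            then show ?case using True z0[of x] \<phi>0[of x n] by (cases "x \<in> \<Omega>") (auto simp: Q_def)
          qed
        qed measurable
        have "(\<integral>x. u' (x, t) * \<psi>' (x, t) \<partial>lborel) = - (\<integral>x. \<psi> (x, t) * (G' (x, t) \<bullet> \<nu>) \<partial>lborel)"
        proof (rule weak_derivative_of_approximation[OF \<Omega> p m1 z0 elim(4,5) \<phi>(1) \<phi>(2)[unfolded c1] \<phi>(3)[unfolded c2]])
          show "((\<lambda>s. \<psi> (x + s *\<^sub>R \<nu>, t)) has_real_derivative \<psi>' (x, t)) (at 0)" for x
            using \<psi>(1)[of "(x, t)"] by simp
          show "continuous_on UNIV (\<lambda>x. \<psi> (x, t))" "continuous_on UNIV (\<lambda>x. \<psi>' (x, t))"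
            by (auto intro!: continuous_on_compose2[OF \<psi>(2)] continuous_on_compose2[OF \<psi>(3)] continuous_intros)
        qed (use M in auto)
        then show ?thesis by (simp add: mult.commute)
      qed
    qed
    then have "(\<integral>t. (\<integral>x. \<psi>' (x, t) * u' (x, t) \<partial>lborel) \<partial>lborel) = (\<integral>t. - (\<integral>x. \<psi> (x, t) * (G' (x, t) \<bullet> \<nu>) \<partial>lborel) \<partial>lborel)"
      by (intro integral_cong_AE slice_meas[OF i1] borel_measurable_uminus slice_meas[OF i2])
    then show ?thesis using slice_eq[OF i1] slice_eq[OF i2] by (simp add: mult.commute)
  qed
  have weak_eq: "- (\<integral>z. u' z * snd (D z) \<partial>lborel) - (LINT x:\<Omega>|lebesgue. u0 x * \<phi> (x, 0)) + (\<integral>z. A' z \<bullet> fst (D z) \<partial>lborel) = (\<integral>z. H' z * \<phi> z \<partial>lborel)"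
    if \<phi>: "\<And>z. GDERIV \<phi> z :> D z" "continuous_on UNIV D" "compact (csupp \<phi>)" "csupp \<phi> \<subseteq> \<Omega> \<times> {..<T}" for \<phi> D
  proof -
    have D_eq: "grad \<phi> = D" using grad_eqI[OF \<phi>(1)] by (rule ext)
    have [measurable]: "\<phi> \<in> borel_measurable borel" "D \<in> borel_measurable borel"
      using GDERIV_imp_continuous_on[OF \<phi>(1)] \<phi>(2) by (auto intro: borel_measurable_continuous_onI)
    have [measurable]: "(\<lambda>z. fst (D z)) \<in> borel_measurable borel" "(\<lambda>z. snd (D z)) \<in> borel_measurable borel"
      using \<phi>(2) by (auto intro!: borel_measurable_continuous_onI continuous_intros)
    have C1: "C1 \<phi>" using \<phi>(1,2) unfolding C1_def by blast
    have "(LINT z:Q|lebesgue. u z * snd (D z)) = (\<integral>z. u' z * snd (D z) \<partial>lborel)"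
      unfolding set_lebesgue_integral_def
    proof (rule lebesgue_integral_cong_lborel(1))
      show "AE z in lborel. indicator Q z *\<^sub>R (u z * snd (D z)) = u' z * snd (D z)"
        using u'(3) by eventually_elim (auto simp: indicator_def u'(2))
    qed measurable
    moreover have "(LINT z:Q|lebesgue. a z (G z) \<bullet> fst (D z)) = (\<integral>z. A' z \<bullet> fst (D z) \<partial>lborel)"
      unfolding set_lebesgue_integral_def
    proof (rule lebesgue_integral_cong_lborel(1))
      show "AE z in lborel. indicator Q z *\<^sub>R (a z (G z) \<bullet> fst (D z)) = A' z \<bullet> fst (D z)"
        using A'(3) by eventually_elim (auto simp: indicator_def A'(2))
    qed measurable
    moreover have "(LINT z:Q|lebesgue. enn2real (hf z) * \<phi> z) = (\<integral>z. H' z * \<phi> z \<partial>lborel)"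
      unfolding set_lebesgue_integral_def
    proof (rule lebesgue_integral_cong_lborel(1))
      show "AE z in lborel. indicator Q z *\<^sub>R (enn2real (hf z) * \<phi> z) = H' z * \<phi> z"
        using H'(3) by eventually_elim (auto simp: indicator_def H'(2))
    qed measurable
    ultimately show ?thesis using eq[of \<phi>] C1 \<phi>(3,4) unfolding D_eq by simp
  qed
  have ae: "AE z in lborel. z \<in> \<Omega> \<times> {0<..<T} \<longrightarrow> u' z = u z \<and> A' z = a z (G' z) \<and> 0 \<le> u z \<and>
        h (u z) * ennreal (f z) < \<infinity> \<and> H' z = enn2real (h (u z) * ennreal (f z))"
    using u'(3) A'_eq u_nonneg[unfolded AE_completion_iff] hf_finite H'(3)
    by eventually_elim (auto simp: Q_def hf_def)
  have "energy_representative \<Omega> T p a h f u0 u u' H' G' A'"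
  proof
    show "u' z = 0 \<and> H' z = 0 \<and> G' z = 0 \<and> A' z = 0" if "z \<notin> \<Omega> \<times> {0<..<T}" for z
      using that u'(2) H'(2) G'(2) A'(2) by (simp add: Q_def)
  qed (fact u'(1) H'(1) G'(1) A'(1) int_u' int_G'p int_A'q int_H' weak_grad weak_eq ae)+
  then show ?thesis by (rule that)
qed

section \<open>Uniqueness by subtracting the representatives of two solutions\<close>

theorem theorem4p1:
  fixes \<Omega> :: "'a::euclidean_space set"
    and T p \<alpha> \<beta> \<gamma> C s0 :: real
    and a :: "'a \<times> real \<Rightarrow> 'a \<Rightarrow> 'a"
    and h :: "real \<Rightarrow> ennreal"
    and f :: "'a \<times> real \<Rightarrow> real"
    and u0 :: "'a \<Rightarrow> real"
    and u v :: "'a \<times> real \<Rightarrow> real"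
  assumes N: "DIM('a) \<ge> 2"
    and dom: "smooth_domain \<Omega>"
    and T: "T > 0"
    and p: "2 - 1 / (real DIM('a) + 1) < p" "p < real DIM('a)"
    and ab: "\<alpha> > 0" "\<beta> > 0"
    and cara: "caratheodory (\<Omega> \<times> {0<..<T}) a"
    and struct: "AE z in lebesgue. z \<in> \<Omega> \<times> {0<..<T} \<longrightarrow>
          (\<forall>\<xi>. a z \<xi> \<bullet> \<xi> \<ge> \<alpha> * norm \<xi> powr p) \<and>
          (\<forall>\<xi>. norm (a z \<xi>) \<le> \<beta> * norm \<xi> powr (p - 1)) \<and>
          (\<forall>\<xi> \<eta>. \<xi> \<noteq> \<eta> \<longrightarrow> (a z \<xi> - a z \<eta>) \<bullet> (\<xi> - \<eta>) > 0)"
    and h_cont: "continuous_on {0..} h"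
    and h_fin: "\<forall>s>0. h s < \<infinity>"
    and h0: "h 0 \<noteq> 0"
    and hgrowth: "\<gamma> \<ge> 0" "C > 0" "s0 > 0" "\<forall>s. 0 < s \<and> s \<le> s0 \<longrightarrow> h s \<le> ennreal (C * s powr (- \<gamma>))"
    and h_bdd: "\<exists>M. \<forall>s\<ge>s0. h s \<le> ennreal M"
    and h_mono: "\<forall>s t. 0 \<le> s \<and> s \<le> t \<longrightarrow> h t \<le> h s"
    and f: "set_integrable lebesgue (\<Omega> \<times> {0<..<T}) f" "AE z in lebesgue. z \<in> \<Omega> \<times> {0<..<T} \<longrightarrow> f z \<ge> 0"
    and u0: "set_integrable lebesgue \<Omega> u0" "AE x in lebesgue. x \<in> \<Omega> \<longrightarrow> u0 x \<ge> 0"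
    and u: "finite_energy_solution \<Omega> T p a h f u0 u"
    and v: "finite_energy_solution \<Omega> T p a h f u0 v"
  shows "AE z in lebesgue. z \<in> \<Omega> \<times> {0<..<T} \<longrightarrow> u z = v z"
proof -
  let ?Q = "\<Omega> \<times> {0<..<T}"
  have \<Omega>: "open \<Omega>" "bounded \<Omega>" using dom by (auto simp: smooth_domain_def)
  have p1: "p > 1"
  proof -
    have "1 / (real DIM('a) + 1) \<le> 1" by simp
    then show ?thesis using p(1) by linarith
  qed
  have growth: "AE z in lebesgue. z \<in> ?Q \<longrightarrow> (\<forall>\<xi>. norm (a z \<xi>) \<le> \<beta> * norm \<xi> powr (p - 1))"
    using struct by eventually_elim blast
  obtain u1 H1 G1 A1 where "energy_representative \<Omega> T p a h f u0 u u1 H1 G1 A1"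
    using finite_energy_representative[OF \<Omega> p1 cara growth ab(2) u] by blast
  then interpret U: energy_representative \<Omega> T p a h f u0 u u1 H1 G1 A1 .
  obtain u2 H2 G2 A2 where "energy_representative \<Omega> T p a h f u0 v u2 H2 G2 A2"
    using finite_energy_representative[OF \<Omega> p1 cara growth ab(2) v] by blast
  then interpret V: energy_representative \<Omega> T p a h f u0 v u2 H2 G2 A2 .
  note [measurable] = U.meas V.meas
  have Q: "bounded ?Q" "?Q \<in> sets borel" using \<Omega> by (auto intro!: bounded_Times borel_open open_Times)
  have q1: "p / (p - 1) \<ge> 1" using p1 by (simp add: le_divide_eq)
  have intG: "integrable lborel G1" "integrable lborel G2"
    using U.zero V.zero U.int_Gp V.int_Gp p1 by (auto intro!: integrable_of_powr[OF _ Q, of _ p])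
  have intA: "integrable lborel A1" "integrable lborel A2"
    using U.zero V.zero U.int_Aq V.int_Aq q1 by (auto intro!: integrable_of_powr[OF _ Q, of _ "p / (p - 1)"])
  interpret difference_equation \<Omega> T p "\<lambda>z. u1 z - u2 z" "\<lambda>z. H1 z - H2 z" "\<lambda>z. G1 z - G2 z" "\<lambda>z. A1 z - A2 z"
  proof
    show "integrable lborel (\<lambda>z. norm (G1 z - G2 z) powr p)"
      using U.int_Gp V.int_Gp p1 by (intro integrable_powr_diff) auto
    show "integrable lborel (\<lambda>z. norm (A1 z - A2 z) powr (p / (p - 1)))"
      using U.int_Aq V.int_Aq q1 by (intro integrable_powr_diff) auto
    show "integrable lborel (\<lambda>z. indicator K (fst z) * (H1 z - H2 z))" if "compact K" "K \<subseteq> \<Omega>" for K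
      using U.int_H[OF that] V.int_H[OF that] by (simp add: right_diff_distrib)
    show "(\<integral>z. (u1 z - u2 z) * \<psi>' z \<partial>lborel) = - (\<integral>z. \<psi> z * ((G1 z - G2 z) \<bullet> \<nu>) \<partial>lborel)"
      if \<psi>: "\<And>z. ((\<lambda>s. \<psi> (z + s *\<^sub>R (\<nu>, 0))) has_real_derivative \<psi>' z) (at 0)"
        "continuous_on UNIV \<psi>" "continuous_on UNIV \<psi>'" "\<And>z. norm z > R \<Longrightarrow> \<psi> z = 0" "\<And>z. norm z > R \<Longrightarrow> \<psi>' z = 0"
      for \<psi> \<psi>' \<nu> R
    proof -
      obtain M1 where M1: "\<And>z. norm (\<psi> z) \<le> M1" using bounded_continuous_cball[OF \<psi>(2) \<psi>(4)] by metis
      obtain M2 where M2: "\<And>z. norm (\<psi>' z) \<le> M2" using bounded_continuous_cball[OF \<psi>(3) \<psi>(5)] by metis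
      have \<psi>m: "\<psi> \<in> borel_measurable borel" "\<psi>' \<in> borel_measurable borel"
        using \<psi>(2,3) by (auto intro: borel_measurable_continuous_onI)
      have "integrable lborel (\<lambda>z. \<psi>' z * u1 z)" "integrable lborel (\<lambda>z. \<psi>' z * u2 z)"
        "integrable lborel (\<lambda>z. \<psi> z * (G1 z \<bullet> \<nu>))" "integrable lborel (\<lambda>z. \<psi> z * (G2 z \<bullet> \<nu>))"
        using M1 M2 by (auto intro!: integrable_bounded_mult[OF _ \<psi>m(2), of _ M2] integrable_bounded_mult[OF _ \<psi>m(1), of _ M1]
            U.int_u V.int_u integrable_inner_left intG)
      then show ?thesis
        using U.weak_grad[OF \<psi>] V.weak_grad[OF \<psi>] by (simp add: left_diff_distrib right_diff_distrib inner_diff_left mult.commute[of _ "\<psi>' _"])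
    qed
    show "- (\<integral>z. (u1 z - u2 z) * snd (D z) \<partial>lborel) + (\<integral>z. (A1 z - A2 z) \<bullet> fst (D z) \<partial>lborel) = (\<integral>z. (H1 z - H2 z) * \<phi> z \<partial>lborel)"
      if \<phi>: "\<And>z. GDERIV \<phi> z :> D z" "continuous_on UNIV D" "compact (csupp \<phi>)" "csupp \<phi> \<subseteq> \<Omega> \<times> {..<T}" for \<phi> D
    proof -
      obtain R where R: "\<And>x. norm x > R \<Longrightarrow> x \<notin> csupp \<phi>" using bounded_csupp[OF \<phi>(3)] by metis
      have out: "\<phi> z = 0" "D z = 0" if "z \<notin> csupp \<phi>" for z using csupp_outside[OF that] \<phi>(1) by auto
      have cont: "continuous_on UNIV \<phi>" by (rule GDERIV_imp_continuous_on[OF \<phi>(1)])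
      obtain M where M: "\<And>z. norm (\<phi> z) \<le> M" using bounded_continuous_cball[OF cont] out(1) R by metis
      obtain M' where M': "\<And>z. norm (D z) \<le> M'" using bounded_continuous_cball[OF \<phi>(2)] out(2) R by metis
      have [measurable]: "\<phi> \<in> borel_measurable borel" using cont by (rule borel_measurable_continuous_onI)
      have sm: "(\<lambda>z. snd (D z)) \<in> borel_measurable borel" and [measurable]: "(\<lambda>z. fst (D z)) \<in> borel_measurable borel"
        using \<phi>(2) by (auto intro!: borel_measurable_continuous_onI continuous_intros)
      have Ms: "\<bar>snd (D z)\<bar> \<le> M'" for z using norm_snd_le[of "snd (D z)" "fst (D z)"] M'[of z] by simp
      have u_int: "integrable lborel (\<lambda>z. snd (D z) * u1 z)" "integrable lborel (\<lambda>z. snd (D z) * u2 z)"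
        using Ms by (auto intro!: integrable_bounded_mult[OF _ sm, of _ M'] U.int_u V.int_u)
      have A_int: "integrable lborel (\<lambda>z. B z \<bullet> fst (D z))" if B: "integrable lborel B" for B :: "'a \<times> real \<Rightarrow> 'a"
      proof (rule Bochner_Integration.integrable_bound)
        show "integrable lborel (\<lambda>z. M' * norm (B z))" using B by auto
        show "(\<lambda>z. B z \<bullet> fst (D z)) \<in> borel_measurable lborel" using borel_measurable_integrable[OF B] by simp
        have "\<bar>B z \<bullet> fst (D z)\<bar> \<le> M' * norm (B z)" for z
        proof -
          have "norm (fst (D z)) \<le> M'" using norm_fst_le[of "fst (D z)" "snd (D z)"] M'[of z] by simp
          then have "norm (B z) * norm (fst (D z)) \<le> norm (B z) * M'" by (intro mult_left_mono) auto
          then show ?thesis using Cauchy_Schwarz_ineq2[of "B z" "fst (D z)"] by (simp add: mult.commute)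
        qed
        then show "AE z in lborel. norm (B z \<bullet> fst (D z)) \<le> norm (M' * norm (B z))"
          by (auto intro!: AE_I2 order_trans[OF _ abs_ge_self])
      qed
      \<comment> \<open>The right-hand sides are integrable over K \<times> (0, T) for compact K in
        \<Omega> only; the spatial projection of the support of the test function is such a
        set.\<close>
      define K where "K = fst ` csupp \<phi>"
      have K: "compact K" "K \<subseteq> \<Omega>"
        using \<phi>(3,4) by (auto simp: K_def intro!: compact_continuous_image continuous_intros)
      have H_int: "integrable lborel (\<lambda>z. H z * \<phi> z)" if "integrable lborel (\<lambda>z. indicator K (fst z) * H z)" for H
      proof -
        have "integrable lborel (\<lambda>z. \<phi> z * (indicator K (fst z) * H z))"
          using M by (intro integrable_bounded_mult[OF that, of _ M]) auto
        moreover have "\<phi> z * (indicator K (fst z) * H z) = H z * \<phi> z" for z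
          using out(1)[of z] by (cases "z \<in> csupp \<phi>") (auto simp: K_def indicator_def)
        ultimately show ?thesis by simp
      qed
      show ?thesis
        using U.weak_eq[OF \<phi>] V.weak_eq[OF \<phi>] u_int A_int[OF intA(1)] A_int[OF intA(2)] H_int[OF U.int_H[OF K]] H_int[OF V.int_H[OF K]]
        by (simp add: left_diff_distrib right_diff_distrib inner_diff_left mult.commute[of _ "snd (D _)"])
    qed
    show "AE z in lborel. 0 \<le> (G1 z - G2 z) \<bullet> (A1 z - A2 z)"
      using struct[unfolded AE_completion_iff] U.ae V.ae
    proof eventually_elim
      case (elim z)
      show ?case
      proof (cases "z \<in> ?Q \<and> G1 z \<noteq> G2 z")
        case True
        then have "(a z (G1 z) - a z (G2 z)) \<bullet> (G1 z - G2 z) > 0" using elim(1) by blast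
        then show ?thesis using elim(2,3) True by (simp add: inner_commute[of "G1 z - G2 z"])
      next
        case False
        then show ?thesis using U.zero[of z] V.zero[of z] by auto
      qed
    qed
    show "AE z in lborel. (u1 z - u2 z) * (H1 z - H2 z) \<le> 0"
      using U.ae V.ae
    proof eventually_elim
      case (elim z)
      \<comment> \<open>The value of h at the smaller argument is the larger one, so its finiteness
        is what monotonicity of \<open>enn2real\<close> requires.\<close>
      have mono: "enn2real (h t * ennreal (f z)) \<le> enn2real (h s * ennreal (f z))"
        if "0 \<le> s" "s \<le> t" "h s * ennreal (f z) < \<infinity>" for s t
        using h_mono that by (intro enn2real_mono mult_right_mono) auto
      show ?case
      proof (cases "z \<in> ?Q")
        case True
        with elim have eqs: "u1 z = u z" "u2 z = v z" "0 \<le> u z" "0 \<le> v z"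
          "h (u z) * ennreal (f z) < \<infinity>" "h (v z) * ennreal (f z) < \<infinity>"
          "H1 z = enn2real (h (u z) * ennreal (f z))" "H2 z = enn2real (h (v z) * ennreal (f z))" by blast+
        show ?thesis
        proof (cases "u z \<le> v z")
          case True
          with mono[of "u z" "v z"] eqs show ?thesis by (intro mult_nonpos_nonneg) auto
        next
          case False
          with mono[of "v z" "u z"] eqs show ?thesis by (intro mult_nonneg_nonpos) auto
        qed
      next
        case False
        then show ?thesis using U.zero[OF False] V.zero[OF False] by simp
      qed
    qed
  qed (use \<Omega> p1 U.zero V.zero U.int_u V.int_u in auto)
  have "AE z in lborel. u1 z - u2 z = 0" by (rule vanishes[OF dom T])
  with U.ae V.ae have "AE z in lborel. z \<in> ?Q \<longrightarrow> u z = v z"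
    by eventually_elim auto
  then show ?thesis by (rule AE_completion)
qed

end
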